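(* Let $\beta>1$ be a Pisot number and let $n\ge 1$. If $X\subseteq\mathbb{R}^n$ is $\beta$-definable, then $X$ is $\beta$-recognizable.
   Context: A Pisot number is a real algebraic integer greater than $1$ all of whose (other) Galois conjugates have modulus less than $1$. Let $\beta>1$ be a real number. Expansions in dimension one. Let $A_\beta=\{0,1,\ldots,\lceil\beta\rceil-1\}$. For a real number $x\ge 0$, the $\beta$-expansion of $x$ is the infinite word $d_\beta(x)=x_k\cdots x_1x_0\star x_{-1}x_{-2}\cdots$ over $A_\beta\cup\{\star\}$, where $k\ge 0$ is minimal such that $x=\sum_{-\infty<i\le k}x_i\beta^i$ with $x_i\in A_\beta$ for all $i\le k$ and $\sum_{-\infty<i\le \ell}x_i\beta^i<\beta^{\ell+1}$ for all $\ell\le k$. For $x<0$, $d_\beta(x)$ is the word obtained from $d_\beta(-x)$ by replacing each digit $a$ by $-a$. Put $\tilde{A}_\beta=\{-(\lceil\beta\rceil-1),\ldots,0,\ldots,\lceil\beta\rceil-1\}$. Expansions in dimension $n$. Let $\mathbf{\tilde{A}}_\beta=(\tilde{A}_\beta)^n$, $\boldsymbol{\star}=(\star,\ldots,\star)$, $\mathbf{0}=(0,\ldots,0)$. For $\mathbf{x}=(x_1,\ldots,x_n)\in\mathbb{R}^n$, $d_\beta(\mathbf{x})$ is the word over $\mathbf{\tilde{A}}_\beta\cup\{\boldsymbol{\star}\}$ whose $i$th component belongs to $0^*d_\beta(x_i)$ for each $i$ (leading zeroes are added so that all the symbols $\star$ occur at the same position) and which does not start with $\mathbf{0}$, except if $|x_i|<1$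 for all $i$, in which case the word starting with $\mathbf{0}\boldsymbol{\star}$ is chosen. For $X\subseteq\mathbb{R}^n$, $d_\beta(X)=\{d_\beta(\mathbf{x})\mid\mathbf{x}\in X\}$. Büchi automata. A Büchi automaton over a finite alphabet $A$ is a tuple $(Q,A,E,I,T)$ with $Q$ a finite set of states, $E\subseteq Q\times A\times Q$ the transitions, $I\subseteq Q$ the initial states and $T\subseteq Q$ the terminal states. It accepts an infinite word $u\in A^\omega$ if $u$ labels an infinite path starting in a state of $I$ and visiting $T$ infinitely often; its accepted language is the set of accepted infinite words. A set $X\subseteq\mathbb{R}^n$ is $\beta$-recognizable if some Büchi automaton over $\mathbf{\tilde{A}}_\beta\cup\{\boldsymbol{\star}\}$ accepts exactly the language $d_\beta(X)$. Definability. For $a\in\tilde{A}_\beta$, the binary predicate $X_{\beta,a}(x,y)$ on $\mathbb{R}^2$ holds if and only if $y$ is an integral power of $\beta$ and either $|x|<y$ and $a=0$, or $|x|\ge y$ and the digit of $d_\beta(x)=x_k\cdots x_0\star x_{-1}\cdots$ corresponding to $y$ is $a$ (that is, $y=\beta^i$ for some $i\le k$ and $x_i=a$). Let $X_\beta=\{X_{\beta,a}\mid a\in\tilde{A}_\beta\}$. A set $X\subseteq\mathbb{R}^n$ is $\beta$-definable if it is defined by a first order formula in the structure $\langle\mathbb{R},1,\le,+,X_\beta\rangle$. *)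

theory Defs
  imports
    "HOL-Analysis.Analysis"
    "HOL-Computational_Algebra.Computational_Algebra"
    "HOL-Library.Omega_Words_Fun"
begin

section \<open>Pisot numbers\<close>

text \<open>Up to a constant factor, an irreducible rational polynomial vanishing at \<open>\<beta>\<close> is the minimal
  polynomial of \<open>\<beta>\<close>.\<close>

definition galois_conjugate :: "real \<Rightarrow> complex \<Rightarrow> bool" where
  "galois_conjugate \<beta> z \<longleftrightarrow>
     (\<exists>p :: rat poly. irreducible p \<and> poly (map_poly of_rat p) \<beta> = 0
                        \<and> poly (map_poly of_rat p) z = 0)"

definition pisot :: "real \<Rightarrow> bool" where
  "pisot \<beta> \<longleftrightarrow> algebraic_int \<beta> \<and> \<beta> > 1 \<and>
     (\<forall>z. galois_conjugate \<beta> z \<and> z \<noteq> complex_of_real \<beta> \<longrightarrow> cmod z < 1)"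

section \<open>Expansions of real numbers\<close>

definition digits :: "real \<Rightarrow> int set" where
  "digits \<beta> = {0..\<lceil>\<beta>\<rceil> - 1}"

definition signed_digits :: "real \<Rightarrow> int set" where
  "signed_digits \<beta> = {- (\<lceil>\<beta>\<rceil> - 1)..\<lceil>\<beta>\<rceil> - 1}"

text \<open>\<open>beta_rep \<beta> x k d\<close> constrains the digits \<open>d i\<close> with \<open>i \<le> k\<close> only.\<close>

definition beta_rep :: "real \<Rightarrow> real \<Rightarrow> nat \<Rightarrow> (int \<Rightarrow> int) \<Rightarrow> bool" where
  "beta_rep \<beta> x k d \<longleftrightarrow>
     (\<forall>i \<le> int k. d i \<in> digits \<beta>) \<and>
     ((\<lambda>i. of_int (d i) * \<beta> powi i) has_sum x) {..int k} \<and>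
     (\<forall>l \<le> int k. (\<Sum>\<^sub>\<infinity>i\<in>{..l}. of_int (d i) * \<beta> powi i) < \<beta> powi (l + 1))"

definition top_index :: "real \<Rightarrow> real \<Rightarrow> nat" where
  "top_index \<beta> x = (LEAST k. \<exists>d. beta_rep \<beta> \<bar>x\<bar> k d)"

text \<open>Digits to the left of the leading one are not part of the expansion; setting them to zero makes
  the digit function unique.\<close>

definition abs_digit :: "real \<Rightarrow> real \<Rightarrow> int \<Rightarrow> int" where
  "abs_digit \<beta> x =
     (THE d. beta_rep \<beta> \<bar>x\<bar> (top_index \<beta> x) d \<and> (\<forall>i > int (top_index \<beta> x). d i = 0))"

definition beta_digit :: "real \<Rightarrow> real \<Rightarrow> int \<Rightarrow> int" where
  "beta_digit \<beta> x i = (if x < 0 then - abs_digit \<beta> x i else abs_digit \<beta> x i)"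

datatype symb = Digit int | Star

definition expansion :: "real \<Rightarrow> real \<Rightarrow> symb word" where
  "expansion \<beta> x =
     (let k = top_index \<beta> x in
        map (\<lambda>j. Digit (beta_digit \<beta> x (int k - int j))) [0..<Suc k] \<frown> [Star] \<frown>
        (\<lambda>j. Digit (beta_digit \<beta> x (- 1 - int j))))"

section \<open>Expansions of vectors\<close>

text \<open>Since a first-order formula relates sets of different dimensions, the space of real vectors of
  dimension \<open>n\<close> is the set of real lists of length \<open>n\<close>. A letter in dimension \<open>n\<close> is likewise a list of
  length \<open>n\<close>, so that the \<open>i\<close>th component of a word \<open>w\<close> is \<open>\<lambda>j. w j ! i\<close>.\<close>

definition vectors :: "nat \<Rightarrow> real list set" where
  "vectors n = {xs. length xs = n}"

definition star_letter :: "nat \<Rightarrow> symb list" where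
  "star_letter n = replicate n Star"

definition zero_letter :: "nat \<Rightarrow> symb list" where
  "zero_letter n = replicate n (Digit 0)"

definition vec_alphabet :: "real \<Rightarrow> nat \<Rightarrow> symb list set" where
  "vec_alphabet \<beta> n =
     {map Digit ds | ds. length ds = n \<and> set ds \<subseteq> signed_digits \<beta>} \<union> {star_letter n}"

definition is_vec_expansion :: "real \<Rightarrow> real list \<Rightarrow> symb list word \<Rightarrow> bool" where
  "is_vec_expansion \<beta> xs w \<longleftrightarrow>
     (\<forall>j. w j \<in> vec_alphabet \<beta> (length xs)) \<and>
     (\<forall>i < length xs. \<exists>m. (\<lambda>j. w j ! i) = replicate m (Digit 0) \<frown> expansion \<beta> (xs ! i)) \<and>
     (if \<forall>i < length xs. \<bar>xs ! i\<bar> < 1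
      then w 0 = zero_letter (length xs) \<and> w 1 = star_letter (length xs)
      else w 0 \<noteq> zero_letter (length xs))"

definition vec_expansion :: "real \<Rightarrow> real list \<Rightarrow> symb list word" where
  "vec_expansion \<beta> xs = (THE w. is_vec_expansion \<beta> xs w)"

section \<open>Buechi automata\<close>

record ('q, 'a) buchi =
  states :: "'q set"
  transitions :: "('q \<times> 'a \<times> 'q) set"
  initial :: "'q set"
  terminal :: "'q set"

definition buchi_automaton :: "'a set \<Rightarrow> ('q, 'a) buchi \<Rightarrow> bool" where
  "buchi_automaton A M \<longleftrightarrow>
     finite A \<and> finite (states M) \<and> transitions M \<subseteq> states M \<times> A \<times> states M \<and>
     initial M \<subseteq> states M \<and> terminal M \<subseteq> states M"

definition accepts :: "('q, 'a) buchi \<Rightarrow> 'a word \<Rightarrow> bool" where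
  "accepts M u \<longleftrightarrow>
     (\<exists>r :: 'q word. r 0 \<in> initial M \<and> (\<forall>j. (r j, u j, r (Suc j)) \<in> transitions M) \<and>
        (\<exists>\<^sub>\<infinity>j. r j \<in> terminal M))"

definition language :: "('q, 'a) buchi \<Rightarrow> 'a word set" where
  "language M = {u. accepts M u}"

text \<open>Naming the states by natural numbers is no restriction, as the state set is finite.\<close>

definition beta_recognizable :: "real \<Rightarrow> nat \<Rightarrow> real list set \<Rightarrow> bool" where
  "beta_recognizable \<beta> n X \<longleftrightarrow> X \<subseteq> vectors n \<and>
     (\<exists>M :: (nat, symb list) buchi. buchi_automaton (vec_alphabet \<beta> n) M \<and>
        language M = vec_expansion \<beta> ` X)"

section \<open>Definability\<close>

definition digit_pred :: "real \<Rightarrow> int \<Rightarrow> real \<Rightarrow> real \<Rightarrow> bool" where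
  "digit_pred \<beta> a x y \<longleftrightarrow>
     (\<exists>i :: int. y = \<beta> powi i) \<and>
     (\<bar>x\<bar> < y \<and> a = 0 \<or>
      \<bar>x\<bar> \<ge> y \<and> (\<exists>i \<le> int (top_index \<beta> x). y = \<beta> powi i \<and> beta_digit \<beta> x i = a))"

datatype fo_term = Var nat | One | Plus fo_term fo_term

datatype formula =
    Eq fo_term fo_term
  | Le fo_term fo_term
  | DigitAt int fo_term fo_term
  | Neg formula
  | Conj formula formula
  | Disj formula formula
  | Impl formula formula
  | Exists nat formula
  | Forall nat formula

primrec term_val :: "(nat \<Rightarrow> real) \<Rightarrow> fo_term \<Rightarrow> real" where
  "term_val \<rho> (Var v) = \<rho> v"
| "term_val \<rho> One = 1"
| "term_val \<rho> (Plus s t) = term_val \<rho> s + term_val \<rho> t"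

primrec sat :: "real \<Rightarrow> (nat \<Rightarrow> real) \<Rightarrow> formula \<Rightarrow> bool" where
  "sat \<beta> \<rho> (Eq s t) \<longleftrightarrow> term_val \<rho> s = term_val \<rho> t"
| "sat \<beta> \<rho> (Le s t) \<longleftrightarrow> term_val \<rho> s \<le> term_val \<rho> t"
| "sat \<beta> \<rho> (DigitAt a s t) \<longleftrightarrow> digit_pred \<beta> a (term_val \<rho> s) (term_val \<rho> t)"
| "sat \<beta> \<rho> (Neg \<phi>) \<longleftrightarrow> \<not> sat \<beta> \<rho> \<phi>"
| "sat \<beta> \<rho> (Conj \<phi> \<psi>) \<longleftrightarrow> sat \<beta> \<rho> \<phi> \<and> sat \<beta> \<rho> \<psi>"
| "sat \<beta> \<rho> (Disj \<phi> \<psi>) \<longleftrightarrow> sat \<beta> \<rho> \<phi> \<or> sat \<beta> \<rho> \<psi>"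
| "sat \<beta> \<rho> (Impl \<phi> \<psi>) \<longleftrightarrow> (sat \<beta> \<rho> \<phi> \<longrightarrow> sat \<beta> \<rho> \<psi>)"
| "sat \<beta> \<rho> (Exists v \<phi>) \<longleftrightarrow> (\<exists>x. sat \<beta> (\<rho>(v := x)) \<phi>)"
| "sat \<beta> \<rho> (Forall v \<phi>) \<longleftrightarrow> (\<forall>x. sat \<beta> (\<rho>(v := x)) \<phi>)"

primrec term_vars :: "fo_term \<Rightarrow> nat set" where
  "term_vars (Var v) = {v}"
| "term_vars One = {}"
| "term_vars (Plus s t) = term_vars s \<union> term_vars t"

primrec free_vars :: "formula \<Rightarrow> nat set" where
  "free_vars (Eq s t) = term_vars s \<union> term_vars t"
| "free_vars (Le s t) = term_vars s \<union> term_vars t"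
| "free_vars (DigitAt a s t) = term_vars s \<union> term_vars t"
| "free_vars (Neg \<phi>) = free_vars \<phi>"
| "free_vars (Conj \<phi> \<psi>) = free_vars \<phi> \<union> free_vars \<psi>"
| "free_vars (Disj \<phi> \<psi>) = free_vars \<phi> \<union> free_vars \<psi>"
| "free_vars (Impl \<phi> \<psi>) = free_vars \<phi> \<union> free_vars \<psi>"
| "free_vars (Exists v \<phi>) = free_vars \<phi> - {v}"
| "free_vars (Forall v \<phi>) = free_vars \<phi> - {v}"

primrec digit_symbols :: "formula \<Rightarrow> int set" where
  "digit_symbols (Eq s t) = {}"
| "digit_symbols (Le s t) = {}"
| "digit_symbols (DigitAt a s t) = {a}"
| "digit_symbols (Neg \<phi>) = digit_symbols \<phi>"
| "digit_symbols (Conj \<phi> \<psi>) = digit_symbols \<phi> \<union> digit_symbols \<psi>"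
| "digit_symbols (Disj \<phi> \<psi>) = digit_symbols \<phi> \<union> digit_symbols \<psi>"
| "digit_symbols (Impl \<phi> \<psi>) = digit_symbols \<phi> \<union> digit_symbols \<psi>"
| "digit_symbols (Exists v \<phi>) = digit_symbols \<phi>"
| "digit_symbols (Forall v \<phi>) = digit_symbols \<phi>"

text \<open>The coordinate \<open>xs ! i\<close> interprets variable \<open>i\<close>; values of \<open>(!)\<close> beyond the length of \<open>xs\<close> are
  never used because the free variables lie below \<open>n\<close>.\<close>

definition beta_definable :: "real \<Rightarrow> nat \<Rightarrow> real list set \<Rightarrow> bool" where
  "beta_definable \<beta> n X \<longleftrightarrow>
     (\<exists>\<phi>. free_vars \<phi> \<subseteq> {..<n} \<and> digit_symbols \<phi> \<subseteq> signed_digits \<beta> \<and>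
          X = {xs \<in> vectors n. sat \<beta> (\<lambda>i. xs ! i) \<phi>})"

end

theory Submission
  imports Defs "HOL-Library.Ramsey"
begin


text \<open>
  The theorem holds because every first-order formula of the structure can be compiled, by induction
  on the formula, into a finite automaton that reads expansions. Two facts make this possible.

  First, the Buechi-recognizable predicates on infinite words form a Boolean algebra that is closed
  under projection. Negation is the difficult case: by Ramsey's theorem every infinite word factors
  into blocks that, from the second one on, all act in the same way on the states of a given
  automaton, and acceptance depends only on the actions involved (\<open>omega_regular_Not\<close>). The alphabet
  may be infinite throughout, since only the set of states has to be finite; a letter can therefore
  carry one digit for every variable at once.

  Second, for a Pisot number a finite automaton can find the sign of \<open>\<Sum>\<^sub>j c\<^sub>j \<beta>\<^sup>-\<^sup>j\<^sup>-\<^sup>1\<close> for integers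
  \<open>c\<^sub>j\<close> that are bounded but otherwise arbitrary. Horner's scheme turns the digits into the partial sums
  \<open>s\<^sub>m = \<Sum>\<^sub>j\<^sub><\<^sub>m c\<^sub>j \<beta>\<^sup>m\<^sup>-\<^sup>1\<^sup>-\<^sup>j\<close>. As soon as \<open>\<bar>s\<^sub>m\<bar>\<close> exceeds the largest possible contribution of the
  digits still to come, the sign is decided. The values \<open>s\<^sub>m\<close> below this threshold are finitely many
  (\<open>finite_bounded_pisot_values\<close>): they are values at \<open>\<beta>\<close> of integer polynomials with bounded
  coefficients, whose values at the other conjugates are bounded too, because those have modulus less
  than 1. Interpolation at all the conjugates then bounds the coefficients of the remainder modulo the
  minimal polynomial, and these coefficients have a common denominator.

  The sign test settles everything about numbers. A digit word is an expansion exactly when all its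
  tails have value less than 1, so being an expansion is omega-regular. An equation or inequality
  between terms compares two linear combinations of expansions, and such a combination is again a
  word of bounded integers; addition needs no normalization of digits. The digit predicate is local,
  because the expansion of a power of \<open>\<beta>\<close> has a single nonzero digit. For an existential quantifier
  one projects the track of the quantified variable away, after prepending zeros, since the witness
  may need more digits to the left of the radix point than the free variables
  (\<open>omega_regular_exists\<close>).

  In this induction the radix point is a mark on the units digit and any number of leading zeros is
  allowed. At the end the mark is turned into a separate letter (\<open>omega_regular_insert_star\<close>) and the
  words with superfluous leading zeros are discarded.
\<close>


section \<open>Omega-regular predicates\<close>

definition buchi_accepts ::
  "'q set \<Rightarrow> ('q \<Rightarrow> 'a \<Rightarrow> 'q \<Rightarrow> bool) \<Rightarrow> 'q set \<Rightarrow> 'q set \<Rightarrow> 'a word \<Rightarrow> bool" where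
  "buchi_accepts Q \<delta> I F w \<longleftrightarrow>
     (\<exists>r. r 0 \<in> I \<and> (\<forall>j. r j \<in> Q \<and> \<delta> (r j) (w j) (r (Suc j))) \<and> (\<exists>\<^sub>\<infinity>j. r j \<in> F))"

text \<open>Predicates instead of languages, so that the closure properties read like the introduction
  rules of a logic. Only the set of states has to be finite; the alphabet may be infinite.\<close>

definition omega_regular :: "('a word \<Rightarrow> bool) \<Rightarrow> bool" where
  "omega_regular P \<longleftrightarrow>
     (\<exists>(Q :: nat set) \<delta> I F. finite Q \<and> (\<forall>w. P w \<longleftrightarrow> buchi_accepts Q \<delta> I F w))"

lemma omega_regularE:
  assumes "omega_regular P"
  obtains Q :: "nat set" and \<delta> I F where "finite Q" "\<And>w. P w \<longleftrightarrow> buchi_accepts Q \<delta> I F w"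
  using assms unfolding omega_regular_def by blast

lemma omega_regularI:
  fixes Q :: "'q set"
  assumes fin: "finite Q" and P: "\<And>w. P w \<longleftrightarrow> buchi_accepts Q \<delta> I F w"
  shows "omega_regular P"
proof -
  obtain f :: "'q \<Rightarrow> nat" where f: "inj_on f Q"
    using finite_imp_inj_to_nat_seg[OF fin] by blast
  define g where "g = inv_into Q f"
  have gf [simp]: "g (f q) = q" if "q \<in> Q" for q
    using f that by (simp add: g_def)
  have "P w \<longleftrightarrow> buchi_accepts (f ` Q) (\<lambda>p a q. \<delta> (g p) a (g q)) (f ` (Q \<inter> I)) (f ` (Q \<inter> F)) w" for w
  proof
    assume "P w"
    then obtain r where r: "r 0 \<in> I" "\<And>j. r j \<in> Q" "\<And>j. \<delta> (r j) (w j) (r (Suc j))" "\<exists>\<^sub>\<infinity>j. r j \<in> F"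
      unfolding P buchi_accepts_def by blast
    have "\<exists>\<^sub>\<infinity>j. f (r j) \<in> f ` (Q \<inter> F)"
      using r(4) by (rule INFM_mono) (use r(2) in blast)
    then show "buchi_accepts (f ` Q) (\<lambda>p a q. \<delta> (g p) a (g q)) (f ` (Q \<inter> I)) (f ` (Q \<inter> F)) w"
      unfolding buchi_accepts_def
      by (intro exI[of _ "\<lambda>j. f (r j)"]) (use r in auto)
  next
    assume "buchi_accepts (f ` Q) (\<lambda>p a q. \<delta> (g p) a (g q)) (f ` (Q \<inter> I)) (f ` (Q \<inter> F)) w"
    then obtain r where r: "r 0 \<in> f ` (Q \<inter> I)" "\<And>j. r j \<in> f ` Q"
        "\<And>j. \<delta> (g (r j)) (w j) (g (r (Suc j)))" "\<exists>\<^sub>\<infinity>j. r j \<in> f ` (Q \<inter> F)"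
      unfolding buchi_accepts_def by blast
    have "\<exists>\<^sub>\<infinity>j. g (r j) \<in> F"
      using r(4) by (rule INFM_mono) auto
    moreover have "g (r j) \<in> Q" for j
      using r(2)[of j] by auto
    ultimately show "P w"
      unfolding P buchi_accepts_def
      by (intro exI[of _ "\<lambda>j. g (r j)"]) (use r in auto)
  qed
  with fin show ?thesis
    unfolding omega_regular_def by (meson finite_imageI)
qed

lemma omega_regular_vimage:
  assumes "omega_regular P"
  shows "omega_regular (\<lambda>w. P (\<lambda>j. f (w j)))"
proof -
  obtain Q :: "nat set" and \<delta> I F where *: "finite Q" "\<And>w. P w \<longleftrightarrow> buchi_accepts Q \<delta> I F w"
    using assms by (rule omega_regularE) blast
  show ?thesis
    by (rule omega_regularI[OF *(1), where \<delta> = "\<lambda>p a q. \<delta> p (f a) q"]) (simp add: *(2) buchi_accepts_def)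
qed

lemma omega_regular_ex_track:
  assumes "omega_regular P"
  shows "omega_regular (\<lambda>w. \<exists>u. P (\<lambda>j. (w j, u j)))"
proof -
  obtain Q :: "nat set" and \<delta> I F where *: "finite Q" "\<And>w. P w \<longleftrightarrow> buchi_accepts Q \<delta> I F w"
    using assms by (rule omega_regularE) blast
  show ?thesis
  proof (rule omega_regularI[OF *(1), where \<delta> = "\<lambda>p a q. \<exists>b. \<delta> p (a, b) q"])
    fix w
    show "(\<exists>u. P (\<lambda>j. (w j, u j))) \<longleftrightarrow> buchi_accepts Q (\<lambda>p a q. \<exists>b. \<delta> p (a, b) q) I F w"
    proof
      assume "buchi_accepts Q (\<lambda>p a q. \<exists>b. \<delta> p (a, b) q) I F w"
      then obtain r where r: "r 0 \<in> I" "\<exists>\<^sub>\<infinity>j. r j \<in> F"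
          "\<forall>j. \<exists>b. r j \<in> Q \<and> \<delta> (r j) (w j, b) (r (Suc j))"
        unfolding buchi_accepts_def by blast
      from choice[OF r(3)] obtain u where "\<forall>j. r j \<in> Q \<and> \<delta> (r j) (w j, u j) (r (Suc j))" ..
      with r show "\<exists>u. P (\<lambda>j. (w j, u j))"
        unfolding * buchi_accepts_def by blast
    qed (auto simp: * buchi_accepts_def)
  qed
qed

lemma omega_regular_disj:
  assumes "omega_regular P" "omega_regular P'"
  shows "omega_regular (\<lambda>w. P w \<or> P' w)"
proof -
  obtain Q :: "nat set" and \<delta> I F where *: "finite Q" "\<And>w. P w \<longleftrightarrow> buchi_accepts Q \<delta> I F w"
    using assms(1) by (rule omega_regularE) blast
  obtain Q' :: "nat set" and \<delta>' I' F' where A': "finite Q'" "\<And>w. P' w \<longleftrightarrow> buchi_accepts Q' \<delta>' I' F' w"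
    using assms(2) by (rule omega_regularE) blast
  define \<Delta> where "\<Delta> p a q = (case p of Inl p \<Rightarrow> (case q of Inl q \<Rightarrow> \<delta> p a q | Inr q \<Rightarrow> False)
      | Inr p \<Rightarrow> (case q of Inl q \<Rightarrow> False | Inr q \<Rightarrow> \<delta>' p a q))" for p q a
  show ?thesis
  proof (rule omega_regularI[where Q = "Q <+> Q'" and \<delta> = \<Delta> and I = "I <+> I'" and F = "F <+> F'"])
    fix w
    show "P w \<or> P' w \<longleftrightarrow> buchi_accepts (Q <+> Q') \<Delta> (I <+> I') (F <+> F') w" (is "?L \<longleftrightarrow> ?R")
    proof
      assume ?L
      then show ?R
      proof
        assume "P w"
        then obtain r where r: "r 0 \<in> I" "\<forall>j. r j \<in> Q \<and> \<delta> (r j) (w j) (r (Suc j))" "\<exists>\<^sub>\<infinity>j. r j \<in> F"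
          unfolding * buchi_accepts_def by blast
        then show ?R
          unfolding buchi_accepts_def by (intro exI[of _ "\<lambda>j. Inl (r j)"]) (auto simp: \<Delta>_def elim: INFM_mono)
      next
        assume "P' w"
        then obtain r where r: "r 0 \<in> I'" "\<forall>j. r j \<in> Q' \<and> \<delta>' (r j) (w j) (r (Suc j))" "\<exists>\<^sub>\<infinity>j. r j \<in> F'"
          unfolding A' buchi_accepts_def by blast
        then show ?R
          unfolding buchi_accepts_def by (intro exI[of _ "\<lambda>j. Inr (r j)"]) (auto simp: \<Delta>_def elim: INFM_mono)
      qed
    next
      assume ?R
      then obtain r where r: "r 0 \<in> I <+> I'" and rr: "\<forall>j. r j \<in> Q <+> Q' \<and> \<Delta> (r j) (w j) (r (Suc j))"
          and r4: "\<exists>\<^sub>\<infinity>j. r j \<in> F <+> F'"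
        unfolding buchi_accepts_def by (elim exE conjE)
      from rr have r2: "\<And>j. r j \<in> Q <+> Q'" and r3: "\<And>j. \<Delta> (r j) (w j) (r (Suc j))"
        by (simp_all only: simp_thms)
      show ?L
      proof (cases "r 0")
        case (Inl x)
        have "isl (r j)" for j
        proof (induction j)
          case (Suc j)
          then show ?case using r3[of j] by (auto simp: \<Delta>_def split: sum.splits)
        qed (simp add: Inl)
        then have e: "r j = Inl (projl (r j))" for j by simp
        have "\<exists>\<^sub>\<infinity>j. projl (r j) \<in> F"
          using r4 by (rule INFM_mono) (metis InlI Inl_Inr_False PlusE e sum.sel(1))
        moreover have "projl (r j) \<in> Q" for j
          using r2[of j] e[of j] by (metis Inl_Inr_False PlusE sum.sel(1))
        moreover have "\<delta> (projl (r j)) (w j) (projl (r (Suc j)))" for j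
          using r3[of j] e[of j] e[of "Suc j"] unfolding \<Delta>_def by (metis sum.case(1))
        moreover have "projl (r 0) \<in> I"
          using r Inl by auto
        ultimately show ?L
          unfolding * buchi_accepts_def by (intro disjI1 exI[of _ "\<lambda>j. projl (r j)"]) auto
      next
        case (Inr x)
        have "\<not> isl (r j)" for j
        proof (induction j)
          case (Suc j)
          then show ?case using r3[of j] by (auto simp: \<Delta>_def split: sum.splits)
        qed (simp add: Inr)
        then have e: "r j = Inr (projr (r j))" for j by simp
        have "\<exists>\<^sub>\<infinity>j. projr (r j) \<in> F'"
          using r4 by (rule INFM_mono) (metis Inl_Inr_False PlusE e sum.sel(2))
        moreover have "projr (r j) \<in> Q'" for j
          using r2[of j] e[of j] by (metis Inl_Inr_False PlusE sum.sel(2))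
        moreover have "\<delta>' (projr (r j)) (w j) (projr (r (Suc j)))" for j
          using r3[of j] e[of j] e[of "Suc j"] unfolding \<Delta>_def by (metis sum.case(2))
        moreover have "projr (r 0) \<in> I'"
          using r Inr by auto
        ultimately show ?L
          unfolding A' buchi_accepts_def by (intro disjI2 exI[of _ "\<lambda>j. projr (r j)"]) auto
      qed
    qed
  qed (use * A' in auto)
qed

lemma omega_regular_False: "omega_regular (\<lambda>w. False)"
  by (rule omega_regularI[where Q = "{} :: nat set" and I = "{}" and F = "{}" and \<delta> = "\<lambda>_ _ _. True"])
     (auto simp: buchi_accepts_def)

lemma omega_regular_finite_Bex:
  assumes "finite A" "\<And>x. x \<in> A \<Longrightarrow> omega_regular (P x)"
  shows "omega_regular (\<lambda>w. \<exists>x\<in>A. P x w)"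
  using assms by (induction A rule: finite_induct) (auto intro: omega_regular_False omega_regular_disj)

section \<open>Complementation\<close>

text \<open>The profile of a finite word records which pairs of states it connects (first component) and
  which of them by a path that meets a terminal state before its last state (second component).
  Leaving the last state out makes consecutive blocks of a run cover every position exactly once.\<close>

type_synonym 'q profile = "'q rel \<times> 'q rel"

definition profile_mult :: "'q profile \<Rightarrow> 'q profile \<Rightarrow> 'q profile" where
  "profile_mult s t = (fst s O fst t, snd s O fst t \<union> fst s O snd t)"

definition letter_profile :: "'q set \<Rightarrow> ('q \<Rightarrow> 'a \<Rightarrow> 'q \<Rightarrow> bool) \<Rightarrow> 'q set \<Rightarrow> 'a \<Rightarrow> 'q profile" where
  "letter_profile Q \<delta> F a =
     ({(p, q). p \<in> Q \<and> q \<in> Q \<and> \<delta> p a q}, {(p, q). p \<in> Q \<inter> F \<and> q \<in> Q \<and> \<delta> p a q})"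

definition word_profile :: "'q set \<Rightarrow> ('q \<Rightarrow> 'a \<Rightarrow> 'q \<Rightarrow> bool) \<Rightarrow> 'q set \<Rightarrow> 'a list \<Rightarrow> 'q profile" where
  "word_profile Q \<delta> F u = foldl (\<lambda>s a. profile_mult s (letter_profile Q \<delta> F a)) (Id, {}) u"

lemma word_profile_Nil [simp]: "word_profile Q \<delta> F [] = (Id, {})"
  and word_profile_snoc [simp]:
    "word_profile Q \<delta> F (u @ [a]) = profile_mult (word_profile Q \<delta> F u) (letter_profile Q \<delta> F a)"
  by (simp_all add: word_profile_def)

text \<open>A finite superset of all profiles. The profile of the empty word is listed apart because its
  first component relates all elements of the type, not only the states.\<close>

definition profiles :: "'q set \<Rightarrow> 'q profile set" where
  "profiles Q = insert (Id, {}) (Pow (Q \<times> Q) \<times> Pow (Q \<times> Q))"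

lemma finite_profiles: "finite Q \<Longrightarrow> finite (profiles Q)"
  by (simp add: profiles_def)

lemma word_profile_in_profiles: "word_profile Q \<delta> F u \<in> profiles Q"
proof (induction u rule: rev_induct)
  case (snoc a u)
  then show ?case
    by (fastforce simp: profiles_def profile_mult_def letter_profile_def)
qed (simp add: profiles_def)

lemma fst_word_profile_iff:
  assumes "m \<le> n"
  shows "(p, q) \<in> fst (word_profile Q \<delta> F (subsequence w m n)) \<longleftrightarrow>
    (\<exists>r. r m = p \<and> r n = q \<and> (\<forall>j\<in>{m..<n}. r j \<in> Q \<and> r (Suc j) \<in> Q \<and> \<delta> (r j) (w j) (r (Suc j))))"
  using assms
proof (induction n arbitrary: q rule: dec_induct)
  case base
  then show ?case by auto
next
  case (step n)
  show ?case (is "?L \<longleftrightarrow> ?R")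
  proof
    assume ?L
    then obtain y where y: "(p, y) \<in> fst (word_profile Q \<delta> F (subsequence w m n))" "y \<in> Q" "q \<in> Q" "\<delta> y (w n) q"
      using step.hyps by (auto simp: profile_mult_def letter_profile_def)
    from y(1)[unfolded step.IH] obtain r where
      r: "r m = p" "r n = y" "\<forall>j\<in>{m..<n}. r j \<in> Q \<and> r (Suc j) \<in> Q \<and> \<delta> (r j) (w j) (r (Suc j))"
      by blast
    have "\<forall>j\<in>{m..<Suc n}. (r(Suc n := q)) j \<in> Q \<and> (r(Suc n := q)) (Suc j) \<in> Q \<and>
        \<delta> ((r(Suc n := q)) j) (w j) ((r(Suc n := q)) (Suc j))"
      using r y by (auto simp: less_Suc_eq)
    with step.hyps r(1) show ?R
      by (intro exI[of _ "r(Suc n := q)"]) auto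
  next
    assume ?R
    then obtain r where
      r: "r m = p" "r (Suc n) = q" "\<forall>j\<in>{m..<Suc n}. r j \<in> Q \<and> r (Suc j) \<in> Q \<and> \<delta> (r j) (w j) (r (Suc j))"
      by blast
    then have "(p, r n) \<in> fst (word_profile Q \<delta> F (subsequence w m n))"
      unfolding step.IH by (intro exI[of _ r]) auto
    with r step.hyps show ?L
      by (auto simp: profile_mult_def letter_profile_def)
  qed
qed

lemma snd_word_profile_iff:
  assumes "m \<le> n"
  shows "(p, q) \<in> snd (word_profile Q \<delta> F (subsequence w m n)) \<longleftrightarrow>
    (\<exists>r. r m = p \<and> r n = q \<and> (\<forall>j\<in>{m..<n}. r j \<in> Q \<and> r (Suc j) \<in> Q \<and> \<delta> (r j) (w j) (r (Suc j))) \<and>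
         (\<exists>j\<in>{m..<n}. r j \<in> F))"
  using assms
proof (induction n arbitrary: q rule: dec_induct)
  case base
  then show ?case by auto
next
  case (step n)
  show ?case (is "?L \<longleftrightarrow> ?R")
  proof
    assume ?L
    then obtain y where y: "y \<in> Q" "q \<in> Q" "\<delta> y (w n) q"
        "(p, y) \<in> snd (word_profile Q \<delta> F (subsequence w m n)) \<or>
         y \<in> F \<and> (p, y) \<in> fst (word_profile Q \<delta> F (subsequence w m n))"
      using step.hyps by (auto simp: profile_mult_def letter_profile_def)
    from y(4)[unfolded step.IH fst_word_profile_iff[OF step.hyps(1)]] obtain r where
      r: "r m = p" "r n = y" "\<forall>j\<in>{m..<n}. r j \<in> Q \<and> r (Suc j) \<in> Q \<and> \<delta> (r j) (w j) (r (Suc j))"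
         "(\<exists>j\<in>{m..<Suc n}. r j \<in> F)"
      using step.hyps by fastforce
    have "\<forall>j\<in>{m..<Suc n}. (r(Suc n := q)) j \<in> Q \<and> (r(Suc n := q)) (Suc j) \<in> Q \<and>
        \<delta> ((r(Suc n := q)) j) (w j) ((r(Suc n := q)) (Suc j))"
      using r y by (auto simp: less_Suc_eq)
    with step.hyps r show ?R
      by (intro exI[of _ "r(Suc n := q)"]) auto
  next
    assume ?R
    then obtain r k where
      r: "r m = p" "r (Suc n) = q" "\<forall>j\<in>{m..<Suc n}. r j \<in> Q \<and> r (Suc j) \<in> Q \<and> \<delta> (r j) (w j) (r (Suc j))"
      and k: "k \<in> {m..<Suc n}" "r k \<in> F"
      by blast
    have fst: "(p, r n) \<in> fst (word_profile Q \<delta> F (subsequence w m n))"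
      unfolding fst_word_profile_iff[OF step.hyps(1)] using r by (intro exI[of _ r]) auto
    show ?L
    proof (cases "k = n")
      case True
      with r step.hyps k fst show ?thesis
        by (auto simp: profile_mult_def letter_profile_def)
    next
      case False
      then have "(p, r n) \<in> snd (word_profile Q \<delta> F (subsequence w m n))"
        unfolding step.IH using r k by (intro exI[of _ r]) auto
      with r step.hyps show ?thesis
        by (auto simp: profile_mult_def letter_profile_def)
    qed
  qed
qed

lemma INFM_idx_blocks:
  assumes f: "idx_sequence f"
  shows "(\<exists>\<^sub>\<infinity>j. p j) \<longleftrightarrow> (\<exists>\<^sub>\<infinity>i. \<exists>j\<in>{f i..<f (Suc i)}. p j)"
proof
  assume L: "\<exists>\<^sub>\<infinity>j. p j"
  show "\<exists>\<^sub>\<infinity>i. \<exists>j\<in>{f i..<f (Suc i)}. p j"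
    unfolding INFM_nat_le
  proof
    fix m
    obtain j where j: "j \<ge> f m" "p j"
      using L unfolding INFM_nat_le by blast
    obtain i where i: "j \<in> {f i..<f (Suc i)}"
      using idx_sequence_interval[OF f] by blast
    have "m \<le> i"
    proof (rule ccontr)
      assume "\<not> m \<le> i"
      then have "f (Suc i) \<le> f m" by (intro idx_sequence_mono[OF f]) simp
      with i j show False by simp
    qed
    with i j show "\<exists>i\<ge>m. \<exists>j\<in>{f i..<f (Suc i)}. p j" by blast
  qed
next
  assume R: "\<exists>\<^sub>\<infinity>i. \<exists>j\<in>{f i..<f (Suc i)}. p j"
  show "\<exists>\<^sub>\<infinity>j. p j"
    unfolding INFM_nat_le
  proof
    fix m
    obtain i j where ij: "i \<ge> m" "j \<in> {f i..<f (Suc i)}" "p j"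
      using R unfolding INFM_nat_le by blast
    have "i \<le> f i"
    proof (induction i)
      case (Suc i)
      then show ?case using f unfolding idx_sequence_def by (metis Suc_leI le_trans not_less_eq_eq)
    qed simp
    with ij have "j \<ge> m" by simp
    with ij(3) show "\<exists>j\<ge>m. p j" by blast
  qed
qed

text \<open>A run can be cut at the block boundaries, and conversely paths through the blocks with matching
  end points can be glued. Hence acceptance depends on the profiles of the blocks alone, whichever
  factorization of the word is used.\<close>

lemma buchi_accepts_iff_block_profiles:
  assumes f: "idx_sequence f"
  shows "buchi_accepts Q \<delta> I F w \<longleftrightarrow>
    (\<exists>q. q 0 \<in> I \<and> (\<forall>i. (q i, q (Suc i)) \<in> fst (word_profile Q \<delta> F (subsequence w (f i) (f (Suc i))))) \<and>
         (\<exists>\<^sub>\<infinity>i. (q i, q (Suc i)) \<in> snd (word_profile Q \<delta> F (subsequence w (f i) (f (Suc i))))))" (is "?L \<longleftrightarrow> ?R")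
proof
  assume ?L
  then obtain r where r: "r 0 \<in> I" "\<And>j. r j \<in> Q" "\<And>j. \<delta> (r j) (w j) (r (Suc j))" "\<exists>\<^sub>\<infinity>j. r j \<in> F"
    unfolding buchi_accepts_def by blast
  have le: "f i \<le> f (Suc i)" for i
    using idx_sequence_mono[OF f] by simp
  have "(r (f i), r (f (Suc i))) \<in> fst (word_profile Q \<delta> F (subsequence w (f i) (f (Suc i))))" for i
    unfolding fst_word_profile_iff[OF le] using r by blast
  moreover have "(r (f i), r (f (Suc i))) \<in> snd (word_profile Q \<delta> F (subsequence w (f i) (f (Suc i))))"
    if "\<exists>j\<in>{f i..<f (Suc i)}. r j \<in> F" for i
    unfolding snd_word_profile_iff[OF le] using r that by blast
  then have "\<exists>\<^sub>\<infinity>i. (r (f i), r (f (Suc i))) \<in> snd (word_profile Q \<delta> F (subsequence w (f i) (f (Suc i))))"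
    by (rule INFM_mono[OF INFM_idx_blocks[OF f, THEN iffD1, OF r(4)]])
  moreover have "r (f 0) \<in> I"
    using r(1) f by (simp add: idx_sequence_def)
  ultimately show ?R
    by (intro exI[of _ "\<lambda>i. r (f i)"]) auto
next
  assume ?R
  then obtain q where q: "q 0 \<in> I"
      "\<And>i. (q i, q (Suc i)) \<in> fst (word_profile Q \<delta> F (subsequence w (f i) (f (Suc i))))"
      "\<exists>\<^sub>\<infinity>i. (q i, q (Suc i)) \<in> snd (word_profile Q \<delta> F (subsequence w (f i) (f (Suc i))))"
    by blast
  have le: "f i \<le> f (Suc i)" for i
    using idx_sequence_mono[OF f] by simp
  define S where "S i \<longleftrightarrow> (q i, q (Suc i)) \<in> snd (word_profile Q \<delta> F (subsequence w (f i) (f (Suc i))))" for i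
  have "\<exists>r. r (f i) = q i \<and> r (f (Suc i)) = q (Suc i) \<and>
      (\<forall>j\<in>{f i..<f (Suc i)}. r j \<in> Q \<and> r (Suc j) \<in> Q \<and> \<delta> (r j) (w j) (r (Suc j))) \<and>
      (S i \<longrightarrow> (\<exists>j\<in>{f i..<f (Suc i)}. r j \<in> F))" for i
  proof (cases "S i")
    case True
    then show ?thesis
      using snd_word_profile_iff[OF le[of i], of "q i" "q (Suc i)" Q \<delta> F w] unfolding S_def by blast
  next
    case False
    then show ?thesis
      using fst_word_profile_iff[OF le[of i], of "q i" "q (Suc i)" Q \<delta> F w] q(2)[of i] by blast
  qed
  then obtain R where R: "\<And>i. R i (f i) = q i" "\<And>i. R i (f (Suc i)) = q (Suc i)"
      "\<And>i j. j \<in> {f i..<f (Suc i)} \<Longrightarrow> R i j \<in> Q \<and> R i (Suc j) \<in> Q \<and> \<delta> (R i j) (w j) (R i (Suc j))"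
      "\<And>i. S i \<Longrightarrow> \<exists>j\<in>{f i..<f (Suc i)}. R i j \<in> F"
    by metis
  define r where "r = merge R f"
  have r_at: "r j = R i j" if "j \<in> {f i..<f (Suc i)}" for i j
    unfolding r_def by (rule merge[OF f that])
  have r_Suc: "r (Suc j) = R i (Suc j)" if "j \<in> {f i..<f (Suc i)}" for i j
    using merge_Suc[OF f that, of R] R(1)[of "Suc i"] R(2)[of i] by (auto simp: r_def)
  have "r j \<in> Q \<and> \<delta> (r j) (w j) (r (Suc j))" for j
  proof -
    obtain i where i: "j \<in> {f i..<f (Suc i)}"
      using idx_sequence_interval[OF f] by blast
    then show ?thesis using R(3)[OF i] r_at[OF i] r_Suc[OF i] by simp
  qed
  moreover have "\<exists>\<^sub>\<infinity>j. r j \<in> F"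
  proof (rule INFM_idx_blocks[OF f, THEN iffD2], rule INFM_mono)
    show "\<exists>\<^sub>\<infinity>i. S i" using q(3) unfolding S_def .
  next
    fix i assume "S i"
    with R(4) obtain j where j: "j \<in> {f i..<f (Suc i)}" "R i j \<in> F" by blast
    with r_at show "\<exists>j\<in>{f i..<f (Suc i)}. r j \<in> F" by (metis (no_types))
  qed
  moreover have "r 0 \<in> I"
    using merge0[OF f, of R] R(1)[of 0] q(1) f by (simp add: r_def idx_sequence_def)
  ultimately show ?L
    unfolding buchi_accepts_def by blast
qed

definition has_block_profiles ::
  "'q set \<Rightarrow> ('q \<Rightarrow> 'a \<Rightarrow> 'q \<Rightarrow> bool) \<Rightarrow> 'q set \<Rightarrow> 'q profile \<Rightarrow> 'q profile \<Rightarrow> 'a word \<Rightarrow> bool" where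
  "has_block_profiles Q \<delta> F s e w \<longleftrightarrow>
     (\<exists>f. idx_sequence f \<and>
        (\<forall>i. word_profile Q \<delta> F (subsequence w (f i) (f (Suc i))) = (if i = 0 then s else e)))"

text \<open>Colour each pair of positions by the profile of the factor between them. An infinite
  homogeneous set of positions cuts the word as required.\<close>

lemma ex_block_profiles:
  assumes "finite Q"
  shows "\<exists>s\<in>profiles Q. \<exists>e\<in>profiles Q. has_block_profiles Q \<delta> F s e w"
proof -
  let ?\<pi> = "word_profile Q \<delta> F"
  obtain g :: "'a profile \<Rightarrow> nat" and s where g: "g ` profiles Q = {i. i < s}" "inj_on g (profiles Q)"
    using finite_imp_inj_to_nat_seg[OF finite_profiles[OF assms]] by blast
  \<comment> \<open>Ramsey's theorem expects numbers as colours, so the profiles are numbered by \<open>g\<close>.\<close>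
  define c where "c X = g (?\<pi> (subsequence w (Min X) (Max X)))" for X
  have "\<forall>x\<in>UNIV. \<forall>y\<in>UNIV. x \<noteq> y \<longrightarrow> c {x, y} < s"
    using g(1) word_profile_in_profiles[of Q \<delta> F] unfolding c_def by blast
  from Ramsey2[OF infinite_UNIV_nat this] obtain Y t where
    Y: "infinite Y" "\<forall>x\<in>Y. \<forall>y\<in>Y. x \<noteq> y \<longrightarrow> c {x, y} = t" by blast
  \<comment> \<open>Position 0 always starts the first block; without it the blocks are nonempty.\<close>
  define Z where "Z = Y - {0}"
  have Z: "infinite Z" using Y(1) by (simp add: Z_def)
  define f where "f i = (case i of 0 \<Rightarrow> 0 | Suc i \<Rightarrow> enumerate Z i)" for i
  have enZ: "enumerate Z i \<in> Z" for i
    using enumerate_in_set[OF Z] .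
  have f: "idx_sequence f"
    unfolding idx_sequence_def
  proof (intro conjI allI)
    fix n show "f n < f (Suc n)"
      using enZ[of n] enumerate_step[OF Z] by (cases n) (auto simp: f_def Z_def)
  qed (simp add: f_def)
  define e where "e = ?\<pi> (subsequence w (f 1) (f 2))"
  have "?\<pi> (subsequence w (f (Suc i)) (f (Suc (Suc i)))) = e" for i
  proof -
    have col: "g (?\<pi> (subsequence w (f (Suc i)) (f (Suc (Suc i))))) = t" for i
    proof -
      have lt: "f (Suc i) < f (Suc (Suc i))" using f by (simp add: idx_sequence_def)
      have "f (Suc i) \<in> Y" "f (Suc (Suc i)) \<in> Y"
        using enZ by (auto simp: f_def Z_def)
      then have "c {f (Suc i), f (Suc (Suc i))} = t"
        by (rule Y(2)[rule_format]) (use lt in simp)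
      then show ?thesis using lt by (simp add: c_def)
    qed
    have "g (?\<pi> (subsequence w (f (Suc i)) (f (Suc (Suc i))))) = g e"
      using col[of i] col[of 0] by (simp add: e_def numeral_2_eq_2)
    then show ?thesis
      using g(2) word_profile_in_profiles unfolding e_def by (metis inj_onD)
  qed
  then have "\<forall>i. ?\<pi> (subsequence w (f i) (f (Suc i))) = (if i = 0 then ?\<pi> (subsequence w (f 0) (f 1)) else e)"
    by (auto simp: gr0_conv_Suc)
  with f have "has_block_profiles Q \<delta> F (?\<pi> (subsequence w (f 0) (f 1))) e w"
    unfolding has_block_profiles_def by blast
  then show ?thesis
    using word_profile_in_profiles unfolding e_def by blast
qed

text \<open>The automaton guesses the block boundaries. A state consists of a flag telling that a block has
  just started, the profile that the current block must have in the end, and the profile of the part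
  of the block read so far.\<close>

lemma omega_regular_has_block_profiles:
  assumes "finite Q"
  shows "omega_regular (has_block_profiles Q \<delta> F s e)"
proof -
  let ?\<pi> = "word_profile Q \<delta> F"
  define \<Delta> :: "bool \<times> 'a profile \<times> 'a profile \<Rightarrow> 'b \<Rightarrow> bool \<times> 'a profile \<times> 'a profile \<Rightarrow> bool" where
    "\<Delta> = (\<lambda>(c, x, m) a (c', x', m').
       (if c' then profile_mult m (letter_profile Q \<delta> F a) = x \<and> x' = e \<and> m' = (Id, {})
        else x' = x \<and> m' = profile_mult m (letter_profile Q \<delta> F a)))"
  let ?S = "(UNIV :: bool set) \<times> {s, e} \<times> profiles Q"
  show ?thesis
  proof (rule omega_regularI[where Q = ?S and \<delta> = \<Delta> and I = "{(True, s, (Id, {}))}" and F = "{True} \<times> UNIV"])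
    show "finite ?S" using finite_profiles[OF assms] by simp
  next
    fix w
    define tgt where "tgt i = (if i = 0 then s else e)" for i :: nat
    show "has_block_profiles Q \<delta> F s e w \<longleftrightarrow>
        buchi_accepts ?S \<Delta> {(True, s, (Id, {}))} ({True} \<times> UNIV) w" (is "?L \<longleftrightarrow> ?R")
    proof
      assume ?L
      then obtain f where f: "idx_sequence f" and blk: "\<And>i. ?\<pi> (subsequence w (f i) (f (Suc i))) = tgt i"
        unfolding has_block_profiles_def tgt_def by blast
      define R where "R i j = (j = f i, tgt i, ?\<pi> (subsequence w (f i) j))" for i j
      define r where "r = merge R f"
      have r_at: "r j = R i j" if "j \<in> {f i..<f (Suc i)}" for i j
        unfolding r_def by (rule merge[OF f that])
      have "r j \<in> ?S \<and> \<Delta> (r j) (w j) (r (Suc j))" for j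
      proof -
        obtain i where i: "j \<in> {f i..<f (Suc i)}"
          using idx_sequence_interval[OF f] by blast
        have rj: "r j = R i j" using r_at[OF i] .
        have "r j \<in> ?S"
          unfolding rj R_def by (auto simp: tgt_def word_profile_in_profiles)
        moreover have "\<Delta> (r j) (w j) (r (Suc j))"
        proof (cases "Suc j = f (Suc i)")
          case True
          then have "r (Suc j) = (True, e, (Id, {}))"
            using merge_Suc[OF f i, of R] by (simp add: r_def R_def tgt_def)
          moreover have "profile_mult (?\<pi> (subsequence w (f i) j)) (letter_profile Q \<delta> F (w j)) = tgt i"
            using blk[of i] True i by (metis atLeastLessThan_iff subseq_to_Suc word_profile_snoc)
          ultimately show ?thesis
            by (simp add: rj R_def \<Delta>_def)
        next
          case False
          then have "r (Suc j) = R i (Suc j)"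
            using merge_Suc[OF f i, of R] by (simp add: r_def)
          then show ?thesis
            using i by (simp add: rj R_def \<Delta>_def)
        qed
        ultimately show ?thesis by blast
      qed
      moreover have "r 0 = (True, s, (Id, {}))"
        using merge0[OF f, of R] f by (simp add: r_def R_def tgt_def idx_sequence_def)
      moreover have "\<exists>\<^sub>\<infinity>j. r j \<in> {True} \<times> UNIV"
      proof (rule INFM_idx_blocks[OF f, THEN iffD2], rule INFM_mono)
        show "\<exists>\<^sub>\<infinity>i::nat. True" by simp
      next
        fix i
        have "f i \<in> {f i..<f (Suc i)}" using idx_sequence_idx[OF f] .
        with r_at[OF this] show "\<exists>j\<in>{f i..<f (Suc i)}. r j \<in> {True} \<times> UNIV"
          by (intro bexI[of _ "f i"]) (auto simp: R_def)
      qed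
      ultimately show ?R
        unfolding buchi_accepts_def by blast
    next
      assume ?R
      then obtain r where r: "r 0 = (True, s, (Id, {}))" "\<And>j. \<Delta> (r j) (w j) (r (Suc j))"
          "\<exists>\<^sub>\<infinity>j. r j \<in> {True} \<times> UNIV"
        unfolding buchi_accepts_def by blast
      define M where "M = {j. fst (r j)}"
      have M: "infinite M"
        using r(3) by (auto simp: M_def INFM_iff_infinite mem_Times_iff)
      define f where "f = enumerate M"
      have f0: "f 0 = 0"
        unfolding f_def enumerate_0 by (rule Least_eq_0) (simp add: M_def r)
      have f: "idx_sequence f"
        unfolding idx_sequence_def using f0 enumerate_step[OF M] by (simp add: f_def)
      have inM: "fst (r (f i))" for i
        using enumerate_in_set[OF M, of i] by (simp add: M_def f_def)
      have notM: "\<not> fst (r j)" if "f i < j" "j < f (Suc i)" for i j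
      proof
        assume "fst (r j)"
        then have "j \<in> M" by (simp add: M_def)
        then have "f (Suc i) \<le> j"
          using that(1) unfolding f_def enumerate_Suc''[OF M] by (intro Least_le) simp
        with that show False by simp
      qed
      have x: "snd (r (f i)) = (tgt i, (Id, {}))" for i
      proof (cases i)
        case 0
        then show ?thesis by (simp add: f0 r tgt_def)
      next
        case (Suc k)
        then have "f i > 0" using idx_sequence_less[OF f, of 0 k] by (simp add: f0)
        then obtain j where j: "f i = Suc j" by (cases "f i") auto
        show ?thesis
          using r(2)[of j] inM[of i] Suc unfolding j by (cases "r j"; cases "r (Suc j)") (auto simp: \<Delta>_def tgt_def)
      qed
      have inv: "snd (r j) = (tgt i, ?\<pi> (subsequence w (f i) j))" if "f i \<le> j" "j < f (Suc i)" for i j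
        using that
      proof (induction j rule: dec_induct)
        case base
        then show ?case by (simp add: x)
      next
        case (step j)
        then have "snd (r j) = (tgt i, ?\<pi> (subsequence w (f i) j))" "\<not> fst (r (Suc j))"
          using notM[of i "Suc j"] by auto
        with r(2)[of j] step.hyps show ?case
          by (cases "r j"; cases "r (Suc j)") (auto simp: \<Delta>_def)
      qed
      have "?\<pi> (subsequence w (f i) (f (Suc i))) = tgt i" for i
      proof -
        have lt: "f i < f (Suc i)" using f by (simp add: idx_sequence_def)
        then obtain j where j: "f (Suc i) = Suc j" by (cases "f (Suc i)") auto
        then have le: "f i \<le> j" using lt by simp
        have "snd (r j) = (tgt i, ?\<pi> (subsequence w (f i) j))"
          using inv[OF le] j by simp
        then show ?thesis
          using r(2)[of j] inM[of "Suc i"] le unfolding j by (cases "r j"; cases "r (Suc j)") (auto simp: \<Delta>_def)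
      qed
      with f show ?L
        unfolding has_block_profiles_def tgt_def by blast
    qed
  qed
qed

text \<open>The complement is the union, over the finitely many pairs of profiles whose block pattern
  admits no accepting run, of the words with this block pattern.\<close>

lemma omega_regular_Not:
  assumes "omega_regular P"
  shows "omega_regular (\<lambda>w. \<not> P w)"
proof -
  obtain Q :: "nat set" and \<delta> I F where Q: "finite Q" and P: "\<And>w. P w \<longleftrightarrow> buchi_accepts Q \<delta> I F w"
    using assms by (rule omega_regularE) blast
  define acc where "acc s e \<longleftrightarrow> (\<exists>q. q 0 \<in> I \<and>
      (\<forall>i. (q i, q (Suc i)) \<in> fst (if i = 0 then s else e)) \<and>
      (\<exists>\<^sub>\<infinity>i. (q i, q (Suc i)) \<in> snd (if i = 0 then s else e)))" for s e
  have P_iff: "P w \<longleftrightarrow> acc s e" if blocks: "has_block_profiles Q \<delta> F s e w" for s e w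
  proof -
    obtain f where f: "idx_sequence f"
      and blk: "\<And>i. word_profile Q \<delta> F (subsequence w (f i) (f (Suc i))) = (if i = 0 then s else e)"
      using blocks unfolding has_block_profiles_def by blast
    show ?thesis
      unfolding P buchi_accepts_iff_block_profiles[OF f] blk acc_def ..
  qed
  let ?A = "{se \<in> profiles Q \<times> profiles Q. \<not> acc (fst se) (snd se)}"
  have "(\<lambda>w. \<not> P w) = (\<lambda>w. \<exists>se\<in>?A. has_block_profiles Q \<delta> F (fst se) (snd se) w)"
  proof
    fix w
    show "(\<not> P w) = (\<exists>se\<in>?A. has_block_profiles Q \<delta> F (fst se) (snd se) w)"
      using ex_block_profiles[OF Q, of \<delta> F w] P_iff[of _ _ w] by fastforce
  qed
  moreover have "omega_regular (\<lambda>w. \<exists>se\<in>?A. has_block_profiles Q \<delta> F (fst se) (snd se) w)"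
    by (intro omega_regular_finite_Bex omega_regular_has_block_profiles Q)
       (simp add: finite_profiles Q)
  ultimately show ?thesis by simp
qed

lemma omega_regular_conj:
  assumes "omega_regular P" "omega_regular P'"
  shows "omega_regular (\<lambda>w. P w \<and> P' w)"
  using omega_regular_Not[OF omega_regular_disj[OF omega_regular_Not[OF assms(1)] omega_regular_Not[OF assms(2)]]]
  by simp

lemma omega_regular_finite_Ball:
  assumes "finite A" "\<And>x. x \<in> A \<Longrightarrow> omega_regular (P x)"
  shows "omega_regular (\<lambda>w. \<forall>x\<in>A. P x w)"
  using omega_regular_Not[OF omega_regular_finite_Bex[OF assms(1) omega_regular_Not[OF assms(2)]]]
  by simp

section \<open>Further closure properties\<close>

text \<open>The state \<open>None\<close> waits for the position at which the suffix starts.\<close>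

lemma omega_regular_ex_suffix:
  assumes "omega_regular P"
  shows "omega_regular (\<lambda>w. \<exists>k. P (suffix k w))"
proof -
  obtain Q :: "nat set" and \<delta> I F where Q: "finite Q" and P: "\<And>w. P w \<longleftrightarrow> buchi_accepts Q \<delta> I F w"
    using assms by (rule omega_regularE) blast
  define \<Delta> where "\<Delta> p a q = (case p of None \<Rightarrow> (case q of None \<Rightarrow> True | Some q' \<Rightarrow> q' \<in> I)
      | Some p' \<Rightarrow> (case q of None \<Rightarrow> False | Some q' \<Rightarrow> \<delta> p' a q'))" for p a q
  show ?thesis
  proof (rule omega_regularI[where Q = "insert None (Some ` Q)" and \<delta> = \<Delta> and
        I = "insert None (Some ` I)" and F = "Some ` F"])
    fix w
    show "(\<exists>k. P (suffix k w)) \<longleftrightarrow>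
        buchi_accepts (insert None (Some ` Q)) \<Delta> (insert None (Some ` I)) (Some ` F) w" (is "?L \<longleftrightarrow> ?R")
    proof
      assume ?L
      then obtain k r where r: "r 0 \<in> I" "\<And>j. r j \<in> Q" "\<And>j. \<delta> (r j) (w (k + j)) (r (Suc j))"
          "\<exists>\<^sub>\<infinity>j. r j \<in> F"
        unfolding P buchi_accepts_def by auto
      define r' where "r' j = (if j < k then None else Some (r (j - k)))" for j
      have "r' 0 \<in> insert None (Some ` I)"
        using r(1) by (auto simp: r'_def)
      moreover have "r' j \<in> insert None (Some ` Q)" for j
        using r(2) by (auto simp: r'_def)
      moreover have "\<Delta> (r' j) (w j) (r' (Suc j))" for j
      proof (cases "j < k")
        case True
        then show ?thesis
          using r(1) by (cases "Suc j < k") (auto simp: r'_def \<Delta>_def not_less)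
      next
        case False
        then have "Suc (j - k) = Suc j - k" by simp
        with False r(3)[of "j - k"] show ?thesis
          by (simp add: r'_def \<Delta>_def)
      qed
      moreover have "\<exists>\<^sub>\<infinity>j. r' j \<in> Some ` F"
        unfolding INFM_nat_le
      proof
        fix m
        obtain j where "j \<ge> m" "r j \<in> F"
          using r(4) unfolding INFM_nat_le by blast
        then show "\<exists>n\<ge>m. r' n \<in> Some ` F"
          by (intro exI[of _ "j + k"]) (auto simp: r'_def)
      qed
      ultimately show ?R
        unfolding buchi_accepts_def by blast
    next
      assume ?R
      then obtain r where r0: "r 0 \<in> insert None (Some ` I)" and rQ: "\<And>j. r j \<in> insert None (Some ` Q)"
          and rD: "\<And>j. \<Delta> (r j) (w j) (r (Suc j))" and rF: "\<exists>\<^sub>\<infinity>j. r j \<in> Some ` F"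
        unfolding buchi_accepts_def by blast
      obtain i where i: "r i \<noteq> None"
        using INFM_EX[OF rF] by auto
      define k where "k = (LEAST k. r k \<noteq> None)"
      have k: "r k \<noteq> None"
        unfolding k_def using i by (rule LeastI)
      have start: "the (r k) \<in> I"
      proof (cases k)
        case 0
        then show ?thesis using r0 k by auto
      next
        case (Suc m)
        then have "r m = None"
          using not_less_Least[of m "\<lambda>k. r k \<noteq> None"] by (auto simp: k_def)
        then show ?thesis
          using rD[of m] k Suc by (auto simp: \<Delta>_def)
      qed
      have some: "r (k + j) \<noteq> None" for j
      proof (induction j)
        case (Suc j)
        then show ?case using rD[of "k + j"] by (auto simp: \<Delta>_def split: option.splits)
      qed (simp add: k)
      have "the (r (k + j)) \<in> Q" for j
        using rQ[of "k + j"] some[of j] by auto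
      moreover have "\<delta> (the (r (k + j))) (w (k + j)) (the (r (k + Suc j)))" for j
        using rD[of "k + j"] some[of j] some[of "Suc j"] by (auto simp: \<Delta>_def)
      moreover have "\<exists>\<^sub>\<infinity>j. the (r (k + j)) \<in> F"
        unfolding INFM_nat_le
      proof
        fix m
        obtain j where "j \<ge> k + m" "r j \<in> Some ` F"
          using rF unfolding INFM_nat_le by blast
        then show "\<exists>n\<ge>m. the (r (k + n)) \<in> F"
          by (intro exI[of _ "j - k"]) auto
      qed
      ultimately have "buchi_accepts Q \<delta> I F (suffix k w)"
        unfolding buchi_accepts_def using start by (intro exI[of _ "\<lambda>j. the (r (k + j))"]) auto
      then show ?L unfolding P by blast
    qed
  qed (use Q in simp)
qed

lemma omega_regular_all_suffix:
  assumes "omega_regular P"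
  shows "omega_regular (\<lambda>w. \<forall>k. P (suffix k w))"
  using omega_regular_Not[OF omega_regular_ex_suffix[OF omega_regular_Not[OF assms]]] by simp

text \<open>Prefixing a word only changes the set of states in which the automaton may start, so the set
  of admissible prefixes can be arbitrary.\<close>

lemma omega_regular_ex_prefix:
  assumes "omega_regular P"
  shows "omega_regular (\<lambda>w. \<exists>u\<in>A. P (u \<frown> w))"
proof -
  obtain Q :: "nat set" and \<delta> I F where Q: "finite Q" and P: "\<And>w. P w \<longleftrightarrow> buchi_accepts Q \<delta> I F w"
    using assms by (rule omega_regularE) blast
  define I' where "I' = {r (length u) | r u. u \<in> A \<and> r 0 \<in> I \<and>
      (\<forall>j<length u. r j \<in> Q \<and> \<delta> (r j) (u ! j) (r (Suc j)))}"
  show ?thesis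
  proof (rule omega_regularI[OF Q, where \<delta> = \<delta> and I = I' and F = F])
    fix w
    show "(\<exists>u\<in>A. P (u \<frown> w)) \<longleftrightarrow> buchi_accepts Q \<delta> I' F w" (is "?L \<longleftrightarrow> ?R")
    proof
      assume ?L
      then obtain u r where u: "u \<in> A" and r: "r 0 \<in> I" "\<And>j. r j \<in> Q"
          "\<And>j. \<delta> (r j) ((u \<frown> w) j) (r (Suc j))" "\<exists>\<^sub>\<infinity>j. r j \<in> F"
        unfolding P buchi_accepts_def by blast
      have "\<forall>j<length u. r j \<in> Q \<and> \<delta> (r j) (u ! j) (r (Suc j))"
        using r(2,3) by (metis conc_fst)
      then have "r (length u) \<in> I'"
        unfolding I'_def using u r(1) by blast
      moreover have "\<delta> (r (length u + j)) (w j) (r (length u + Suc j))" for j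
        using r(3)[of "length u + j"] by simp
      moreover have "\<exists>\<^sub>\<infinity>j. r (length u + j) \<in> F"
        unfolding INFM_nat_le
      proof
        fix m
        obtain j where "j \<ge> length u + m" "r j \<in> F"
          using r(4) unfolding INFM_nat_le by blast
        then show "\<exists>n\<ge>m. r (length u + n) \<in> F"
          by (intro exI[of _ "j - length u"]) auto
      qed
      ultimately show ?R
        unfolding buchi_accepts_def by (intro exI[of _ "\<lambda>j. r (length u + j)"]) (auto simp: r)
    next
      assume ?R
      then obtain r where r: "r 0 \<in> I'" "\<And>j. r j \<in> Q"
          "\<And>j. \<delta> (r j) (w j) (r (Suc j))" "\<exists>\<^sub>\<infinity>j. r j \<in> F"
        unfolding buchi_accepts_def by blast
      from r(1) obtain s u where s: "r 0 = s (length u)" "u \<in> A" "s 0 \<in> I"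
          "\<And>j. j < length u \<Longrightarrow> s j \<in> Q \<and> \<delta> (s j) (u ! j) (s (Suc j))"
        unfolding I'_def by blast
      define t where "t j = (if j < length u then s j else r (j - length u))" for j
      have "t 0 \<in> I"
        using s(1,3) by (simp add: t_def)
      moreover have "t j \<in> Q" for j
        using s(4)[of j] r(2) by (simp add: t_def)
      moreover have "\<delta> (t j) ((u \<frown> w) j) (t (Suc j))" for j
      proof (cases "j < length u")
        case True
        then have "t (Suc j) = s (Suc j)"
          using s(1) by (cases "Suc j = length u") (auto simp: t_def)
        with True s(4)[of j] show ?thesis by (simp add: t_def)
      next
        case False
        then have "Suc j - length u = Suc (j - length u)" by simp
        with False r(3)[of "j - length u"] show ?thesis by (simp add: t_def)
      qed
      moreover have "\<exists>\<^sub>\<infinity>j. t j \<in> F"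
        unfolding INFM_nat_le
      proof
        fix m
        obtain j where "j \<ge> m" "r j \<in> F"
          using r(4) unfolding INFM_nat_le by blast
        then show "\<exists>n\<ge>m. t n \<in> F"
          by (intro exI[of _ "length u + j"]) (auto simp: t_def)
      qed
      ultimately have "P (u \<frown> w)"
        unfolding P buchi_accepts_def by blast
      with s(2) show ?L by blast
    qed
  qed
qed

lemma omega_regular_all_letters: "omega_regular (\<lambda>w. \<forall>j. p (w j))"
  by (rule omega_regularI[where Q = "{()}" and \<delta> = "\<lambda>_ a _. p a" and I = "{()}" and F = "{()}"])
     (auto simp: buchi_accepts_def)

lemma omega_regular_ex1_letter: "omega_regular (\<lambda>w. \<exists>!j. p (w j))"
proof (rule omega_regularI[where Q = "UNIV :: bool set" and I = "{False}" and F = "{True}" and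
      \<delta> = "\<lambda>s a s'. if p a then \<not> s \<and> s' else s' = s"])
  fix w
  let ?\<delta> = "\<lambda>s a s'. if p a then \<not> s \<and> s' else s' = s"
  show "(\<exists>!j. p (w j)) \<longleftrightarrow> buchi_accepts UNIV ?\<delta> {False} {True} w" (is "?L \<longleftrightarrow> ?R")
  proof
    assume ?L
    then obtain i where i: "\<And>j. p (w j) \<longleftrightarrow> j = i" by (metis (mono_tags))
    have "?\<delta> (i < j) (w j) (i < Suc j)" for j
      by (auto simp: i less_Suc_eq)
    moreover have "\<exists>\<^sub>\<infinity>j. i < j"
      unfolding INFM_nat by (metis less_add_Suc1 less_add_Suc2)
    ultimately show ?R
      unfolding buchi_accepts_def by (intro exI[of _ "\<lambda>j. i < j"]) auto
  next
    assume ?R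
    then obtain r where r: "\<not> r 0" "\<And>j. ?\<delta> (r j) (w j) (r (Suc j))" "\<exists>\<^sub>\<infinity>j. r j"
      unfolding buchi_accepts_def by auto
    have count: "if r j then \<exists>i<j. \<forall>k<j. p (w k) \<longleftrightarrow> k = i else \<forall>k<j. \<not> p (w k)" for j
    proof (induction j)
      case (Suc j)
      show ?case
      proof (cases "p (w j)")
        case True
        with r(2)[of j] Suc show ?thesis by (auto simp: less_Suc_eq)
      next
        case False
        with r(2)[of j] have "r (Suc j) = r j" by simp
        with Suc False show ?thesis
          by (auto simp: less_Suc_eq split: if_splits)
      qed
    qed (simp add: r)
    obtain m where m: "r m" using INFM_EX[OF r(3)] by blast
    then obtain i where i: "i < m" "p (w i)" using count[of m] by auto
    have "j = i" if "p (w j)" for j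
    proof -
      obtain n where n: "n > max i j" "r n"
        using r(3) unfolding INFM_nat by blast
      then obtain l where l: "\<forall>k<n. p (w k) \<longleftrightarrow> k = l" using count[of n] by auto
      with n i(2) that show ?thesis by simp
    qed
    with i show ?L by blast
  qed
qed simp

section \<open>Finiteness from the Pisot condition\<close>

abbreviation rat_eval :: "rat poly \<Rightarrow> 'a::field_char_0 \<Rightarrow> 'a" where
  "rat_eval p z \<equiv> poly (map_poly of_rat p) z"

lemma rat_eval_add: "rat_eval (p + q) z = rat_eval p z + rat_eval q z"
proof (induction p arbitrary: q)
  case (pCons a p)
  then show ?case
    by (cases q) (simp add: map_poly_pCons of_rat_add algebra_simps)
qed simp

lemma rat_eval_smult: "rat_eval (smult c p) z = of_rat c * rat_eval p z"
  by (induction p) (simp_all add: map_poly_pCons of_rat_mult algebra_simps)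

lemma rat_eval_mult: "rat_eval (p * q) z = rat_eval p z * rat_eval q z"
  by (induction p) (simp_all add: map_poly_pCons rat_eval_add rat_eval_smult algebra_simps)

lemma rat_eval_of_int_poly:
  "rat_eval (map_poly of_int P) z = poly (map_poly of_int P) z"
  by (simp add: map_poly_map_poly o_def)

lemma complex_of_real_of_rat: "complex_of_real (of_rat x) = of_rat x"
  by (cases x) (simp add: of_rat_rat)

text \<open>The polynomials that vanish at \<open>z\<close> form an ideal, which is generated by an element of least
  degree.\<close>

lemma annihilator_principal:
  fixes z :: "'a :: field_char_0"
  assumes "r \<noteq> 0" "rat_eval r z = 0"
  shows "\<exists>g :: rat poly. g \<noteq> 0 \<and> rat_eval g z = 0 \<and> (\<forall>q. rat_eval q z = 0 \<longrightarrow> g dvd q)"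
proof -
  let ?R = "\<lambda>p :: rat poly. p \<noteq> 0 \<and> rat_eval p z = 0"
  have "?R r" using assms by simp
  then obtain g where g: "?R g" and min: "\<And>q. ?R q \<Longrightarrow> degree g \<le> degree q"
    using ex_has_least_nat[of ?R _ degree] by blast
  have "g dvd q" if "rat_eval q z = 0" for q
  proof -
    have "rat_eval (q div g * g + q mod g) z = 0" using that by simp
    then have "rat_eval (q mod g) z = 0"
      using g unfolding rat_eval_add rat_eval_mult by simp
    then have "q mod g = 0"
      using min[of "q mod g"] degree_mod_less'[of g q] g by linarith
    then show ?thesis by auto
  qed
  with g show ?thesis by blast
qed

lemma not_is_unit_of_root:
  fixes z :: "'a :: field_char_0"
  assumes "rat_eval p z = 0"
  shows "\<not> is_unit p"
proof
  assume "is_unit p"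
  then obtain c where "p = [:c:]" "c \<noteq> 0" unfolding is_unit_poly_iff by (auto simp: dvd_field_iff)
  with assms show False by (simp add: map_poly_pCons)
qed

lemma irreducible_dvd_of_root:
  fixes z :: "'a :: field_char_0"
  assumes "irreducible p" "rat_eval p z = 0" "rat_eval q z = 0"
  shows "p dvd q"
proof -
  have p0: "p \<noteq> 0" using assms(1) by auto
  obtain g where g0: "g \<noteq> 0" and g: "rat_eval g z = 0" "\<And>q. rat_eval q z = 0 \<Longrightarrow> g dvd q"
    using annihilator_principal[OF p0 assms(2)] by blast
  obtain h where h: "p = g * h" using g(2)[OF assms(2)] by (rule dvdE)
  then have "is_unit h"
    using assms(1) not_is_unit_of_root[OF g(1)] by (auto dest: irreducibleD)
  then have "p dvd g" unfolding h by simp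
  then show ?thesis using g(2)[OF assms(3)] by (rule dvd_trans)
qed

lemma irreducible_annihilator:
  fixes z :: "'a :: field_char_0"
  assumes "r \<noteq> 0" "rat_eval r z = 0"
  shows "\<exists>p :: rat poly. irreducible p \<and> rat_eval p z = 0"
proof -
  obtain p where p: "p \<noteq> 0" "rat_eval p z = 0" "\<And>q. rat_eval q z = 0 \<Longrightarrow> p dvd q"
    using annihilator_principal[OF assms] by blast
  have "irreducible p"
  proof (rule irreducibleI)
    fix a b assume ab: "p = a * b"
    with p have nz: "a \<noteq> 0" "b \<noteq> 0" by auto
    then have deg: "degree p = degree a + degree b"
      unfolding ab by (simp add: degree_mult_eq)
    have "rat_eval a z = 0 \<or> rat_eval b z = 0"
      using p ab by (simp add: rat_eval_mult)
    then have "p dvd a \<or> p dvd b" using p(3) by blast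
    then have "degree a = 0 \<or> degree b = 0"
      using nz deg by (auto dest!: dvd_imp_degree_le)
    then show "is_unit a \<or> is_unit b"
      using nz by (auto simp: is_unit_iff_degree)
  qed (use p not_is_unit_of_root in auto)
  with p show ?thesis by blast
qed

text \<open>A multiple root would also be a root of the derivative, which an irreducible polynomial cannot
  divide.\<close>

lemma card_roots_irreducible:
  fixes p :: "rat poly"
  assumes "irreducible p"
  shows "card {z :: complex. rat_eval p z = 0} = degree p"
proof -
  have p0: "p \<noteq> 0" using assms by auto
  have deg: "degree p > 0"
    using assms p0 by (metis gr0I irreducible_not_unit is_unit_iff_degree)
  have "pderiv p \<noteq> 0"
    using deg by (simp add: pderiv_eq_0_iff)
  then have ndvd: "\<not> p dvd pderiv p"
    using deg by (auto dest!: dvd_imp_degree_le simp: degree_pderiv)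
  let ?P = "map_poly of_rat p :: complex poly"
  have pd: "pderiv ?P = map_poly of_rat (pderiv p)"
    by (intro poly_eqI) (simp add: coeff_pderiv coeff_map_poly of_rat_mult of_rat_add)
  have "rsquarefree ?P"
    unfolding rsquarefree_roots pd
  proof safe
    fix z :: complex assume "rat_eval p z = 0" "rat_eval (pderiv p) z = 0"
    then have "p dvd pderiv p" by (rule irreducible_dvd_of_root[OF assms])
    with ndvd show False ..
  qed
  from complex_poly_decompose_rsquarefree[OF this]
  have "degree ?P = degree (smult (lead_coeff ?P) (\<Prod>z|poly ?P z = 0. [:- z, 1:]))"
    by simp
  also have "\<dots> = (\<Sum>z|poly ?P z = 0. 1)"
    using p0 by (simp add: degree_prod_eq_sum_degree map_poly_eq_0_iff)
  finally show ?thesis by (simp add: degree_map_poly)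
qed

lemma lagrange_interpolation:
  fixes Z :: "complex set"
  assumes "finite Z"
  obtains L :: "complex \<Rightarrow> complex poly" where
    "\<And>R. degree R < card Z \<Longrightarrow> R = (\<Sum>z\<in>Z. smult (poly R z) (L z))"
proof -
  define L where "L z = smult (inverse (\<Prod>y\<in>Z - {z}. z - y)) (\<Prod>y\<in>Z - {z}. [:- y, 1:])" for z
  have L: "poly (L z) y = (if y = z then 1 else 0)" if "z \<in> Z" "y \<in> Z" for z y
    using assms that by (auto simp: L_def poly_prod prod_zero_iff)
  have deg: "degree (L z) < card Z" if "z \<in> Z" for z
  proof -
    have "degree (L z) \<le> (\<Sum>y\<in>Z - {z}. 1)"
      unfolding L_def
      by (rule order_trans[OF degree_smult_le], rule order_trans[OF degree_prod_sum_le])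
         (auto simp: assms)
    also have "\<dots> < card Z"
    proof -
      have "card Z > 0" using that assms card_gt_0_iff by blast
      then show ?thesis using that assms by simp
    qed
    finally show ?thesis .
  qed
  show ?thesis
  proof
    fix R :: "complex poly" assume R: "degree R < card Z"
    show "R = (\<Sum>z\<in>Z. smult (poly R z) (L z))"
    proof (rule poly_eqI_degree[of Z])
      fix y assume y: "y \<in> Z"
      have "poly (\<Sum>z\<in>Z. smult (poly R z) (L z)) y = (\<Sum>z\<in>Z. if z = y then poly R z else 0)"
        unfolding poly_sum by (rule sum.cong) (auto simp: L y)
      also have "\<dots> = poly R y"
        using y assms by simp
      finally show "poly R y = poly (\<Sum>z\<in>Z. smult (poly R z) (L z)) y" by simp
    next
      show "degree (\<Sum>z\<in>Z. smult (poly R z) (L z)) < card Z"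
        using R deg by (intro degree_sum_less) (auto intro: le_less_trans[OF degree_smult_le])
    qed (fact R)
  qed
qed

lemma common_denominator:
  assumes "finite (A :: rat set)"
  shows "\<exists>N :: int. N > 0 \<and> (\<forall>a\<in>A. of_int N * a \<in> \<int>)"
  using assms
proof (induction A rule: finite_induct)
  case (insert a A)
  then obtain N where N: "N > 0" "\<And>a. a \<in> A \<Longrightarrow> of_int N * a \<in> \<int>" by blast
  obtain b c where bc: "quotient_of a = (b, c)" by (cases "quotient_of a")
  then have c: "c > 0" "a = of_int b / of_int c"
    by (auto simp: quotient_of_denom_pos quotient_of_div)
  have "of_int (N * c) * x \<in> \<int>" if "x \<in> insert a A" for x
  proof (cases "x = a")
    case True
    have "of_int (N * c) * x = (of_int (N * b) :: rat)" using c by (simp add: True)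
    then show ?thesis by (simp only: Ints_of_int)
  next
    case False
    with that N(2) have "of_int N * x \<in> \<int>" by blast
    then have "of_int c * (of_int N * x) \<in> \<int>" by (rule Ints_mult[OF Ints_of_int])
    moreover have "of_int (N * c) * x = of_int c * (of_int N * x)" by simp
    ultimately show ?thesis by metis
  qed
  then show ?case using N c by (intro exI[of _ "N * c"]) auto
qed (auto intro: exI[of _ 1])

lemma finite_bounded_denominator:
  fixes N :: int
  assumes "N > 0"
  shows "finite {x :: rat. of_int N * x \<in> \<int> \<and> \<bar>real_of_rat x\<bar> \<le> B}"
proof (rule finite_subset)
  show "{x :: rat. of_int N * x \<in> \<int> \<and> \<bar>real_of_rat x\<bar> \<le> B}
      \<subseteq> (\<lambda>i. of_int i / of_int N) ` {- \<lceil>of_int N * B\<rceil>..\<lceil>of_int N * B\<rceil>}"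
  proof
    fix x :: rat assume "x \<in> {x. of_int N * x \<in> \<int> \<and> \<bar>real_of_rat x\<bar> \<le> B}"
    then obtain i where i: "of_int N * x = of_int i" and B: "\<bar>real_of_rat x\<bar> \<le> B"
      by (auto elim: Ints_cases)
    have x: "x = of_int i / of_int N"
      using assms i by (simp add: field_simps)
    have "real_of_int i = real_of_int N * real_of_rat x"
      using assms by (simp add: x of_rat_divide)
    then have "\<bar>real_of_int i\<bar> \<le> of_int N * B"
      using assms B by (simp add: abs_mult)
    then have "i \<in> {- \<lceil>of_int N * B\<rceil>..\<lceil>of_int N * B\<rceil>}"
      by (simp; linarith)
    with x show "x \<in> (\<lambda>i. of_int i / of_int N) ` {- \<lceil>of_int N * B\<rceil>..\<lceil>of_int N * B\<rceil>}"
      by blast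
  qed
qed simp

text \<open>Division by the monic integer polynomial \<open>q\<close> stays within integer polynomials. Modulo \<open>p\<close>, an
  integer polynomial is therefore an integer combination of finitely many residues of monomials, for
  which a common denominator exists.\<close>

lemma residue_denominator:
  fixes p :: "rat poly" and q :: "int poly"
  assumes "lead_coeff q = 1" "p dvd map_poly of_int q"
  shows "\<exists>N :: int. N > 0 \<and> (\<forall>P k. of_int N * coeff (map_poly of_int P mod p) k \<in> \<int>)"
proof -
  let ?e = "map_poly of_int :: int poly \<Rightarrow> rat poly"
  let ?A = "(\<lambda>(j, k). coeff (monom 1 j mod p) k) ` ({..<degree q} \<times> {..degree p})"
  obtain N where N: "N > 0" "\<And>a. a \<in> ?A \<Longrightarrow> of_int N * a \<in> \<int>"
    using common_denominator[of ?A] by blast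
  have "of_int N * coeff (?e P mod p) k \<in> \<int>" if "k \<le> degree p" for P k
  proof -
    have q0: "q \<noteq> 0" using assms(1) by auto
    obtain A S where AS: "pseudo_divmod P q = (A, S)" by (cases "pseudo_divmod P q")
    have "P = q * A + S" and S: "S = 0 \<or> degree S < degree q"
      using pseudo_divmod[OF q0 AS] assms(1) by auto
    then have "?e P = ?e q * ?e A + ?e S"
      by (intro poly_eqI) (simp add: coeff_map_poly coeff_mult)
    then have "?e P mod p = ?e S mod p"
      using assms(2) by (simp add: mod_eq_dvd_iff)
    also have "?e S = (\<Sum>j<degree q. smult (of_int (coeff S j)) (monom 1 j))"
    proof (rule poly_eqI)
      fix n
      have "coeff S n = 0" if "n \<ge> degree q"
        using S that by (auto simp: coeff_eq_0)
      then show "coeff (?e S) n = coeff (\<Sum>j<degree q. smult (of_int (coeff S j)) (monom 1 j)) n"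
        by (cases "n < degree q") (auto simp: coeff_map_poly coeff_sum if_distrib cong: if_cong)
    qed
    also have "(\<Sum>j<n. smult (of_int (coeff S j)) (monom 1 j)) mod p =
        (\<Sum>j<n. smult (of_int (coeff S j)) (monom 1 j mod p))" for n
      by (induction n) (auto simp: poly_mod_add_left mod_smult_left)
    finally have "of_int N * coeff (?e P mod p) k =
        (\<Sum>j<degree q. of_int (coeff S j) * (of_int N * coeff (monom 1 j mod p) k))"
      by (simp add: coeff_sum sum_distrib_left mult_ac)
    also have "\<dots> \<in> \<int>"
      using that by (intro Ints_sum Ints_mult N(2)) auto
    finally show ?thesis .
  qed
  moreover have "coeff (?e P mod p) k = 0" if "k > degree p" for P k
  proof -
    have "?e q \<noteq> 0" using assms(1) by (auto simp: map_poly_eq_0_iff)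
    then have "p \<noteq> 0" using assms(2) by auto
    then show ?thesis using that degree_mod_less[of p "?e P"] by (auto simp: coeff_eq_0)
  qed
  ultimately have "of_int N * coeff (?e P mod p) k \<in> \<int>" for P k
    by (cases "k \<le> degree p") auto
  with N(1) show ?thesis by blast
qed

lemma norm_int_poly_le:
  fixes z :: complex and P :: "int poly"
  assumes "cmod z < 1" "\<And>k. \<bar>coeff P k\<bar> \<le> C"
  shows "cmod (poly (map_poly of_int P) z) \<le> of_int C / (1 - cmod z)"
proof -
  have C: "C \<ge> 0" using assms(2)[of 0] by linarith
  have "poly (map_poly of_int P) z = (\<Sum>i\<le>degree P. of_int (coeff P i) * z ^ i)"
    by (subst poly_altdef) (simp add: degree_map_poly coeff_map_poly)
  also have "cmod \<dots> \<le> (\<Sum>i\<le>degree P. of_int C * cmod z ^ i)"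
  proof (rule sum_norm_le)
    fix i
    have "\<bar>real_of_int (coeff P i)\<bar> \<le> real_of_int C" using assms(2)[of i] by linarith
    then show "cmod (of_int (coeff P i) * z ^ i) \<le> of_int C * cmod z ^ i"
      by (simp add: norm_mult norm_power mult_right_mono)
  qed
  also have "\<dots> \<le> of_int C * (1 / (1 - cmod z))"
  proof -
    have "(\<Sum>i\<le>degree P. cmod z ^ i) \<le> (\<Sum>i. cmod z ^ i)"
      using assms(1) by (intro sum_le_suminf summable_geometric) auto
    then show ?thesis
      using C assms(1) by (simp add: suminf_geometric flip: sum_distrib_left) (metis mult_left_mono of_int_0_le_iff times_divide_eq_right mult.right_neutral)
  qed
  finally show ?thesis by simp
qed

text \<open>The residue of \<open>P\<close> modulo the minimal polynomial of
  \<open>\<beta>\<close> takes the same values as \<open>P\<close> at \<open>\<beta>\<close> and its conjugates, and all these values are bounded: at \<open>\<beta>\<close>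
  by assumption, elsewhere by a geometric series. Since there are as many conjugates as coefficients,
  the coefficients of the residue are bounded; having a common denominator, they take finitely many
  values.\<close>

lemma finite_bounded_pisot_values:
  fixes K :: real and C :: int
  assumes "pisot \<beta>"
  shows "finite {poly (map_poly of_int P) \<beta> | P. (\<forall>k. \<bar>coeff P k\<bar> \<le> C) \<and> \<bar>poly (map_poly of_int P) \<beta>\<bar> \<le> K}"
proof -
  have alg: "algebraic_int \<beta>" using assms by (simp add: pisot_def)
  obtain q :: "int poly" where q: "poly (map_poly of_int q) \<beta> = 0" "lead_coeff q = 1"
    using alg unfolding algebraic_int_altdef_ipoly by blast
  define Q :: "rat poly" where "Q = map_poly of_int q"
  have Q0: "Q \<noteq> 0" using q(2) by (auto simp: Q_def map_poly_eq_0_iff)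
  have Q: "rat_eval Q \<beta> = 0" using q(1) by (simp add: Q_def rat_eval_of_int_poly)
  obtain p :: "rat poly" where p: "irreducible p" "rat_eval p \<beta> = 0"
    using irreducible_annihilator[OF Q0 Q] by blast
  then have p0: "p \<noteq> 0" by auto
  obtain N :: int where N: "N > 0" "\<And>P k. of_int N * coeff (map_poly of_int P mod p) k \<in> \<int>"
    using residue_denominator[OF q(2) irreducible_dvd_of_root[OF p Q, unfolded Q_def]] by blast
  define Z where "Z = {z :: complex. rat_eval p z = 0}"
  have cardZ: "card Z = degree p"
    unfolding Z_def by (rule card_roots_irreducible[OF p(1)])
  have finZ: "finite Z"
    unfolding Z_def using p0 by (intro poly_roots_finite) (simp add: map_poly_eq_0_iff)
  have conj: "cmod z < 1" if "z \<in> Z" "z \<noteq> of_real \<beta>" for z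
    using assms that p unfolding pisot_def galois_conjugate_def Z_def by blast
  have deg: "degree p > 0"
    using p p0 by (metis gr0I irreducible_not_unit is_unit_iff_degree)
  obtain L where L: "\<And>R. degree R < card Z \<Longrightarrow> R = (\<Sum>z\<in>Z. smult (poly R z) (L z))"
    using lagrange_interpolation[OF finZ] by blast
  \<comment> \<open>\<open>M z\<close> bounds the value at the conjugate \<open>z\<close>, and \<open>B k\<close> the resulting coefficient of index \<open>k\<close>.\<close>
  define M where "M z = (if z = of_real \<beta> then K else of_int C / (1 - cmod z))" for z
  define B where "B k = (\<Sum>z\<in>Z. M z * cmod (coeff (L z) k))" for k
  define S where "S k = {x :: rat. of_int N * x \<in> \<int> \<and> \<bar>real_of_rat x\<bar> \<le> B k}" for k
  define val where "val f = (\<Sum>k<degree p. real_of_rat (f k) * \<beta> ^ k)" for f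
  have "finite (val ` (PiE {..<degree p} S))"
    unfolding S_def by (intro finite_imageI finite_PiE finite_bounded_denominator N) auto
  moreover have "{poly (map_poly of_int P) \<beta> | P. (\<forall>k. \<bar>coeff P k\<bar> \<le> C) \<and> \<bar>poly (map_poly of_int P) \<beta>\<bar> \<le> K}
      \<subseteq> val ` (PiE {..<degree p} S)"
  proof safe
    fix P :: "int poly"
    assume C: "\<forall>k. \<bar>coeff P k\<bar> \<le> C" and K: "\<bar>poly (map_poly of_int P) \<beta>\<bar> \<le> K"
    define R where "R = map_poly of_int P mod p"
    have degR: "degree R < degree p"
      unfolding R_def using degree_mod_less[OF p0, of "map_poly of_int P"] deg by auto
    have eval: "rat_eval R z = poly (map_poly of_int P) z" if "rat_eval p z = 0" for z :: "'z :: field_char_0"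
    proof -
      have "map_poly of_int P = map_poly of_int P div p * p + R"
        by (simp add: R_def)
      then have "rat_eval (map_poly of_int P) z = rat_eval (map_poly of_int P div p * p + R) z"
        by simp
      with that show ?thesis
        by (simp only: rat_eval_add rat_eval_mult rat_eval_of_int_poly) simp
    qed
    have M: "cmod (rat_eval R z) \<le> M z" if z: "z \<in> Z" for z
    proof (cases "z = of_real \<beta>")
      case True
      have "poly (map_poly of_int P) (complex_of_real \<beta>) = of_real (poly (map_poly of_int P) \<beta>)"
        by (induction P) (auto simp: map_poly_pCons)
      then show ?thesis
        using K eval[of z] z by (simp add: M_def True Z_def)
    next
      case False
      then show ?thesis
        using norm_int_poly_le[OF conj[OF z False], of P C] C eval[of z] z by (simp add: M_def Z_def)
    qed
    have "coeff R k \<in> S k" for k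
    proof -
      let ?R = "map_poly of_rat R :: complex poly"
      have "cmod (coeff ?R k) = cmod (\<Sum>z\<in>Z. rat_eval R z * coeff (L z) k)"
        by (subst L[of ?R]) (auto simp: coeff_sum cardZ degR degree_map_poly)
      also have "\<dots> \<le> B k"
        unfolding B_def by (rule sum_norm_le) (auto simp: norm_mult intro!: mult_right_mono M)
      finally have "cmod (coeff ?R k) \<le> B k" .
      moreover have "cmod (coeff ?R k) = \<bar>real_of_rat (coeff R k)\<bar>"
        by (simp add: coeff_map_poly flip: complex_of_real_of_rat)
      ultimately show ?thesis
        using N(2)[of P k] by (simp add: S_def R_def)
    qed
    moreover have "poly (map_poly of_int P) \<beta> = val (restrict (coeff R) {..<degree p})"
    proof -
      have "rat_eval R \<beta> = (\<Sum>k\<le>degree R. real_of_rat (coeff R k) * \<beta> ^ k)"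
        by (subst poly_altdef) (simp add: degree_map_poly coeff_map_poly)
      also have "\<dots> = (\<Sum>k<degree p. real_of_rat (coeff R k) * \<beta> ^ k)"
        using degR by (intro sum.mono_neutral_left) (auto simp: coeff_eq_0)
      finally show ?thesis using eval[OF p(2)] by (simp add: val_def)
    qed
    ultimately show "poly (map_poly of_int P) \<beta> \<in> val ` (PiE {..<degree p} S)"
      by (intro image_eqI[of _ _ "restrict (coeff R) {..<degree p}"]) auto
  qed
  ultimately show ?thesis by (rule finite_subset[rotated])
qed

section \<open>Values of digit sequences\<close>

text \<open>The word is read as the digits after a radix point.\<close>

definition word_value :: "real \<Rightarrow> int word \<Rightarrow> real" where
  "word_value \<beta> c = (\<Sum>j. of_int (c j) / \<beta> ^ Suc j)"

lemma summable_word_value_norm: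
  assumes "\<beta> > 1" "\<And>j. \<bar>c j\<bar> \<le> C"
  shows "summable (\<lambda>j. norm (real_of_int (c j) / \<beta> ^ Suc j))"
proof (rule summable_comparison_test')
  show "summable (\<lambda>j. real_of_int C / \<beta> * (1 / \<beta>) ^ j)"
    using assms(1) by (intro summable_mult summable_geometric) auto
  fix j
  have "\<bar>real_of_int (c j)\<bar> \<le> real_of_int C" using assms(2)[of j] by linarith
  then show "norm (norm (real_of_int (c j) / \<beta> ^ Suc j)) \<le> real_of_int C / \<beta> * (1 / \<beta>) ^ j"
    using assms(1) by (simp add: abs_divide power_divide divide_right_mono)
qed

lemma sums_word_value:
  assumes "\<beta> > 1" "\<And>j. \<bar>c j\<bar> \<le> C"
  shows "(\<lambda>j. real_of_int (c j) / \<beta> ^ Suc j) sums word_value \<beta> c"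
  unfolding word_value_def
  by (intro summable_sums summable_norm_cancel[OF summable_word_value_norm[OF assms]])

lemma word_value_rec:
  assumes "\<beta> > 1" "\<And>j. \<bar>c j\<bar> \<le> C"
  shows "\<beta> * word_value \<beta> c = of_int (c 0) + word_value \<beta> (suffix 1 c)"
proof -
  have "(\<lambda>j. real_of_int (c (Suc j)) / \<beta> ^ Suc (Suc j)) sums (word_value \<beta> c - of_int (c 0) / \<beta>)"
    using sums_word_value[OF assms] by (subst sums_Suc_iff) simp
  from sums_mult[OF this, of \<beta>]
  have "(\<lambda>j. real_of_int (suffix 1 c j) / \<beta> ^ Suc j) sums (\<beta> * (word_value \<beta> c - of_int (c 0) / \<beta>))"
    using assms(1) by simp
  moreover have "(\<lambda>j. real_of_int (suffix 1 c j) / \<beta> ^ Suc j) sums word_value \<beta> (suffix 1 c)"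
    by (rule sums_word_value[OF assms(1), of _ C]) (simp add: assms(2))
  ultimately have "\<beta> * (word_value \<beta> c - of_int (c 0) / \<beta>) = word_value \<beta> (suffix 1 c)"
    by (rule sums_unique2)
  then show ?thesis using assms(1) by (simp add: algebra_simps)
qed

lemma word_value_of_remainders:
  assumes "\<beta> > 1" "\<And>n. t (Suc n) = \<beta> * t n - of_int (c n)" "\<And>n. \<bar>t n\<bar> \<le> B"
  shows "word_value \<beta> c = t 0"
proof -
  have partial: "(\<Sum>j<n. real_of_int (c j) / \<beta> ^ Suc j) = t 0 - t n / \<beta> ^ n" for n
  proof (induction n)
    case (Suc n)
    have "t n / \<beta> ^ n = \<beta> * t n / \<beta> ^ Suc n" using assms(1) by simp
    then show ?case unfolding sum.lessThan_Suc Suc assms(2) diff_divide_distrib by linarith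
  qed simp
  have "(\<lambda>n. (1 / \<beta>) ^ n * B) \<longlonglongrightarrow> 0 * B"
    using assms(1) by (intro tendsto_intros LIMSEQ_power_zero) auto
  then have lim: "(\<lambda>n. (1 / \<beta>) ^ n * B) \<longlonglongrightarrow> 0"
    by simp
  have "(\<lambda>n. t n / \<beta> ^ n) \<longlonglongrightarrow> 0"
  proof (rule Lim_null_comparison[OF _ lim], rule always_eventually, rule allI)
    fix n
    show "norm (t n / \<beta> ^ n) \<le> (1 / \<beta>) ^ n * B"
      using assms(1) assms(3)[of n] by (simp add: abs_divide power_divide divide_right_mono)
  qed
  then have "(\<lambda>n. t 0 - t n / \<beta> ^ n) \<longlonglongrightarrow> t 0 - 0"
    by (intro tendsto_intros)
  then have "(\<lambda>j. real_of_int (c j) / \<beta> ^ Suc j) sums t 0"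
    by (simp only: sums_def partial diff_zero)
  then show ?thesis unfolding word_value_def by (rule sums_unique[symmetric])
qed

lemma abs_word_value_le:
  assumes "\<beta> > 1" "\<And>j. \<bar>c j\<bar> \<le> C"
  shows "\<bar>word_value \<beta> c\<bar> \<le> of_int C / (\<beta> - 1)"
proof -
  have K: "word_value \<beta> (\<lambda>_. C) = of_int C / (\<beta> - 1)"
    by (rule word_value_of_remainders[of \<beta> "\<lambda>_. of_int C / (\<beta> - 1)" _ "\<bar>of_int C / (\<beta> - 1)\<bar>"])
       (use assms(1) in \<open>auto simp: field_simps\<close>)
  have C: "\<bar>C\<bar> \<le> C" using assms(2)[of 0] by linarith
  have "\<bar>word_value \<beta> c\<bar> \<le> (\<Sum>j. norm (real_of_int (c j) / \<beta> ^ Suc j))"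
    unfolding word_value_def real_norm_def[symmetric]
    by (rule summable_norm[OF summable_word_value_norm[OF assms]])
  also have "\<dots> \<le> (\<Sum>j. real_of_int C / \<beta> ^ Suc j)"
  proof (rule suminf_le)
    fix j
    have "\<bar>real_of_int (c j)\<bar> \<le> real_of_int C" using assms(2)[of j] by linarith
    then show "norm (real_of_int (c j) / \<beta> ^ Suc j) \<le> real_of_int C / \<beta> ^ Suc j"
      using assms(1) by (simp add: abs_divide divide_right_mono)
  next
    show "summable (\<lambda>j. norm (real_of_int (c j) / \<beta> ^ Suc j))"
      by (rule summable_word_value_norm[OF assms])
    show "summable (\<lambda>j. real_of_int C / \<beta> ^ Suc j)"
      by (rule sums_summable[OF sums_word_value[OF assms(1), of "\<lambda>_. C" C]]) (use C in simp)
  qed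
  also have "\<dots> = of_int C / (\<beta> - 1)"
    using K by (simp add: word_value_def)
  finally show ?thesis .
qed

lemma word_value_uminus:
  assumes "\<beta> > 1" "\<And>j. \<bar>c j\<bar> \<le> C"
  shows "word_value \<beta> (\<lambda>j. - c j) = - word_value \<beta> c"
  using sums_unique[OF sums_minus[OF sums_word_value[OF assms]]] by (simp add: word_value_def)

lemma word_value_add:
  assumes "\<beta> > 1" "\<And>j. \<bar>c j\<bar> \<le> C" "\<And>j. \<bar>d j\<bar> \<le> D"
  shows "word_value \<beta> (\<lambda>j. c j + d j) = word_value \<beta> c + word_value \<beta> d"
  using sums_unique[OF sums_add[OF sums_word_value[OF assms(1,2)] sums_word_value[OF assms(1,3)]]]
  by (simp add: word_value_def add_divide_distrib)

section \<open>Comparing values by finite automata\<close>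

text \<open>The initial value \<open>- a\<close> makes the scheme compare the value of the word with \<open>a\<close>.\<close>

primrec horner :: "real \<Rightarrow> int \<Rightarrow> int word \<Rightarrow> nat \<Rightarrow> real" where
  "horner \<beta> a c 0 = - of_int a"
| "horner \<beta> a c (Suc m) = \<beta> * horner \<beta> a c m + of_int (c m)"

lemma horner_eq:
  assumes "\<beta> > 1" "\<And>j. \<bar>c j\<bar> \<le> C"
  shows "horner \<beta> a c m = \<beta> ^ m * (word_value \<beta> c - of_int a) - word_value \<beta> (suffix m c)"
proof (induction m)
  case (Suc m)
  have "\<beta> * word_value \<beta> (suffix m c) = of_int (c m) + word_value \<beta> (suffix (Suc m) c)"
    using word_value_rec[of \<beta> "suffix m c" C] assms by simp
  moreover have "horner \<beta> a c (Suc m) =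
      \<beta> ^ Suc m * (word_value \<beta> c - of_int a) - \<beta> * word_value \<beta> (suffix m c) + of_int (c m)"
    unfolding horner.simps Suc by (simp add: right_diff_distrib)
  ultimately show ?case by linarith
qed simp

lemma horner_is_poly_value:
  assumes "\<And>j. \<bar>c j\<bar> \<le> C" "\<bar>a\<bar> \<le> C"
  shows "\<exists>P :: int poly. (\<forall>k. \<bar>coeff P k\<bar> \<le> C) \<and> horner \<beta> a c m = poly (map_poly of_int P) \<beta>"
proof (induction m)
  case 0
  show ?case
    using assms(2) by (intro exI[of _ "[:- a:]"]) (auto simp: coeff_pCons map_poly_pCons split: nat.split)
next
  case (Suc m)
  then obtain P :: "int poly" where P: "\<And>k. \<bar>coeff P k\<bar> \<le> C" "horner \<beta> a c m = poly (map_poly of_int P) \<beta>"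
    by blast
  then show ?case
    using assms(1)
    by (intro exI[of _ "pCons (c m) P"]) (auto simp: coeff_pCons map_poly_pCons split: nat.split)
qed

text \<open>The automaton computes Horner's scheme exactly as long as the result is at most \<open>K\<close>, the largest
  possible absolute value of a tail. Exceeding \<open>K\<close> once is equivalent to a value greater than \<open>a\<close>, and
  is remembered by the accepting sink \<open>None\<close>. On accepted words the scheme never falls below \<open>- K\<close>, so
  finitely many states suffice.\<close>

lemma omega_regular_word_value_gt:
  assumes "pisot \<beta>" "C \<ge> 0"
  shows "omega_regular (\<lambda>c. (\<forall>j. \<bar>c j\<bar> \<le> C) \<and> word_value \<beta> c > of_int a)"
proof -
  have \<beta>: "\<beta> > 1" using assms(1) by (simp add: pisot_def)
  define K where "K = of_int C / (\<beta> - 1)"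
  have K0: "K \<ge> 0" using \<beta> assms(2) by (simp add: K_def)
  \<comment> \<open>The initial value \<open>- a\<close> counts as a coefficient, too.\<close>
  define D where "D = max C \<bar>a\<bar>"
  define S where "S = {poly (map_poly of_int P) \<beta> | P. (\<forall>k. \<bar>coeff P k\<bar> \<le> D) \<and> \<bar>poly (map_poly of_int P) \<beta>\<bar> \<le> K}"
  define nxt where "nxt s = (if s > K then None else Some s)" for s :: real
  define \<delta> where "\<delta> p (e::int) q \<longleftrightarrow> \<bar>e\<bar> \<le> C \<and> q = (case p of None \<Rightarrow> None | Some s \<Rightarrow> nxt (\<beta> * s + of_int e))" for p e q
  define st where "st c m = (if \<exists>i\<le>m. horner \<beta> a c i > K then None else Some (horner \<beta> a c m))" for c m
  have st_0: "st c 0 = nxt (- of_int a)" for c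
    by (simp add: st_def nxt_def)
  have st_Suc: "st c (Suc m) = (case st c m of None \<Rightarrow> None | Some s \<Rightarrow> nxt (\<beta> * s + of_int (c m)))" for c m
    by (auto simp: st_def nxt_def le_Suc_eq)
  have gt_iff: "word_value \<beta> c > of_int a \<longleftrightarrow> (\<exists>m. horner \<beta> a c m > K)" if c: "\<And>j. \<bar>c j\<bar> \<le> C" for c
  proof
    assume "\<exists>m. horner \<beta> a c m > K"
    then obtain m where m: "horner \<beta> a c m > K" by blast
    have "\<bar>word_value \<beta> (suffix m c)\<bar> \<le> K"
      unfolding K_def by (rule abs_word_value_le[OF \<beta>]) (simp add: c)
    with m have "\<beta> ^ m * (word_value \<beta> c - of_int a) > 0"
      unfolding horner_eq[OF \<beta> c] by linarith
    then show "word_value \<beta> c > of_int a"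
      using \<beta> by (simp add: zero_less_mult_iff)
  next
    assume gt: "word_value \<beta> c > of_int a"
    obtain m where m: "2 * K / (word_value \<beta> c - of_int a) < \<beta> ^ m"
      using real_arch_pow[OF \<beta>] by blast
    then have "\<beta> ^ m * (word_value \<beta> c - of_int a) > 2 * K"
      using gt by (simp add: field_simps)
    moreover have "\<bar>word_value \<beta> (suffix m c)\<bar> \<le> K"
      unfolding K_def by (rule abs_word_value_le[OF \<beta>]) (simp add: c)
    ultimately have "horner \<beta> a c m > K"
      unfolding horner_eq[OF \<beta> c] by linarith
    then show "\<exists>m. horner \<beta> a c m > K" ..
  qed
  show ?thesis
  proof (rule omega_regularI[where Q = "insert None (Some ` S)" and \<delta> = \<delta> and I = "{nxt (- of_int a)}" and F = "{None}"])
    show "finite (insert None (Some ` S))"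
      unfolding S_def by (simp add: finite_bounded_pisot_values[OF assms(1)])
  next
    fix c
    show "(\<forall>j. \<bar>c j\<bar> \<le> C) \<and> word_value \<beta> c > of_int a \<longleftrightarrow>
        buchi_accepts (insert None (Some ` S)) \<delta> {nxt (- of_int a)} {None} c" (is "?L \<longleftrightarrow> ?R")
    proof
      assume L: ?L
      then have c: "\<And>j. \<bar>c j\<bar> \<le> C" by blast
      have "st c m \<in> insert None (Some ` S)" for m
      proof (cases "st c m")
        case (Some s)
        then have s: "s = horner \<beta> a c m" "\<not> s > K"
          by (auto simp: st_def split: if_splits)
        have "\<bar>word_value \<beta> (suffix m c)\<bar> \<le> K"
          unfolding K_def by (rule abs_word_value_le[OF \<beta>]) (simp add: c)
        moreover have "\<beta> ^ m * (word_value \<beta> c - of_int a) \<ge> 0"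
          using L \<beta> by simp
        ultimately have "s \<ge> - K"
          unfolding s horner_eq[OF \<beta> c] by linarith
        with s have "\<bar>s\<bar> \<le> K" by simp
        moreover obtain P :: "int poly" where "\<forall>k. \<bar>coeff P k\<bar> \<le> D" "s = poly (map_poly of_int P) \<beta>"
          using horner_is_poly_value[of c D a \<beta> m] c unfolding s D_def by (auto simp: max.coboundedI1)
        ultimately have "s \<in> S" unfolding S_def by blast
        with Some show ?thesis by simp
      qed simp
      moreover have "\<delta> (st c j) (c j) (st c (Suc j))" for j
        using c by (simp add: \<delta>_def st_Suc)
      moreover obtain m where m: "horner \<beta> a c m > K"
        using gt_iff[of c, OF c] L by blast
      have "\<exists>\<^sub>\<infinity>j. st c j \<in> {None}"
        unfolding INFM_nat_le
      proof
        fix n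
        have "st c (max m n) = None"
          using m by (auto simp: st_def intro: exI[of _ m])
        then show "\<exists>j\<ge>n. st c j \<in> {None}" by (intro exI[of _ "max m n"]) simp
      qed
      ultimately show ?R
        unfolding buchi_accepts_def using st_0 by blast
    next
      assume ?R
      then obtain r where r: "r 0 = nxt (- of_int a)" "\<And>j. \<delta> (r j) (c j) (r (Suc j))" "\<exists>\<^sub>\<infinity>j. r j \<in> {None}"
        unfolding buchi_accepts_def by blast
      have c: "\<bar>c j\<bar> \<le> C" for j using r(2)[of j] by (simp add: \<delta>_def)
      have "r j = st c j" for j
      proof (induction j)
        case (Suc j)
        then show ?case using r(2)[of j] by (simp add: \<delta>_def st_Suc)
      qed (simp add: r st_0)
      then obtain m where "st c m = None"
        using INFM_EX[OF r(3)] by auto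
      then have "\<exists>m. horner \<beta> a c m > K"
        by (auto simp: st_def split: if_splits)
      with gt_iff[of c, OF c] c show ?L by blast
    qed
  qed
qed

lemma omega_regular_letter_value_gt:
  assumes "pisot \<beta>" "C \<ge> 0"
  shows "omega_regular (\<lambda>w. (\<forall>j. \<bar>f (w j)\<bar> \<le> C) \<and> word_value \<beta> (\<lambda>j. f (w j)) > of_int a)"
  using omega_regular_vimage[OF omega_regular_word_value_gt[OF assms]] .

lemma omega_regular_letter_value_lt:
  assumes "pisot \<beta>" "C \<ge> 0"
  shows "omega_regular (\<lambda>w. (\<forall>j. \<bar>f (w j)\<bar> \<le> C) \<and> word_value \<beta> (\<lambda>j. f (w j)) < of_int a)"
proof -
  have \<beta>: "\<beta> > 1" using assms(1) by (simp add: pisot_def)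
  have "(\<lambda>w. (\<forall>j. \<bar>f (w j)\<bar> \<le> C) \<and> word_value \<beta> (\<lambda>j. f (w j)) < of_int a) =
      (\<lambda>w. (\<forall>j. \<bar>- f (w j)\<bar> \<le> C) \<and> word_value \<beta> (\<lambda>j. - f (w j)) > of_int (- a))"
    by (intro ext conj_cong) (auto simp: word_value_uminus[OF \<beta>, of _ C])
  then show ?thesis
    using omega_regular_letter_value_gt[OF assms, of "\<lambda>x. - f x" "- a"] by simp
qed

section \<open>Expansions as digit words\<close>

text \<open>The greedy condition, rescaled: the tail after each position must be worth less than one unit
  of that position.\<close>

definition nonneg_expansion :: "real \<Rightarrow> int word \<Rightarrow> bool" where
  "nonneg_expansion \<beta> c \<longleftrightarrow> (\<forall>j. c j \<in> digits \<beta>) \<and> (\<forall>k. word_value \<beta> (suffix k c) < 1)"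

text \<open>The sign of an expansion is carried by its digits, so that zero has only one expansion.\<close>

definition signed_expansion :: "real \<Rightarrow> int word \<Rightarrow> bool" where
  "signed_expansion \<beta> c \<longleftrightarrow> nonneg_expansion \<beta> c \<or> nonneg_expansion \<beta> (\<lambda>j. - c j)"

lemma digits_bounded: "e \<in> digits \<beta> \<Longrightarrow> \<bar>e\<bar> \<le> \<lceil>\<beta>\<rceil> - 1"
  by (simp add: digits_def)

lemma nonneg_expansion_bounded: "nonneg_expansion \<beta> c \<Longrightarrow> \<bar>c j\<bar> \<le> \<lceil>\<beta>\<rceil> - 1"
  unfolding nonneg_expansion_def using digits_bounded by blast

lemma signed_expansion_bounded: "signed_expansion \<beta> c \<Longrightarrow> \<bar>c j\<bar> \<le> \<lceil>\<beta>\<rceil> - 1"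
  unfolding signed_expansion_def using nonneg_expansion_bounded[of \<beta> c j]
    nonneg_expansion_bounded[of \<beta> "\<lambda>j. - c j" j] by auto

lemma nonneg_expansion_suffix: "nonneg_expansion \<beta> c \<Longrightarrow> nonneg_expansion \<beta> (suffix k c)"
  by (simp add: nonneg_expansion_def)

lemma word_value_zero [simp]: "word_value \<beta> (\<lambda>_. 0) = 0"
  by (simp add: word_value_def)

lemma word_value_nonneg:
  assumes "\<beta> > 1" "\<And>j. c j \<in> digits \<beta>"
  shows "word_value \<beta> c \<ge> 0"
proof -
  have sums: "(\<lambda>j. real_of_int (c j) / \<beta> ^ Suc j) sums word_value \<beta> c"
    by (rule sums_word_value[OF assms(1) digits_bounded[OF assms(2)]])
  have "0 \<le> real_of_int (c j) / \<beta> ^ Suc j" for j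
    using assms(1) assms(2)[of j] by (simp add: digits_def)
  then show ?thesis
    by (rule sums_le[OF _ sums_zero sums])
qed

lemma word_value_rec_expansion:
  assumes "\<beta> > 1" "nonneg_expansion \<beta> c"
  shows "\<beta> * word_value \<beta> c = of_int (c 0) + word_value \<beta> (suffix 1 c)"
    and "0 \<le> word_value \<beta> c" "word_value \<beta> c < 1"
proof -
  show "\<beta> * word_value \<beta> c = of_int (c 0) + word_value \<beta> (suffix 1 c)"
    by (rule word_value_rec[OF assms(1) nonneg_expansion_bounded[OF assms(2)]])
  show "0 \<le> word_value \<beta> c"
    using assms by (intro word_value_nonneg) (auto simp: nonneg_expansion_def)
  show "word_value \<beta> c < 1"
    using assms(2) unfolding nonneg_expansion_def by (metis suffix_0)
qed

text \<open>Each digit is the integer part of \<open>\<beta>\<close> times the value of the word that starts at it.\<close>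

lemma nonneg_expansion_unique:
  assumes \<beta>: "\<beta> > 1" and c: "nonneg_expansion \<beta> c" and d: "nonneg_expansion \<beta> d"
    and eq: "word_value \<beta> c = word_value \<beta> d"
  shows "c = d"
proof -
  have first: "c 0 = \<lfloor>\<beta> * word_value \<beta> c\<rfloor>" if "nonneg_expansion \<beta> c" for c
    using word_value_rec_expansion[OF \<beta> that]
      word_value_rec_expansion(2,3)[OF \<beta> nonneg_expansion_suffix[OF that, of 1]] by linarith
  have "word_value \<beta> (suffix j c) = word_value \<beta> (suffix j d)" for j
  proof (induction j)
    case (Suc j)
    have step: "word_value \<beta> (suffix (Suc j) e) =
        \<beta> * word_value \<beta> (suffix j e) - of_int \<lfloor>\<beta> * word_value \<beta> (suffix j e)\<rfloor>"
      if "nonneg_expansion \<beta> e" for e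
      using word_value_rec_expansion(1)[OF \<beta> nonneg_expansion_suffix[OF that, of j]]
        first[OF nonneg_expansion_suffix[OF that, of j]] by simp
    show ?case unfolding step[OF c] step[OF d] Suc ..
  qed (simp add: eq)
  then have "c j = d j" for j
    using first[OF nonneg_expansion_suffix[OF c, of j]] first[OF nonneg_expansion_suffix[OF d, of j]] by simp
  then show ?thesis by blast
qed

text \<open>The digits come from iterating \<open>t \<mapsto> \<beta> t - \<lfloor>\<beta> t\<rfloor>\<close> on the unit interval.\<close>

lemma nonneg_expansion_exists:
  assumes \<beta>: "\<beta> > 1" and y: "0 \<le> y" "y < 1"
  shows "\<exists>c. nonneg_expansion \<beta> c \<and> word_value \<beta> c = y"
proof -
  define t where "t n = ((\<lambda>s. frac (\<beta> * s)) ^^ n) y" for n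
  define c where "c n = \<lfloor>\<beta> * t n\<rfloor>" for n
  have t: "0 \<le> t n \<and> t n < 1" for n
    by (induction n) (use y in \<open>auto simp: t_def frac_lt_1\<close>)
  have t_Suc: "t (Suc n) = \<beta> * t n - of_int (c n)" for n
    by (simp add: t_def c_def frac_def)
  have val: "word_value \<beta> (suffix k c) = t k" for k
  proof -
    have "\<bar>t n\<bar> \<le> 1" for n using t[of n] by simp
    then show ?thesis
      using word_value_of_remainders[of \<beta> "\<lambda>n. t (k + n)" "suffix k c" 1] \<beta> t_Suc by simp
  qed
  have "c n \<in> digits \<beta>" for n
  proof -
    have "0 \<le> \<beta> * t n" "\<beta> * t n < \<beta>"
      using \<beta> t[of n] by auto
    then show ?thesis
      unfolding digits_def c_def by (simp; linarith)
  qed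
  with val t have "nonneg_expansion \<beta> c"
    unfolding nonneg_expansion_def by simp
  moreover have "word_value \<beta> c = y"
    using val[of 0] by (simp add: t_def)
  ultimately show ?thesis by blast
qed

lemma suffix_Suc_build [simp]: "suffix (Suc k) (a ## w) = suffix k w"
  by (rule ext) simp

lemma word_value_prepend_zero:
  assumes "\<beta> > 1" "\<And>j. \<bar>c j\<bar> \<le> C"
  shows "word_value \<beta> (0 ## c) = word_value \<beta> c / \<beta>"
proof -
  have "C \<ge> 0" using assms(2)[of 0] by linarith
  then have "\<bar>(0 ## c) j\<bar> \<le> C" for j
    using assms(2) by (cases j) auto
  from word_value_rec[of \<beta> "0 ## c" C, OF assms(1) this] have "\<beta> * word_value \<beta> (0 ## c) = word_value \<beta> c"
    by simp
  then show ?thesis using assms(1) by (simp add: field_simps)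
qed

lemma nonneg_expansion_prepend_zero:
  assumes "\<beta> > 1" "nonneg_expansion \<beta> c"
  shows "nonneg_expansion \<beta> (0 ## c)"
proof -
  have "0 \<in> digits \<beta>" using assms(1) by (simp add: digits_def)
  moreover have "word_value \<beta> c / \<beta> < 1"
    using word_value_rec_expansion(3)[OF assms] assms(1) by simp
  ultimately have "(0 ## c) j \<in> digits \<beta> \<and> word_value \<beta> (suffix j (0 ## c)) < 1" for j
    using assms word_value_prepend_zero[of \<beta> c, OF assms(1) nonneg_expansion_bounded[OF assms(2)]]
    by (cases j) (auto simp: nonneg_expansion_def)
  then show ?thesis by (simp add: nonneg_expansion_def)
qed

section \<open>The digits of a real number\<close>

text \<open>Index \<open>l - j\<close> of the two-sided digit sequence becomes position \<open>j\<close> of a word.\<close>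

lemma has_sum_digits:
  assumes \<beta>: "\<beta> > 1" and d: "\<And>j. \<bar>d (l - int j)\<bar> \<le> C"
  shows "((\<lambda>i. real_of_int (d i) * \<beta> powi i) has_sum
     (\<beta> powi (l + 1) * word_value \<beta> (\<lambda>j. d (l - int j)))) {..l}"
proof -
  let ?c = "\<lambda>j. d (l - int j)"
  have "((\<lambda>j. real_of_int (?c j) / \<beta> ^ Suc j) has_sum word_value \<beta> ?c) UNIV"
    by (rule norm_summable_imp_has_sum[OF summable_word_value_norm[OF \<beta>] sums_word_value[OF \<beta>]]) (rule d)+
  then have "((\<lambda>j. \<beta> powi (l + 1) * (real_of_int (?c j) / \<beta> ^ Suc j)) has_sum (\<beta> powi (l + 1) * word_value \<beta> ?c)) UNIV"
    by (rule has_sum_cmult_right)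
  also have "(\<lambda>j. \<beta> powi (l + 1) * (real_of_int (?c j) / \<beta> ^ Suc j)) =
      (\<lambda>i. real_of_int (d i) * \<beta> powi i) \<circ> (\<lambda>j. l - int j)"
  proof
    fix j
    have pow: "\<beta> powi (l + 1) / \<beta> ^ Suc j = \<beta> powi (l - int j)"
      using \<beta> power_int_diff[of \<beta> "l + 1" "int (Suc j)"] by (simp add: algebra_simps flip: power_int_of_nat)
    have "\<beta> powi (l + 1) * (real_of_int (?c j) / \<beta> ^ Suc j) = real_of_int (?c j) * (\<beta> powi (l + 1) / \<beta> ^ Suc j)"
      by simp
    then show "\<beta> powi (l + 1) * (real_of_int (?c j) / \<beta> ^ Suc j) =
        ((\<lambda>i. real_of_int (d i) * \<beta> powi i) \<circ> (\<lambda>j. l - int j)) j"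
      unfolding pow by simp
  qed
  finally have "((\<lambda>i. real_of_int (d i) * \<beta> powi i) has_sum (\<beta> powi (l + 1) * word_value \<beta> ?c)) (range (\<lambda>j. l - int j))"
    by (subst has_sum_reindex) (auto simp: inj_on_def o_def)
  also have "range (\<lambda>j. l - int j) = {..l}"
  proof safe
    fix i assume "i \<le> l"
    then have "i = l - int (nat (l - i))" by simp
    then show "i \<in> range (\<lambda>j. l - int j)" by blast
  qed auto
  finally show ?thesis .
qed

lemma beta_rep_iff:
  assumes \<beta>: "\<beta> > 1"
  shows "beta_rep \<beta> x k d \<longleftrightarrow> nonneg_expansion \<beta> (\<lambda>j. d (int k - int j)) \<and>
    x = \<beta> ^ Suc k * word_value \<beta> (\<lambda>j. d (int k - int j))"
proof (cases "\<forall>i\<le>int k. d i \<in> digits \<beta>")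
  case False
  then obtain i where "i \<le> int k" "d i \<notin> digits \<beta>" by blast
  then have "d (int k - int (nat (int k - i))) \<notin> digits \<beta>" by simp
  then have "\<not> nonneg_expansion \<beta> (\<lambda>j. d (int k - int j))"
    unfolding nonneg_expansion_def by blast
  with False show ?thesis by (simp add: beta_rep_def)
next
  case True
  have bound: "\<bar>d (l - int j)\<bar> \<le> \<lceil>\<beta>\<rceil> - 1" if "l \<le> int k" for l j
    using True that by (intro digits_bounded) auto
  have sum: "((\<lambda>i. real_of_int (d i) * \<beta> powi i) has_sum
     (\<beta> powi (l + 1) * word_value \<beta> (\<lambda>j. d (l - int j)))) {..l}" if "l \<le> int k" for l
    by (rule has_sum_digits[of \<beta> d l, OF \<beta> bound[OF that]])
  have powk: "\<beta> powi (int k + 1) = \<beta> ^ Suc k"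
    by (metis of_nat_Suc power_int_of_nat add.commute)
  have "((\<lambda>i. real_of_int (d i) * \<beta> powi i) has_sum x) {..int k} \<longleftrightarrow>
      x = \<beta> ^ Suc k * word_value \<beta> (\<lambda>j. d (int k - int j))"
    using sum[of "int k"] has_sum_unique unfolding powk by blast
  moreover have "(\<Sum>\<^sub>\<infinity>i\<in>{..l}. real_of_int (d i) * \<beta> powi i) < \<beta> powi (l + 1) \<longleftrightarrow>
      word_value \<beta> (\<lambda>j. d (l - int j)) < 1" if "l \<le> int k" for l
    using infsumI[OF sum[OF that]] \<beta> by simp
  moreover have "(\<forall>l\<le>int k. word_value \<beta> (\<lambda>j. d (l - int j)) < 1) \<longleftrightarrow>
      (\<forall>n. word_value \<beta> (suffix n (\<lambda>j. d (int k - int j))) < 1)" (is "?L \<longleftrightarrow> ?R")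
  proof
    assume L: ?L
    show ?R
    proof
      fix n
      have "suffix n (\<lambda>j. d (int k - int j)) = (\<lambda>j. d (int k - int n - int j))"
        by (simp add: fun_eq_iff algebra_simps)
      then show "word_value \<beta> (suffix n (\<lambda>j. d (int k - int j))) < 1"
        using L[rule_format, of "int k - int n"] by simp
    qed
  next
    assume R: ?R
    show ?L
    proof (intro allI impI)
      fix l assume l: "l \<le> int k"
      then have "suffix (nat (int k - l)) (\<lambda>j. d (int k - int j)) = (\<lambda>j. d (l - int j))"
        by (simp add: fun_eq_iff algebra_simps)
      with R show "word_value \<beta> (\<lambda>j. d (l - int j)) < 1" by metis
    qed
  qed
  ultimately show ?thesis
    using True by (auto simp: beta_rep_def nonneg_expansion_def)
qed

lemma ex_beta_rep_iff:
  assumes \<beta>: "\<beta> > 1" and x: "x \<ge> 0"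
  shows "(\<exists>d. beta_rep \<beta> x k d) \<longleftrightarrow> x < \<beta> ^ Suc k"
proof
  assume "\<exists>d. beta_rep \<beta> x k d"
  then obtain d where d: "nonneg_expansion \<beta> (\<lambda>j. d (int k - int j))"
      "x = \<beta> ^ Suc k * word_value \<beta> (\<lambda>j. d (int k - int j))"
    unfolding beta_rep_iff[OF \<beta>] by blast
  have "\<beta> ^ Suc k > 0" using \<beta> by simp
  with word_value_rec_expansion(3)[OF \<beta> d(1)] show "x < \<beta> ^ Suc k"
    unfolding d(2) by (metis mult.right_neutral mult_less_cancel_left_pos)
next
  assume lt: "x < \<beta> ^ Suc k"
  have "\<beta> ^ Suc k > 0" using \<beta> by simp
  with x lt have "0 \<le> x / \<beta> ^ Suc k" "x / \<beta> ^ Suc k < 1" by auto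
  then obtain c where c: "nonneg_expansion \<beta> c" "word_value \<beta> c = x / \<beta> ^ Suc k"
    using nonneg_expansion_exists[OF \<beta>] by blast
  have "(\<lambda>j. c (nat (int k - (int k - int j)))) = c" by simp
  with c \<beta> have "beta_rep \<beta> x k (\<lambda>i. c (nat (int k - i)))"
    unfolding beta_rep_iff[OF \<beta>] by simp
  then show "\<exists>d. beta_rep \<beta> x k d" by blast
qed

lemma top_index_le_iff:
  assumes \<beta>: "\<beta> > 1"
  shows "top_index \<beta> x \<le> m \<longleftrightarrow> \<bar>x\<bar> < \<beta> ^ Suc m"
proof -
  have top: "top_index \<beta> x = (LEAST k. \<bar>x\<bar> < \<beta> ^ Suc k)"
    unfolding top_index_def using ex_beta_rep_iff[OF \<beta>, of "\<bar>x\<bar>"] by simp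
  obtain n where "\<bar>x\<bar> < \<beta> ^ n" using real_arch_pow[OF \<beta>] by blast
  also have "\<beta> ^ n \<le> \<beta> ^ Suc n" using \<beta> by (intro power_increasing) auto
  finally have top_less: "\<bar>x\<bar> < \<beta> ^ Suc (top_index \<beta> x)"
    unfolding top by (rule LeastI)
  show ?thesis
  proof
    assume "top_index \<beta> x \<le> m"
    then have "\<beta> ^ Suc (top_index \<beta> x) \<le> \<beta> ^ Suc m" using \<beta> by (intro power_increasing) auto
    with top_less show "\<bar>x\<bar> < \<beta> ^ Suc m" by simp
  next
    assume "\<bar>x\<bar> < \<beta> ^ Suc m"
    then show "top_index \<beta> x \<le> m" unfolding top by (rule Least_le)
  qed
qed

lemma abs_digit_top:
  assumes \<beta>: "\<beta> > 1"
  shows "beta_rep \<beta> \<bar>x\<bar> (top_index \<beta> x) (abs_digit \<beta> x) \<and> (\<forall>i > int (top_index \<beta> x). abs_digit \<beta> x i = 0)"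
proof -
  let ?k = "top_index \<beta> x"
  have "\<bar>x\<bar> < \<beta> ^ Suc ?k" using top_index_le_iff[OF \<beta>] by blast
  then obtain d where d: "beta_rep \<beta> \<bar>x\<bar> ?k d"
    using ex_beta_rep_iff[OF \<beta>, of "\<bar>x\<bar>"] by auto
  have "\<exists>!d. beta_rep \<beta> \<bar>x\<bar> ?k d \<and> (\<forall>i > int ?k. d i = 0)"
  proof (rule ex1I)
    show "beta_rep \<beta> \<bar>x\<bar> ?k (\<lambda>i. if i > int ?k then 0 else d i) \<and>
        (\<forall>i > int ?k. (if i > int ?k then 0 else d i) = 0)"
      using d unfolding beta_rep_iff[OF \<beta>] by simp
  next
    fix e assume e: "beta_rep \<beta> \<bar>x\<bar> ?k e \<and> (\<forall>i > int ?k. e i = 0)"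
    have pos: "\<beta> ^ Suc ?k > 0" using \<beta> by simp
    have "(\<lambda>j. e (int ?k - int j)) = (\<lambda>j. d (int ?k - int j))"
      using d e pos unfolding beta_rep_iff[OF \<beta>]
      by (intro nonneg_expansion_unique[OF \<beta>]) (auto simp del: power_Suc)
    then have *: "e (int ?k - int j) = d (int ?k - int j)" for j by meson
    show "e = (\<lambda>i. if i > int ?k then 0 else d i)"
    proof
      fix i show "e i = (if i > int ?k then 0 else d i)"
        using e *[of "nat (int ?k - i)"] by auto
    qed
  qed
  then show ?thesis unfolding abs_digit_def by (rule theI')
qed

text \<open>Any \<open>m\<close> not less than the leading index may be used, because additional leading zeros do not
  violate the greedy condition.\<close>

lemma abs_digit_expansion:
  assumes \<beta>: "\<beta> > 1" and m: "\<bar>x\<bar> < \<beta> ^ Suc m"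
  shows "nonneg_expansion \<beta> (\<lambda>j. abs_digit \<beta> x (int m - int j)) \<and>
    \<beta> ^ Suc m * word_value \<beta> (\<lambda>j. abs_digit \<beta> x (int m - int j)) = \<bar>x\<bar>"
proof -
  have "top_index \<beta> x \<le> m" using m top_index_le_iff[OF \<beta>] by blast
  then show ?thesis
  proof (induction m rule: dec_induct)
    case base
    then show ?case using abs_digit_top[OF \<beta>, of x] unfolding beta_rep_iff[OF \<beta>] by simp
  next
    case (step m)
    have shift: "(\<lambda>j. abs_digit \<beta> x (int (Suc m) - int j)) = 0 ## (\<lambda>j. abs_digit \<beta> x (int m - int j))"
    proof
      fix j
      show "abs_digit \<beta> x (int (Suc m) - int j) = (0 ## (\<lambda>j. abs_digit \<beta> x (int m - int j))) j"
        using abs_digit_top[OF \<beta>, of x] step.hyps by (cases j) auto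
    qed
    have "word_value \<beta> (0 ## (\<lambda>j. abs_digit \<beta> x (int m - int j))) =
        word_value \<beta> (\<lambda>j. abs_digit \<beta> x (int m - int j)) / \<beta>"
      using step.IH by (intro word_value_prepend_zero[OF \<beta> nonneg_expansion_bounded]) auto
    with step.IH nonneg_expansion_prepend_zero[OF \<beta>] \<beta> show ?case
      unfolding shift by simp
  qed
qed

lemma abs_digit_uminus: "abs_digit \<beta> (- x) = abs_digit \<beta> x"
  by (simp add: abs_digit_def top_index_def)

text \<open>The bridge between words and numbers: an expansion whose first letter has index \<open>m\<close> consists of
  the digits of the number that it represents.\<close>

lemma signed_expansion_iff_beta_digit:
  assumes \<beta>: "\<beta> > 1"
  shows "signed_expansion \<beta> c \<and> \<beta> ^ Suc m * word_value \<beta> c = x \<longleftrightarrow>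
    \<bar>x\<bar> < \<beta> ^ Suc m \<and> c = (\<lambda>j. beta_digit \<beta> x (int m - int j))"
proof -
  have pos: "\<beta> ^ Suc m > 0" using \<beta> by simp
  have nonneg: "0 \<le> y \<and> \<bar>y\<bar> < \<beta> ^ Suc m \<and> c = (\<lambda>j. abs_digit \<beta> y (int m - int j))"
    if c: "nonneg_expansion \<beta> c" and y: "\<beta> ^ Suc m * word_value \<beta> c = y" for c y
  proof -
    note v = word_value_rec_expansion(2,3)[OF \<beta> c]
    have y0: "0 \<le> y" unfolding y[symmetric] using v pos by simp
    moreover have lt: "\<bar>y\<bar> < \<beta> ^ Suc m"
      using y0 v(2) pos unfolding y[symmetric] by (metis abs_of_nonneg mult.right_neutral mult_less_cancel_left_pos)
    ultimately show ?thesis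
      using abs_digit_expansion[OF \<beta> lt] y pos c
      by (auto intro!: nonneg_expansion_unique[OF \<beta> c] simp del: power_Suc)
  qed
  show ?thesis
  proof
    assume "signed_expansion \<beta> c \<and> \<beta> ^ Suc m * word_value \<beta> c = x"
    then have x: "\<beta> ^ Suc m * word_value \<beta> c = x" and c: "signed_expansion \<beta> c" by simp_all
    from c consider "nonneg_expansion \<beta> c" | "nonneg_expansion \<beta> (\<lambda>j. - c j)"
      unfolding signed_expansion_def by blast
    then show "\<bar>x\<bar> < \<beta> ^ Suc m \<and> c = (\<lambda>j. beta_digit \<beta> x (int m - int j))"
    proof cases
      case 1
      with nonneg[OF 1 x] show ?thesis by (auto simp: beta_digit_def)
    next
      case 2
      have "\<beta> ^ Suc m * word_value \<beta> (\<lambda>j. - c j) = - x"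
        unfolding word_value_uminus[OF \<beta> signed_expansion_bounded[OF c]] using x by simp
      from nonneg[OF 2 this] have n: "x \<le> 0" "\<bar>x\<bar> < \<beta> ^ Suc m"
          and neg: "\<And>j. - c j = abs_digit \<beta> x (int m - int j)"
        unfolding abs_digit_uminus abs_minus_cancel neg_0_le_iff_le by (blast, blast, meson)
      have "c j = beta_digit \<beta> x (int m - int j)" for j
      proof (cases "x < 0")
        case True
        then show ?thesis using neg[of j] by (simp add: beta_digit_def)
      next
        case False
        then have "x = 0" using n by simp
        moreover have "nonneg_expansion \<beta> (\<lambda>_. 0)"
          using \<beta> by (simp add: nonneg_expansion_def suffix_def digits_def)
        from nonneg[OF this, of 0] have "abs_digit \<beta> 0 (int m - int j) = 0"
          by (simp add: fun_eq_iff)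
        ultimately show ?thesis using neg[of j] by (simp add: beta_digit_def)
      qed
      with n show ?thesis by (simp add: fun_eq_iff)
    qed
  next
    assume R: "\<bar>x\<bar> < \<beta> ^ Suc m \<and> c = (\<lambda>j. beta_digit \<beta> x (int m - int j))"
    then have lt: "\<bar>x\<bar> < \<beta> ^ Suc m" and c: "c = (\<lambda>j. beta_digit \<beta> x (int m - int j))" by simp_all
    let ?a = "\<lambda>j. abs_digit \<beta> x (int m - int j)"
    note a = abs_digit_expansion[OF \<beta> lt]
    show "signed_expansion \<beta> c \<and> \<beta> ^ Suc m * word_value \<beta> c = x"
    proof (cases "x < 0")
      case True
      then have "c = (\<lambda>j. - ?a j)" by (simp add: c beta_digit_def)
      moreover have "word_value \<beta> (\<lambda>j. - ?a j) = - word_value \<beta> ?a"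
        by (rule word_value_uminus[OF \<beta> nonneg_expansion_bounded]) (use a in blast)
      ultimately show ?thesis
        using a True by (simp add: signed_expansion_def)
    next
      case False
      then have "c = ?a" by (simp add: c beta_digit_def)
      with a False show ?thesis by (simp add: signed_expansion_def)
    qed
  qed
qed

text \<open>A nonzero digit at index \<open>i\<close> would contribute at least \<open>\<beta>\<^sup>i\<close> to \<open>\<bar>x\<bar>\<close>, as all digits of \<open>\<bar>x\<bar>\<close> are
  nonnegative.\<close>

lemma beta_digit_eq_0:
  assumes \<beta>: "\<beta> > 1" and x: "\<bar>x\<bar> < \<beta> powi i"
  shows "beta_digit \<beta> x i = 0"
proof (cases "i > int (top_index \<beta> x)")
  case True
  then show ?thesis using abs_digit_top[OF \<beta>, of x] by (simp add: beta_digit_def)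
next
  case False
  define m where "m = top_index \<beta> x"
  define n where "n = nat (int m - i)"
  have i: "i = int m - int n" using False by (simp add: m_def n_def)
  define c where "c = (\<lambda>j. abs_digit \<beta> x (int m - int j))"
  have "\<bar>x\<bar> < \<beta> ^ Suc m"
    using top_index_le_iff[OF \<beta>, of x m] by (simp add: m_def)
  from abs_digit_expansion[OF \<beta> this]
  have c: "nonneg_expansion \<beta> c" and val: "\<beta> ^ Suc m * word_value \<beta> c = \<bar>x\<bar>"
    by (simp_all add: c_def)
  have tail: "of_int (c j) + word_value \<beta> (suffix (Suc j) c) = \<beta> * word_value \<beta> (suffix j c)"
      "0 \<le> word_value \<beta> (suffix j c)" "0 \<le> c j" for j
    using word_value_rec_expansion[OF \<beta> nonneg_expansion_suffix[OF c, of j]] c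
    by (auto simp: nonneg_expansion_def digits_def)
  have le: "word_value \<beta> (suffix j c) \<le> \<beta> ^ j * word_value \<beta> c" for j
  proof (induction j)
    case (Suc j)
    have "word_value \<beta> (suffix (Suc j) c) \<le> \<beta> * word_value \<beta> (suffix j c)"
      using tail(1,3)[of j] by simp
    also have "\<dots> \<le> \<beta> * (\<beta> ^ j * word_value \<beta> c)"
      by (intro mult_left_mono Suc) (use \<beta> in simp)
    finally show ?case unfolding power_Suc mult.assoc .
  qed simp
  have pow: "\<beta> powi i * \<beta> ^ Suc n = \<beta> ^ Suc m"
    using \<beta> power_int_add[of \<beta> i "int (Suc n)"] unfolding i by (simp add: algebra_simps flip: power_int_of_nat)
  have "of_int (c n) \<le> \<beta> * word_value \<beta> (suffix n c)"
    using tail(1)[of n] tail(2)[of "Suc n"] by linarith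
  also have "\<dots> \<le> \<beta> * (\<beta> ^ n * word_value \<beta> c)"
    by (intro mult_left_mono le) (use \<beta> in simp)
  also have "\<dots> = \<beta> ^ Suc n * word_value \<beta> c" by simp
  finally have "\<beta> powi i * of_int (c n) \<le> \<beta> powi i * (\<beta> ^ Suc n * word_value \<beta> c)"
    using \<beta> by (intro mult_left_mono) auto
  also have "\<dots> = \<bar>x\<bar>"
    unfolding mult.assoc[symmetric] pow val ..
  also have "\<dots> < \<beta> powi i * 1" using x by simp
  finally have "real_of_int (c n) < 1"
    using \<beta> by (subst (asm) mult_less_cancel_left_pos) auto
  then have "c n = 0" using tail(3)[of n] by simp
  then show ?thesis by (simp add: beta_digit_def c_def i)
qed

text \<open>The case distinction in the digit predicate disappears, since the digits of \<open>x\<close> to the left of its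
  leading one are zero.\<close>

lemma digit_pred_iff:
  assumes \<beta>: "\<beta> > 1"
  shows "digit_pred \<beta> a x y \<longleftrightarrow> (\<exists>i. y = \<beta> powi i \<and> beta_digit \<beta> x i = a)"
proof
  assume "digit_pred \<beta> a x y"
  then show "\<exists>i. y = \<beta> powi i \<and> beta_digit \<beta> x i = a"
    unfolding digit_pred_def using beta_digit_eq_0[OF \<beta>] by blast
next
  assume "\<exists>i. y = \<beta> powi i \<and> beta_digit \<beta> x i = a"
  then obtain i where i: "y = \<beta> powi i" "beta_digit \<beta> x i = a" by blast
  have "i \<le> int (top_index \<beta> x)" if "\<bar>x\<bar> \<ge> y"
  proof (rule ccontr)
    assume "\<not> i \<le> int (top_index \<beta> x)"
    then have "\<beta> powi (int (Suc (top_index \<beta> x))) \<le> \<beta> powi i"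
      using \<beta> by (intro power_int_increasing) auto
    moreover have "\<bar>x\<bar> < \<beta> ^ Suc (top_index \<beta> x)"
      using top_index_le_iff[OF \<beta>] by blast
    ultimately show False
      using that i unfolding power_int_of_nat by linarith
  qed
  then show "digit_pred \<beta> a x y"
    unfolding digit_pred_def using i beta_digit_eq_0[OF \<beta>, of x i] by fastforce
qed

lemma unit_word_expansion:
  assumes \<beta>: "\<beta> > 1"
  shows "signed_expansion \<beta> (\<lambda>j. if j = n then 1 else 0)"
    and "word_value \<beta> (\<lambda>j. if j = n then 1 else 0) = 1 / \<beta> ^ Suc n"
proof -
  have val: "word_value \<beta> (\<lambda>j. if j = n then 1 else 0) = 1 / \<beta> ^ Suc n" for n
  proof -
    have "(\<lambda>j. real_of_int (if j = n then 1 else 0) / \<beta> ^ Suc j) sums (\<Sum>j\<in>{n}. real_of_int (if j = n then 1 else 0) / \<beta> ^ Suc j)"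
      by (rule sums_finite) auto
    then show ?thesis unfolding word_value_def by (simp add: sums_iff)
  qed
  have "word_value \<beta> (suffix k (\<lambda>j. if j = n then 1 else 0)) < 1" for k
  proof (cases "k \<le> n")
    case True
    then have "suffix k (\<lambda>j. if j = n then 1 else 0) = (\<lambda>j. if j = n - k then 1 else 0 :: int)"
      by (auto simp: fun_eq_iff)
    then show ?thesis
      using \<beta> one_less_power[OF \<beta>, of "Suc (n - k)"] by (simp add: val del: power_Suc)
  next
    case False
    then have "suffix k (\<lambda>j. if j = n then 1 else 0) = (\<lambda>j. 0 :: int)"
      by (auto simp: fun_eq_iff)
    then show ?thesis by simp
  qed
  moreover have "0 \<in> digits \<beta>" "1 \<in> digits \<beta>"
    using \<beta> by (auto simp: digits_def)
  ultimately show "signed_expansion \<beta> (\<lambda>j. if j = n then 1 else 0)"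
    by (simp add: signed_expansion_def nonneg_expansion_def)
  show "word_value \<beta> (\<lambda>j. if j = n then 1 else 0) = 1 / \<beta> ^ Suc n" by (rule val)
qed

text \<open>The expansion of a power of \<open>\<beta>\<close> is a unit word, so the digit predicate only says that \<open>e\<close> is a unit
  word and that \<open>c\<close> has the digit \<open>a\<close> at the position marked by \<open>e\<close>.\<close>

lemma digit_pred_expansion:
  assumes \<beta>: "\<beta> > 1" and c: "signed_expansion \<beta> c" and e: "signed_expansion \<beta> e"
  shows "digit_pred \<beta> a (\<beta> ^ Suc m * word_value \<beta> c) (\<beta> ^ Suc m * word_value \<beta> e) \<longleftrightarrow>
    (\<exists>!j. e j \<noteq> 0) \<and> (\<forall>j. e j \<noteq> 0 \<longrightarrow> e j = 1 \<and> c j = a)"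
proof -
  let ?x = "\<beta> ^ Suc m * word_value \<beta> c" and ?y = "\<beta> ^ Suc m * word_value \<beta> e"
  let ?u = "\<lambda>n j. if j = n then 1 else 0 :: int"
  have cx: "c = (\<lambda>j. beta_digit \<beta> ?x (int m - int j))"
    using signed_expansion_iff_beta_digit[OF \<beta>, of c m ?x] c by blast
  have ey: "\<bar>?y\<bar> < \<beta> ^ Suc m" "e = (\<lambda>j. beta_digit \<beta> ?y (int m - int j))"
    using signed_expansion_iff_beta_digit[OF \<beta>, of e m ?y] e by blast+
  have unit_val: "\<beta> ^ Suc m * word_value \<beta> (?u n) = \<beta> powi (int m - int n)" for n
    using \<beta> power_int_diff[of \<beta> "int (Suc m)" "int (Suc n)"]
    by (simp add: unit_word_expansion(2)[OF \<beta>] algebra_simps flip: power_int_of_nat)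
  have "digit_pred \<beta> a ?x ?y \<longleftrightarrow> (\<exists>n. e = ?u n \<and> c n = a)"
  proof
    assume "digit_pred \<beta> a ?x ?y"
    then obtain i where i: "?y = \<beta> powi i" "beta_digit \<beta> ?x i = a"
      unfolding digit_pred_iff[OF \<beta>] by blast
    have "i \<le> int m"
    proof (rule ccontr)
      assume "\<not> i \<le> int m"
      then have "\<beta> powi (int (Suc m)) \<le> \<beta> powi i"
        using \<beta> by (intro power_int_increasing) auto
      with ey(1) i(1) show False unfolding power_int_of_nat by linarith
    qed
    then obtain n where n: "i = int m - int n"
      by (metis zle_iff_zadd add_diff_cancel_right')
    have "\<beta> ^ Suc m * word_value \<beta> (?u n) = ?y"
      unfolding unit_val i(1) n ..
    then have "?u n = (\<lambda>j. beta_digit \<beta> ?y (int m - int j))"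
      using signed_expansion_iff_beta_digit[OF \<beta>, of "?u n" m ?y] unit_word_expansion(1)[OF \<beta>] by blast
    then have "e = ?u n" using ey(2) by (rule trans[OF _ sym, rotated])
    moreover have "c n = a" using i(2) n by (subst cx) simp
    ultimately show "\<exists>n. e = ?u n \<and> c n = a" by blast
  next
    assume "\<exists>n. e = ?u n \<and> c n = a"
    then obtain n where n: "e = ?u n" "c n = a" by blast
    have "?y = \<beta> powi (int m - int n)" unfolding n(1) by (rule unit_val)
    moreover have "beta_digit \<beta> ?x (int m - int n) = a" using fun_cong[OF cx, of n] n(2) by (simp only:)
    ultimately show "digit_pred \<beta> a ?x ?y" unfolding digit_pred_iff[OF \<beta>] by blast
  qed
  also have "\<dots> \<longleftrightarrow> (\<exists>!j. e j \<noteq> 0) \<and> (\<forall>j. e j \<noteq> 0 \<longrightarrow> e j = 1 \<and> c j = a)"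
  proof
    assume "(\<exists>!j. e j \<noteq> 0) \<and> (\<forall>j. e j \<noteq> 0 \<longrightarrow> e j = 1 \<and> c j = a)"
    then obtain n where n: "e n \<noteq> 0" "\<And>j. e j \<noteq> 0 \<Longrightarrow> j = n" "e n = 1" "c n = a" by blast
    then have "e = ?u n" by fastforce
    with n show "\<exists>n. e = ?u n \<and> c n = a" by blast
  qed (auto split: if_splits)
  finally show ?thesis .
qed

section \<open>Words encoding valuations\<close>

text \<open>A letter carries one digit for every variable, and the Boolean marks the letter that holds the
  units digits.\<close>

type_synonym letter = "bool \<times> (nat \<Rightarrow> int)"

definition track :: "nat \<Rightarrow> letter word \<Rightarrow> int word" where
  "track v w = (\<lambda>j. snd (w j) v)"

text \<open>Only the tracks of the variables in \<open>U\<close> have to be expansions. The other tracks are arbitrary,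
  so a fresh variable is available at any time.\<close>

definition well_formed :: "real \<Rightarrow> nat set \<Rightarrow> letter word \<Rightarrow> bool" where
  "well_formed \<beta> U w \<longleftrightarrow> (\<exists>!j. fst (w j)) \<and> (\<forall>v\<in>U. signed_expansion \<beta> (track v w))"

definition unit_pos :: "letter word \<Rightarrow> nat" where
  "unit_pos w = (THE j. fst (w j))"

definition valuation :: "real \<Rightarrow> letter word \<Rightarrow> nat \<Rightarrow> real" where
  "valuation \<beta> w v = \<beta> ^ Suc (unit_pos w) * word_value \<beta> (track v w)"

lemma unit_pos_iff:
  assumes "well_formed \<beta> U w"
  shows "fst (w j) \<longleftrightarrow> j = unit_pos w"
  using theI'[of "\<lambda>j. fst (w j)"] assms unfolding well_formed_def unit_pos_def by blast

lemma unit_posI: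
  assumes "\<And>j. fst (w j) \<longleftrightarrow> j = m"
  shows "unit_pos w = m"
  using assms by (simp add: unit_pos_def)

lemma omega_regular_nonneg_expansion:
  assumes "pisot \<beta>"
  shows "omega_regular (\<lambda>w. nonneg_expansion \<beta> (\<lambda>j. f (w j)))"
proof -
  let ?C = "\<lceil>\<beta>\<rceil> - 1"
  have C: "?C \<ge> 0" using assms unfolding pisot_def by linarith
  have "(\<lambda>w. nonneg_expansion \<beta> (\<lambda>j. f (w j))) =
      (\<lambda>w. (\<forall>j. f (w j) \<in> digits \<beta>) \<and>
        (\<forall>k. (\<forall>j. \<bar>f (suffix k w j)\<bar> \<le> ?C) \<and> word_value \<beta> (\<lambda>j. f (suffix k w j)) < of_int 1))"
  proof (rule ext, rule iffI)
    fix w assume e: "nonneg_expansion \<beta> (\<lambda>j. f (w j))"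
    have "word_value \<beta> (\<lambda>j. f (suffix k w j)) < of_int 1" for k
      using e unfolding nonneg_expansion_def suffix_def by simp
    moreover have "\<bar>f (suffix k w j)\<bar> \<le> ?C" for k j
      using nonneg_expansion_bounded[OF e, of "k + j"] by simp
    ultimately show "(\<forall>j. f (w j) \<in> digits \<beta>) \<and>
        (\<forall>k. (\<forall>j. \<bar>f (suffix k w j)\<bar> \<le> ?C) \<and> word_value \<beta> (\<lambda>j. f (suffix k w j)) < of_int 1)"
      using e unfolding nonneg_expansion_def by blast
  qed (auto simp: nonneg_expansion_def suffix_def)
  moreover have "omega_regular (\<lambda>w. (\<forall>j. f (w j) \<in> digits \<beta>) \<and>
        (\<forall>k. (\<forall>j. \<bar>f (suffix k w j)\<bar> \<le> ?C) \<and> word_value \<beta> (\<lambda>j. f (suffix k w j)) < of_int 1))"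
    by (rule omega_regular_conj[OF omega_regular_all_letters
          omega_regular_all_suffix[OF omega_regular_letter_value_lt[OF assms C]]])
  ultimately show ?thesis by simp
qed

lemma omega_regular_signed_expansion:
  assumes "pisot \<beta>"
  shows "omega_regular (\<lambda>w. signed_expansion \<beta> (\<lambda>j. f (w j)))"
  unfolding signed_expansion_def
  by (rule omega_regular_disj[OF omega_regular_nonneg_expansion[OF assms] omega_regular_nonneg_expansion[OF assms]])

lemma omega_regular_well_formed:
  assumes "pisot \<beta>" "finite U"
  shows "omega_regular (well_formed \<beta> U)"
  unfolding well_formed_def track_def
  by (intro omega_regular_conj omega_regular_ex1_letter omega_regular_finite_Ball
      omega_regular_signed_expansion assms)

lemma omega_regular_well_formed_Not:
  assumes "pisot \<beta>" "finite U" "omega_regular (\<lambda>w. well_formed \<beta> U w \<and> A w)"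
  shows "omega_regular (\<lambda>w. well_formed \<beta> U w \<and> \<not> A w)"
proof -
  have "(\<lambda>w. well_formed \<beta> U w \<and> \<not> A w) = (\<lambda>w. well_formed \<beta> U w \<and> \<not> (well_formed \<beta> U w \<and> A w))"
    by blast
  then show ?thesis
    using omega_regular_conj[OF omega_regular_well_formed[OF assms(1,2)] omega_regular_Not[OF assms(3)]] by simp
qed

lemma omega_regular_well_formed_disj:
  assumes "omega_regular (\<lambda>w. well_formed \<beta> U w \<and> A w)" "omega_regular (\<lambda>w. well_formed \<beta> U w \<and> B w)"
  shows "omega_regular (\<lambda>w. well_formed \<beta> U w \<and> (A w \<or> B w))"
  using omega_regular_disj[OF assms] by (simp add: conj_disj_distribL)

lemma omega_regular_well_formed_conj:
  assumes "omega_regular (\<lambda>w. well_formed \<beta> U w \<and> A w)" "omega_regular (\<lambda>w. well_formed \<beta> U w \<and> B w)"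
  shows "omega_regular (\<lambda>w. well_formed \<beta> U w \<and> A w \<and> B w)"
proof -
  have "(\<lambda>w. well_formed \<beta> U w \<and> A w \<and> B w) = (\<lambda>w. (well_formed \<beta> U w \<and> A w) \<and> well_formed \<beta> U w \<and> B w)"
    by blast
  then show ?thesis using omega_regular_conj[OF assms] by simp
qed

section \<open>Atomic formulas\<close>

text \<open>A term is evaluated digit by digit. The result is not an expansion, since its digits may be
  large, but its value is right; the constant 1 is the digit 1 at the units position.\<close>

primrec term_digit :: "fo_term \<Rightarrow> letter \<Rightarrow> int" where
  "term_digit (Var v) a = snd a v"
| "term_digit One a = of_bool (fst a)"
| "term_digit (Plus s t) a = term_digit s a + term_digit t a"

primrec term_bound :: "real \<Rightarrow> fo_term \<Rightarrow> int" where
  "term_bound \<beta> (Var v) = \<lceil>\<beta>\<rceil> - 1"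
| "term_bound \<beta> One = 1"
| "term_bound \<beta> (Plus s t) = term_bound \<beta> s + term_bound \<beta> t"

lemma term_digit_bounded:
  assumes "well_formed \<beta> U w" "term_vars t \<subseteq> U"
  shows "\<bar>term_digit t (w j)\<bar> \<le> term_bound \<beta> t"
  using assms(2)
proof (induction t)
  case (Var v)
  then have "signed_expansion \<beta> (track v w)" using assms(1) by (simp add: well_formed_def)
  from signed_expansion_bounded[OF this, of j] show ?case by (simp add: track_def)
qed auto

lemma term_bound_nonneg: "\<beta> > 1 \<Longrightarrow> term_bound \<beta> t \<ge> 0"
  by (induction t) auto

lemma term_val_eq_word_value:
  assumes \<beta>: "\<beta> > 1" and wf: "well_formed \<beta> U w" and t: "term_vars t \<subseteq> U"
  shows "term_val (valuation \<beta> w) t = \<beta> ^ Suc (unit_pos w) * word_value \<beta> (\<lambda>j. term_digit t (w j))"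
  using t
proof (induction t)
  case (Var v)
  then show ?case by (simp add: valuation_def track_def)
next
  case One
  have "(\<lambda>j. term_digit One (w j)) = (\<lambda>j. if j = unit_pos w then 1 else 0)"
    by (simp add: fun_eq_iff unit_pos_iff[OF wf])
  then show ?case
    using \<beta> by (simp add: unit_word_expansion(2)[OF \<beta>])
next
  case (Plus s t)
  then have "word_value \<beta> (\<lambda>j. term_digit (Plus s t) (w j)) =
      word_value \<beta> (\<lambda>j. term_digit s (w j)) + word_value \<beta> (\<lambda>j. term_digit t (w j))"
    unfolding term_digit.simps
    by (intro word_value_add[OF \<beta>, where C = "term_bound \<beta> s" and D = "term_bound \<beta> t"])
       (auto intro: term_digit_bounded[OF wf])
  with Plus show ?case by (simp add: algebra_simps)
qed

text \<open>The difference of the two digit words is a word of bounded integers, whose sign is tested.\<close>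

lemma omega_regular_term_less:
  assumes "pisot \<beta>" "finite U" "term_vars s \<union> term_vars t \<subseteq> U"
  shows "omega_regular (\<lambda>w. well_formed \<beta> U w \<and> term_val (valuation \<beta> w) s < term_val (valuation \<beta> w) t)"
proof -
  have \<beta>: "\<beta> > 1" using assms(1) by (simp add: pisot_def)
  define f where "f a = term_digit t a - term_digit s a" for a
  define C where "C = term_bound \<beta> s + term_bound \<beta> t"
  have C: "C \<ge> 0" using term_bound_nonneg[OF \<beta>] by (simp add: C_def)
  have key: "(term_val (valuation \<beta> w) s < term_val (valuation \<beta> w) t) \<longleftrightarrow>
      (\<forall>j. \<bar>f (w j)\<bar> \<le> C) \<and> word_value \<beta> (\<lambda>j. f (w j)) > of_int 0" if wf: "well_formed \<beta> U w" for w
  proof -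
    note bs = term_digit_bounded[OF wf, of s] and bt = term_digit_bounded[OF wf, of t]
    have s: "\<bar>- term_digit s (w j)\<bar> \<le> term_bound \<beta> s" and t: "\<bar>term_digit t (w j)\<bar> \<le> term_bound \<beta> t" for j
      using bs[of j] bt[of j] assms(3) by auto
    have bound: "\<bar>f (w j)\<bar> \<le> C" for j
      using s[of j] t[of j] unfolding f_def C_def by linarith
    have "word_value \<beta> (\<lambda>j. f (w j)) =
        word_value \<beta> (\<lambda>j. term_digit t (w j)) + word_value \<beta> (\<lambda>j. - term_digit s (w j))"
      unfolding f_def diff_conv_add_uminus by (rule word_value_add[OF \<beta> t s])
    also have "word_value \<beta> (\<lambda>j. - term_digit s (w j)) = - word_value \<beta> (\<lambda>j. term_digit s (w j))"
      by (rule word_value_uminus[OF \<beta>, where C = "term_bound \<beta> s"]) (use bs assms(3) in auto)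
    finally have "word_value \<beta> (\<lambda>j. f (w j)) =
        word_value \<beta> (\<lambda>j. term_digit t (w j)) - word_value \<beta> (\<lambda>j. term_digit s (w j))" by simp
    moreover have "\<beta> ^ Suc (unit_pos w) > 0" using \<beta> by simp
    ultimately show ?thesis
      using bound assms(3) by (simp add: term_val_eq_word_value[OF \<beta> wf] mult_less_cancel_left_pos del: power_Suc)
  qed
  have eq: "(\<lambda>w. well_formed \<beta> U w \<and> term_val (valuation \<beta> w) s < term_val (valuation \<beta> w) t) =
      (\<lambda>w. well_formed \<beta> U w \<and> (\<forall>j. \<bar>f (w j)\<bar> \<le> C) \<and> word_value \<beta> (\<lambda>j. f (w j)) > of_int 0)"
    by (intro ext conj_cong refl key)
  show ?thesis
    unfolding eq
    by (rule omega_regular_conj[OF omega_regular_well_formed[OF assms(1,2)] omega_regular_letter_value_gt[OF assms(1) C]])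
qed

lemma omega_regular_term_le:
  assumes "pisot \<beta>" "finite U" "term_vars s \<union> term_vars t \<subseteq> U"
  shows "omega_regular (\<lambda>w. well_formed \<beta> U w \<and> term_val (valuation \<beta> w) s \<le> term_val (valuation \<beta> w) t)"
  using omega_regular_well_formed_Not[OF assms(1,2) omega_regular_term_less[OF assms(1,2), of t s]] assms(3)
  by (simp add: not_less Un_commute)

lemma omega_regular_term_eq:
  assumes "pisot \<beta>" "finite U" "term_vars s \<union> term_vars t \<subseteq> U"
  shows "omega_regular (\<lambda>w. well_formed \<beta> U w \<and> term_val (valuation \<beta> w) s = term_val (valuation \<beta> w) t)"
  using omega_regular_well_formed_conj[OF omega_regular_term_le[OF assms] omega_regular_term_le[OF assms(1,2), of t s]] assms(3)
  by (simp add: eq_iff Un_commute)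

lemma omega_regular_digit_pred:
  assumes "pisot \<beta>" "finite U" "p \<in> U" "q \<in> U"
  shows "omega_regular (\<lambda>w. well_formed \<beta> U w \<and> digit_pred \<beta> a (valuation \<beta> w p) (valuation \<beta> w q))"
proof -
  have \<beta>: "\<beta> > 1" using assms(1) by (simp add: pisot_def)
  have eq: "(\<lambda>w. well_formed \<beta> U w \<and> digit_pred \<beta> a (valuation \<beta> w p) (valuation \<beta> w q)) =
      (\<lambda>w. well_formed \<beta> U w \<and> (\<exists>!j. snd (w j) q \<noteq> 0) \<and>
        (\<forall>j. snd (w j) q \<noteq> 0 \<longrightarrow> snd (w j) q = 1 \<and> snd (w j) p = a))"
  proof (intro ext conj_cong refl)
    fix w assume "well_formed \<beta> U w"
    then have "signed_expansion \<beta> (track p w)" "signed_expansion \<beta> (track q w)"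
      using assms(3,4) by (auto simp: well_formed_def)
    from digit_pred_expansion[OF \<beta> this, of a "unit_pos w"]
    show "digit_pred \<beta> a (valuation \<beta> w p) (valuation \<beta> w q) \<longleftrightarrow> (\<exists>!j. snd (w j) q \<noteq> 0) \<and>
        (\<forall>j. snd (w j) q \<noteq> 0 \<longrightarrow> snd (w j) q = 1 \<and> snd (w j) p = a)"
      by (simp add: valuation_def track_def)
  qed
  show ?thesis
    unfolding eq
    by (rule omega_regular_conj[OF omega_regular_well_formed[OF assms(1,2)]
          omega_regular_conj[OF omega_regular_ex1_letter omega_regular_all_letters]])
qed

section \<open>Quantifiers\<close>

lemma prepend_zeros:
  assumes \<beta>: "\<beta> > 1" and c: "signed_expansion \<beta> c"
  shows "signed_expansion \<beta> (replicate k 0 \<frown> c) \<and> word_value \<beta> (replicate k 0 \<frown> c) = word_value \<beta> c / \<beta> ^ k"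
proof (induction k)
  case 0
  then show ?case using c by simp
next
  case (Suc k)
  let ?c = "replicate k 0 \<frown> c"
  have neg: "(\<lambda>j. - (0 ## ?c) j) = 0 ## (\<lambda>j. - ?c j)"
  proof
    fix j show "- (0 ## ?c) j = (0 ## (\<lambda>j. - ?c j)) j" by (cases j) auto
  qed
  have "signed_expansion \<beta> (0 ## ?c)"
    using Suc nonneg_expansion_prepend_zero[OF \<beta>] unfolding signed_expansion_def neg by blast
  moreover have "word_value \<beta> (0 ## ?c) = word_value \<beta> ?c / \<beta>"
    by (rule word_value_prepend_zero[OF \<beta> signed_expansion_bounded]) (use Suc in blast)
  moreover have "replicate (Suc k) 0 \<frown> c = 0 ## ?c"
    by simp
  ultimately show ?case using Suc by simp
qed

definition zero_padding :: "letter list set" where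
  "zero_padding = range (\<lambda>k. replicate k (False, \<lambda>_. 0))"

definition set_track :: "nat \<Rightarrow> int word \<Rightarrow> letter word \<Rightarrow> letter word" where
  "set_track v u w = (\<lambda>j. (fst (w j), (snd (w j))(v := u j)))"

lemma track_set_track: "track t (set_track v u w) = (if t = v then u else track t w)"
  by (auto simp: track_def set_track_def)

lemma track_padded: "track t (replicate k (False, \<lambda>_. 0) \<frown> w) = replicate k 0 \<frown> track t w"
  by (auto simp: track_def conc_def)

text \<open>Prepending \<open>k\<close> zero letters moves the units position by \<open>k\<close>, which compensates the factor
  \<open>\<beta>\<^sup>-\<^sup>k\<close> in the values of the tracks.\<close>

lemma set_track_padded:
  fixes u :: "int word" and v k :: nat
  assumes \<beta>: "\<beta> > 1" and wf: "well_formed \<beta> U w"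
  defines "w' \<equiv> set_track v u (replicate k (False, \<lambda>_. 0) \<frown> w)"
  shows "fst (w' j) \<longleftrightarrow> j = unit_pos w + k"
    and "unit_pos w' = unit_pos w + k"
    and "t \<in> U - {v} \<Longrightarrow> signed_expansion \<beta> (track t w') \<and> valuation \<beta> w' t = valuation \<beta> w t"
    and "well_formed \<beta> (insert v U) w' \<longleftrightarrow> signed_expansion \<beta> u"
proof -
  show fst: "fst (w' j) \<longleftrightarrow> j = unit_pos w + k" for j
    using unit_pos_iff[OF wf, of "j - k"] by (auto simp: w'_def set_track_def conc_def)
  show pos: "unit_pos w' = unit_pos w + k"
    by (rule unit_posI[OF fst])
  show tr: "signed_expansion \<beta> (track t w') \<and> valuation \<beta> w' t = valuation \<beta> w t"
    if "t \<in> U - {v}" for t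
  proof -
    have "track t w' = replicate k 0 \<frown> track t w"
      using that by (simp add: w'_def track_set_track track_padded)
    moreover have "signed_expansion \<beta> (track t w)"
      using wf that by (simp add: well_formed_def)
    ultimately show ?thesis
      using prepend_zeros[OF \<beta>, of "track t w" k] \<beta> by (simp add: valuation_def pos power_add)
  qed
  show "well_formed \<beta> (insert v U) w' \<longleftrightarrow> signed_expansion \<beta> u"
  proof -
    have "\<exists>!j. fst (w' j)" unfolding fst by simp
    moreover have "track v w' = u" by (simp add: w'_def track_set_track)
    ultimately show ?thesis
      using tr unfolding well_formed_def by (metis Diff_iff insert_iff singletonD)
  qed
qed

text \<open>The padding gives room for the digits of the witness \<open>x\<close>. The set \<open>U\<close> may already contain \<open>v\<close>; then
  the old track of \<open>v\<close> is overwritten.\<close>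

lemma omega_regular_exists:
  assumes "pisot \<beta>" "finite U"
    and A: "omega_regular (\<lambda>w. well_formed \<beta> (insert v U) w \<and> A (valuation \<beta> w))"
    and cong: "\<And>\<rho> \<rho>'. (\<And>t. t \<in> insert v U \<Longrightarrow> \<rho> t = \<rho>' t) \<Longrightarrow> A \<rho> \<longleftrightarrow> A \<rho>'"
  shows "omega_regular (\<lambda>w. well_formed \<beta> U w \<and> (\<exists>x. A ((valuation \<beta> w)(v := x))))"
proof -
  have \<beta>: "\<beta> > 1" using assms(1) by (simp add: pisot_def)
  let ?P = "\<lambda>w. well_formed \<beta> (insert v U) w \<and> A (valuation \<beta> w)"
  have "omega_regular (\<lambda>w. ?P (\<lambda>j. (fst (fst (w j)), (snd (fst (w j)))(v := snd (w j)))))"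
    using omega_regular_vimage[OF A, of "\<lambda>a. (fst (fst a), (snd (fst a))(v := snd a))"] .
  from omega_regular_ex_track[OF this] have "omega_regular (\<lambda>w. \<exists>u. ?P (set_track v u w))"
    by (simp add: set_track_def)
  from omega_regular_ex_prefix[OF this]
  have reg: "omega_regular (\<lambda>w. \<exists>z\<in>zero_padding. \<exists>u. ?P (set_track v u (z \<frown> w)))" .
  have key: "(\<exists>x. A ((valuation \<beta> w)(v := x))) \<longleftrightarrow> (\<exists>z\<in>zero_padding. \<exists>u. ?P (set_track v u (z \<frown> w)))" (is "?L \<longleftrightarrow> ?R")
    if wf: "well_formed \<beta> U w" for w
  proof
    assume ?L
    then obtain x where x: "A ((valuation \<beta> w)(v := x))" ..
    \<comment> \<open>With \<open>k\<close> additional letters the first one has index \<open>m\<close>, enough for the digits of \<open>x\<close>.\<close>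
    obtain k where k: "\<bar>x\<bar> < \<beta> ^ k" using real_arch_pow[OF \<beta>] by blast
    define m where "m = unit_pos w + k"
    have "\<beta> ^ k \<le> \<beta> ^ Suc m" using \<beta> by (intro power_increasing) (auto simp: m_def)
    with k have lt: "\<bar>x\<bar> < \<beta> ^ Suc m" by simp
    define u where "u = (\<lambda>j. beta_digit \<beta> x (int m - int j))"
    have u: "signed_expansion \<beta> u" "\<beta> ^ Suc m * word_value \<beta> u = x"
      using signed_expansion_iff_beta_digit[OF \<beta>, of u m x] lt u_def by blast+
    let ?w = "set_track v u (replicate k (False, \<lambda>_. 0) \<frown> w)"
    note w' = set_track_padded[OF \<beta> wf, where v = v and u = u and k = k]
    have "well_formed \<beta> (insert v U) ?w" using w'(4) u(1) by blast
    moreover have "A (valuation \<beta> ?w) \<longleftrightarrow> A ((valuation \<beta> w)(v := x))"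
    proof (rule cong)
      fix t assume t: "t \<in> insert v U"
      show "valuation \<beta> ?w t = ((valuation \<beta> w)(v := x)) t"
      proof (cases "t = v")
        case True
        have "track v ?w = u" by (simp add: track_set_track)
        then have "valuation \<beta> ?w v = x"
          unfolding valuation_def w'(2) using u(2) by (simp add: m_def)
        with True show ?thesis by simp
      next
        case False
        with t w'(3)[of t] show ?thesis by simp
      qed
    qed
    ultimately have "?P ?w" using x by blast
    then show ?R unfolding zero_padding_def by blast
  next
    assume ?R
    then obtain k u where P: "?P (set_track v u (replicate k (False, \<lambda>_. 0) \<frown> w))"
      unfolding zero_padding_def by blast
    let ?w = "set_track v u (replicate k (False, \<lambda>_. 0) \<frown> w)"
    have "A (valuation \<beta> ?w) \<longleftrightarrow> A ((valuation \<beta> w)(v := valuation \<beta> ?w v))"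
    proof (rule cong)
      fix t assume "t \<in> insert v U"
      then show "valuation \<beta> ?w t = ((valuation \<beta> w)(v := valuation \<beta> ?w v)) t"
        using set_track_padded(3)[OF \<beta> wf, where t = t and v = v and u = u and k = k] by (cases "t = v") auto
    qed
    with P show ?L by blast
  qed
  have eq: "(\<lambda>w. well_formed \<beta> U w \<and> (\<exists>x. A ((valuation \<beta> w)(v := x)))) =
      (\<lambda>w. well_formed \<beta> U w \<and> (\<exists>z\<in>zero_padding. \<exists>u. ?P (set_track v u (z \<frown> w))))"
    by (intro ext conj_cong refl key)
  show ?thesis
    unfolding eq by (rule omega_regular_conj[OF omega_regular_well_formed[OF assms(1,2)] reg])
qed

section \<open>Definable relations are omega-regular\<close>

lemma term_val_cong: "(\<And>v. v \<in> term_vars t \<Longrightarrow> \<rho> v = \<rho>' v) \<Longrightarrow> term_val \<rho> t = term_val \<rho>' t"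
  by (induction t) auto

lemma sat_cong: "(\<And>v. v \<in> free_vars \<phi> \<Longrightarrow> \<rho> v = \<rho>' v) \<Longrightarrow> sat \<beta> \<rho> \<phi> \<longleftrightarrow> sat \<beta> \<rho>' \<phi>"
proof (induction \<phi> arbitrary: \<rho> \<rho>')
  case (Eq s t)
  then show ?case using term_val_cong[of s \<rho> \<rho>'] term_val_cong[of t \<rho> \<rho>'] by simp
next
  case (Le s t)
  then show ?case using term_val_cong[of s \<rho> \<rho>'] term_val_cong[of t \<rho> \<rho>'] by simp
next
  case (DigitAt a s t)
  then show ?case using term_val_cong[of s \<rho> \<rho>'] term_val_cong[of t \<rho> \<rho>'] by simp
next
  case (Neg \<phi>)
  then show ?case by (metis free_vars.simps(4) sat.simps(4))
next
  case (Conj \<phi> \<psi>)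
  then show ?case by (metis UnCI free_vars.simps(5) sat.simps(5))
next
  case (Disj \<phi> \<psi>)
  then show ?case by (metis UnCI free_vars.simps(6) sat.simps(6))
next
  case (Impl \<phi> \<psi>)
  then show ?case by (metis UnCI free_vars.simps(7) sat.simps(7))
next
  case (Exists v \<phi>)
  have "sat \<beta> (\<rho>(v := x)) \<phi> \<longleftrightarrow> sat \<beta> (\<rho>'(v := x)) \<phi>" for x
    by (rule Exists.IH) (use Exists.prems in auto)
  then show ?case by simp
next
  case (Forall v \<phi>)
  have "sat \<beta> (\<rho>(v := x)) \<phi> \<longleftrightarrow> sat \<beta> (\<rho>'(v := x)) \<phi>" for x
    by (rule Forall.IH) (use Forall.prems in auto)
  then show ?case by simp
qed

text \<open>The digit predicate needs the normalized expansions of its arguments, which \<open>term_digit\<close> does not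
  provide. They are named by two fresh, existentially quantified variables.\<close>

lemma omega_regular_digit_pred_terms:
  assumes "pisot \<beta>" "finite U" "term_vars s \<union> term_vars t \<subseteq> U"
  shows "omega_regular (\<lambda>w. well_formed \<beta> U w \<and>
    digit_pred \<beta> a (term_val (valuation \<beta> w) s) (term_val (valuation \<beta> w) t))"
proof -
  obtain p where p: "p \<notin> U" using ex_new_if_finite[OF infinite_UNIV_nat assms(2)] by blast
  obtain q where q: "q \<notin> insert p U" using ex_new_if_finite[OF infinite_UNIV_nat, of "insert p U"] assms(2) by auto
  let ?V = "insert q (insert p U)"
  define A where "A \<rho> \<longleftrightarrow> term_val \<rho> (Var p) = term_val \<rho> s \<and> term_val \<rho> (Var q) = term_val \<rho> t \<and>
      digit_pred \<beta> a (\<rho> p) (\<rho> q)" for \<rho>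
  have A_cong: "A \<rho> \<longleftrightarrow> A \<rho>'" if "\<And>x. x \<in> ?V \<Longrightarrow> \<rho> x = \<rho>' x" for \<rho> \<rho>'
  proof -
    have "term_val \<rho> s = term_val \<rho>' s" "term_val \<rho> t = term_val \<rho>' t"
      using that assms(3) by (auto intro!: term_val_cong)
    with that show ?thesis by (simp add: A_def)
  qed
  have "omega_regular (\<lambda>w. well_formed \<beta> ?V w \<and> A (valuation \<beta> w))"
    unfolding A_def using assms
    by (intro omega_regular_well_formed_conj omega_regular_term_eq omega_regular_digit_pred) auto
  then have "omega_regular (\<lambda>w. well_formed \<beta> (insert p U) w \<and> (\<exists>y. A ((valuation \<beta> w)(q := y))))"
    by (rule omega_regular_exists[OF assms(1), rotated]) (use assms(2) A_cong in \<open>blast, simp\<close>)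
  then have "omega_regular (\<lambda>w. well_formed \<beta> U w \<and> (\<exists>x y. A ((valuation \<beta> w)(p := x, q := y))))"
    by (rule omega_regular_exists[OF assms(1,2), where A = "\<lambda>\<rho>. \<exists>y. A (\<rho>(q := y))"])
       (intro ex_cong1 A_cong, auto)
  moreover have "(\<exists>x y. A (\<rho>(p := x, q := y))) \<longleftrightarrow> digit_pred \<beta> a (term_val \<rho> s) (term_val \<rho> t)" for \<rho>
  proof -
    have "term_val (\<rho>(p := x, q := y)) s = term_val \<rho> s" "term_val (\<rho>(p := x, q := y)) t = term_val \<rho> t" for x y
      using p q assms(3) by (auto intro!: term_val_cong)
    then show ?thesis using q by (simp add: A_def)
  qed
  ultimately show ?thesis by simp
qed

theorem omega_regular_sat:
  assumes "pisot \<beta>" "finite U" "free_vars \<phi> \<subseteq> U"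
  shows "omega_regular (\<lambda>w. well_formed \<beta> U w \<and> sat \<beta> (valuation \<beta> w) \<phi>)"
  using assms(2,3)
proof (induction \<phi> arbitrary: U)
  case (Eq s t)
  then show ?case using omega_regular_term_eq[OF assms(1)] by simp
next
  case (Le s t)
  then show ?case using omega_regular_term_le[OF assms(1)] by simp
next
  case (DigitAt a s t)
  then show ?case using omega_regular_digit_pred_terms[OF assms(1)] by simp
next
  case (Neg \<phi>)
  then show ?case using omega_regular_well_formed_Not[OF assms(1)] by simp
next
  case (Conj \<phi> \<psi>)
  then show ?case using omega_regular_well_formed_conj by simp
next
  case (Disj \<phi> \<psi>)
  then show ?case using omega_regular_well_formed_disj by simp
next
  case (Impl \<phi> \<psi>)
  then have "omega_regular (\<lambda>w. well_formed \<beta> U w \<and> (\<not> sat \<beta> (valuation \<beta> w) \<phi> \<or> sat \<beta> (valuation \<beta> w) \<psi>))"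
    by (intro omega_regular_well_formed_disj omega_regular_well_formed_Not[OF assms(1)]) auto
  then show ?case by simp
next
  case (Exists v \<phi>)
  have "omega_regular (\<lambda>w. well_formed \<beta> (insert v U) w \<and> sat \<beta> (valuation \<beta> w) \<phi>)"
    using Exists by auto
  then have "omega_regular (\<lambda>w. well_formed \<beta> U w \<and> (\<exists>x. sat \<beta> ((valuation \<beta> w)(v := x)) \<phi>))"
    by (rule omega_regular_exists[OF assms(1) Exists.prems(1)]) (rule sat_cong, use Exists.prems in auto)
  then show ?case by simp
next
  case (Forall v \<phi>)
  have "omega_regular (\<lambda>w. well_formed \<beta> (insert v U) w \<and> \<not> sat \<beta> (valuation \<beta> w) \<phi>)"
    using Forall by (intro omega_regular_well_formed_Not[OF assms(1)]) auto
  then have "omega_regular (\<lambda>w. well_formed \<beta> U w \<and> (\<exists>x. \<not> sat \<beta> ((valuation \<beta> w)(v := x)) \<phi>))"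
    by (rule omega_regular_exists[OF assms(1) Forall.prems(1)]) (subst sat_cong, use Forall.prems in auto)
  from omega_regular_well_formed_Not[OF assms(1) Forall.prems(1) this] show ?case by simp
qed

section \<open>Inserting the radix point\<close>

definition insert_star :: "('b \<Rightarrow> 'c) \<Rightarrow> 'c \<Rightarrow> nat \<Rightarrow> (bool \<times> 'b) word \<Rightarrow> 'c word" where
  "insert_star h s m w = (\<lambda>j. if j \<le> m then h (snd (w j)) else if j = Suc m then s else h (snd (w (j - 1))))"

text \<open>The letters after the inserted one are delayed by one position. The second component of a state
  says whether the mark is still to come (0), has just been read (1), or the inserted letter has been
  read as well (2); during the step for the inserted letter the old automaton stands still.\<close>

lemma omega_regular_insert_star:
  fixes h :: "'b \<Rightarrow> 'c"
  assumes "omega_regular P"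
  shows "omega_regular (\<lambda>u. \<exists>w m. P w \<and> (\<forall>j. fst (w j) \<longleftrightarrow> j = m) \<and> u = insert_star h s m w)"
proof -
  obtain Q :: "nat set" and \<delta> I F where Q: "finite Q" and P: "\<And>w. P w \<longleftrightarrow> buchi_accepts Q \<delta> I F w"
    using assms by (rule omega_regularE) blast
  define \<Delta> :: "nat \<times> nat \<Rightarrow> 'c \<Rightarrow> nat \<times> nat \<Rightarrow> bool" where
    "\<Delta> = (\<lambda>(p, i) x (q, k).
       i = 0 \<and> k \<le> 1 \<and> (\<exists>b. x = h b \<and> \<delta> p (k = 1, b) q) \<or>
       i = 1 \<and> k = 2 \<and> q = p \<and> x = s \<or>
       i = 2 \<and> k = 2 \<and> (\<exists>b. x = h b \<and> \<delta> p (False, b) q))"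
  let ?S = "Q \<times> {0, 1, 2}"
  show ?thesis
  proof (rule omega_regularI[where Q = ?S and \<delta> = \<Delta> and I = "I \<times> {0}" and F = "F \<times> {2}"])
    show "finite ?S" using Q by simp
  next
    fix u
    show "(\<exists>w m. P w \<and> (\<forall>j. fst (w j) \<longleftrightarrow> j = m) \<and> u = insert_star h s m w) \<longleftrightarrow>
        buchi_accepts ?S \<Delta> (I \<times> {0}) (F \<times> {2}) u" (is "?L \<longleftrightarrow> ?R")
    proof
      assume ?L
      then obtain w m where P': "P w" and mark: "\<And>j. fst (w j) \<longleftrightarrow> j = m" and u: "u = insert_star h s m w" by blast
      from P' obtain r where r: "r 0 \<in> I" "\<And>j. r j \<in> Q" "\<And>j. \<delta> (r j) (w j) (r (Suc j))" "\<exists>\<^sub>\<infinity>j. r j \<in> F"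
        unfolding P buchi_accepts_def by blast
      have step: "\<delta> (r j) (j = m, snd (w j)) (r (Suc j))" for j
        using r(3)[of j] mark[of j] by (cases "w j") simp
      \<comment> \<open>The inserted letter is at position \<open>m + 1\<close>, where the old run waits.\<close>
      define t :: "nat \<Rightarrow> nat \<times> nat" where
        "t j = (if j \<le> m then (r j, 0) else if j = Suc m then (r (Suc m), 1) else (r (j - 1), 2))" for j
      have "t j \<in> ?S" for j using r(2) by (auto simp: t_def)
      moreover have "\<Delta> (t j) (u j) (t (Suc j))" for j
      proof -
        consider "j < m" | "j = m" | "j = Suc m" | "j > Suc m" by linarith
        then show ?thesis
        proof cases
          case 1
          then show ?thesis using step[of j] by (auto simp: t_def u insert_star_def \<Delta>_def)
        next
          case 2
          then show ?thesis using step[of j] by (auto simp: t_def u insert_star_def \<Delta>_def)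
        next
          case 3
          then show ?thesis by (simp add: t_def u insert_star_def \<Delta>_def)
        next
          case 4
          then have "Suc (j - 1) = j" "(j - Suc 0 = m) = False" by auto
          then show ?thesis
            using 4 step[of "j - 1"] by (auto simp: t_def u insert_star_def \<Delta>_def)
        qed
      qed
      moreover have "\<exists>\<^sub>\<infinity>j. t j \<in> F \<times> {2}"
        unfolding INFM_nat_le
      proof
        fix n
        obtain j where "j \<ge> n + Suc m" "r j \<in> F" using r(4) unfolding INFM_nat_le by blast
        then show "\<exists>i\<ge>n. t i \<in> F \<times> {2}" by (intro exI[of _ "Suc j"]) (auto simp: t_def)
      qed
      moreover have "t 0 \<in> I \<times> {0}" using r(1) by (simp add: t_def)
      ultimately show ?R unfolding buchi_accepts_def by (intro exI[of _ t] conjI allI)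
    next
      assume ?R
      then obtain t where t0: "t 0 \<in> I \<times> {0}" and t: "\<forall>j. t j \<in> ?S \<and> \<Delta> (t j) (u j) (t (Suc j))"
          and tF: "\<exists>\<^sub>\<infinity>j. t j \<in> F \<times> {2}"
        unfolding buchi_accepts_def by (elim exE conjE)
      from t have tS: "\<And>j. t j \<in> ?S" and t\<Delta>: "\<And>j. \<Delta> (t j) (u j) (t (Suc j))"
        by (simp_all only: simp_thms)
      obtain k where "t k \<in> F \<times> {2}" using INFM_EX[OF tF] ..
      then have "snd (t k) \<noteq> 0" by (auto simp: mem_Times_iff)
      then have ex: "\<exists>l. snd (t l) \<noteq> 0" ..
      define l where "l = (LEAST l. snd (t l) \<noteq> 0)"
      have l: "snd (t l) \<noteq> 0" unfolding l_def by (rule LeastI_ex[OF ex])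
      have before: "snd (t j) = 0" if "j < l" for j
        using not_less_Least that unfolding l_def by blast
      have "snd (t 0) = 0" using t0 by auto
      with l have "l \<noteq> 0" by metis
      then obtain m where m: "l = Suc m" by (cases l) auto
      have at: "snd (t (Suc m)) = 1"
        using t\<Delta>[of m] before[of m] l unfolding m by (cases "t m"; cases "t (Suc m)") (auto simp: \<Delta>_def)
      have after: "snd (t (Suc (Suc m) + i)) = 2" for i
      proof (induction i)
        case 0
        then show ?case
          using t\<Delta>[of "Suc m"] at by (cases "t (Suc m)"; cases "t (Suc (Suc m))") (auto simp: \<Delta>_def)
      next
        case (Suc i)
        then show ?case
          using t\<Delta>[of "Suc (Suc m) + i"]
          by (cases "t (Suc (Suc m) + i)"; cases "t (Suc (Suc (Suc m) + i))") (auto simp: \<Delta>_def)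
      qed
      have later: "snd (t j) = 2" if "j > Suc m" for j
        using after[of "j - Suc (Suc m)"] that by (metis Suc_leI le_add_diff_inverse)
      have star: "u (Suc m) = s" "fst (t (Suc (Suc m))) = fst (t (Suc m))"
        using t\<Delta>[of "Suc m"] at by (cases "t (Suc m)"; cases "t (Suc (Suc m))"; auto simp: \<Delta>_def)+
      have "\<exists>b. j \<noteq> Suc m \<longrightarrow> u j = h b \<and> \<delta> (fst (t j)) (j = m, b) (fst (t (Suc j)))" for j
      proof -
        consider "j < m" | "j = m" | "j = Suc m" | "j > Suc m" by linarith
        then show ?thesis
        proof cases
          case 1
          then show ?thesis
            using t\<Delta>[of j] before[of j] before[of "Suc j"] unfolding m
            by (cases "t j"; cases "t (Suc j)") (auto simp: \<Delta>_def)
        next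
          case 2
          then show ?thesis
            using t\<Delta>[of j] before[of j] at unfolding m
            by (cases "t j"; cases "t (Suc j)") (auto simp: \<Delta>_def)
        next
          case 4
          then show ?thesis
            using t\<Delta>[of j] later[of j]
            by (cases "t j"; cases "t (Suc j)") (auto simp: \<Delta>_def)
        qed auto
      qed
      then have "\<exists>g. \<forall>j. j \<noteq> Suc m \<longrightarrow> u j = h (g j) \<and> \<delta> (fst (t j)) (j = m, g j) (fst (t (Suc j)))"
        by (intro choice) blast
      then obtain g where g: "\<And>j. j \<noteq> Suc m \<Longrightarrow> u j = h (g j)"
          "\<And>j. j \<noteq> Suc m \<Longrightarrow> \<delta> (fst (t j)) (j = m, g j) (fst (t (Suc j)))" by blast
      \<comment> \<open>Deleting position \<open>m + 1\<close> recovers the original word and its run.\<close>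
      define w where "w j = (j = m, if j \<le> m then g j else g (Suc j))" for j
      define r where "r j = (if j \<le> m then fst (t j) else fst (t (Suc j)))" for j
      have "r 0 \<in> I" using t0 by (auto simp: r_def)
      moreover have "r j \<in> Q" for j using tS by (auto simp: r_def mem_Times_iff)
      moreover have "\<delta> (r j) (w j) (r (Suc j))" for j
      proof -
        consider "j < m" | "j = m" | "j > m" by linarith
        then show ?thesis
        proof cases
          case 1
          then show ?thesis using g(2)[of j] by (simp add: r_def w_def)
        next
          case 2
          then show ?thesis using g(2)[of j] star(2) by (simp add: r_def w_def)
        next
          case 3
          then show ?thesis using g(2)[of "Suc j"] by (simp add: r_def w_def)
        qed
      qed
      moreover have "\<exists>\<^sub>\<infinity>j. r j \<in> F"
        unfolding INFM_nat_le
      proof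
        fix n
        obtain j where j: "j \<ge> n + Suc (Suc m)" "t j \<in> F \<times> {2}"
          using tF[unfolded INFM_nat_le, rule_format, of "n + Suc (Suc m)"] by (elim exE conjE)
        then have "r (j - 1) = fst (t j)" by (auto simp: r_def)
        with j show "\<exists>i\<ge>n. r i \<in> F" by (intro exI[of _ "j - 1"]) (auto simp: mem_Times_iff)
      qed
      ultimately have "P w" unfolding P buchi_accepts_def by blast
      moreover have "fst (w j) \<longleftrightarrow> j = m" for j by (simp add: w_def)
      moreover have "u = insert_star h s m w"
      proof
        fix j
        show "u j = insert_star h s m w j"
          using g(1)[of j] star(1) by (cases "j \<le> m") (auto simp: insert_star_def w_def)
      qed
      ultimately show ?L by blast
    qed
  qed
qed

section \<open>Expansions of vectors\<close>

definition padded_digit :: "real \<Rightarrow> nat \<Rightarrow> real \<Rightarrow> nat \<Rightarrow> symb" where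
  "padded_digit \<beta> m x j = Digit (beta_digit \<beta> x (int m - int j))"

text \<open>The expansion of \<open>x\<close> with leading zeros such that the first letter has index \<open>m\<close>.\<close>

definition padded_expansion :: "real \<Rightarrow> nat \<Rightarrow> real \<Rightarrow> symb word" where
  "padded_expansion \<beta> m x = (\<lambda>j. if j \<le> m then padded_digit \<beta> m x j
     else if j = Suc m then Star else padded_digit \<beta> m x (j - 1))"

definition padded_vec_expansion :: "real \<Rightarrow> nat \<Rightarrow> real list \<Rightarrow> symb list word" where
  "padded_vec_expansion \<beta> m xs = (\<lambda>j. map (\<lambda>x. padded_expansion \<beta> m x j) xs)"

lemma padded_expansion_star_iff: "padded_expansion \<beta> m x j = Star \<longleftrightarrow> j = Suc m"
  by (simp add: padded_expansion_def padded_digit_def)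

lemma replicate_conc_expansion:
  assumes \<beta>: "\<beta> > 1"
  shows "replicate k (Digit 0) \<frown> expansion \<beta> x = padded_expansion \<beta> (k + top_index \<beta> x) x"
proof
  fix j
  define l where "l = top_index \<beta> x"
  have zero: "beta_digit \<beta> x i = 0" if "i > int l" for i
    using abs_digit_top[OF \<beta>, of x] that by (simp add: beta_digit_def l_def)
  have exp: "expansion \<beta> x = map (\<lambda>j. Digit (beta_digit \<beta> x (int l - int j))) [0..<Suc l] \<frown> [Star] \<frown>
      (\<lambda>j. Digit (beta_digit \<beta> x (- 1 - int j)))"
    by (simp only: expansion_def Let_def l_def)
  consider "j < k" | "k \<le> j" "j \<le> k + l" | "j = Suc (k + l)" | "j > Suc (k + l)" by linarith
  then show "(replicate k (Digit 0) \<frown> expansion \<beta> x) j = padded_expansion \<beta> (k + top_index \<beta> x) x j"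
  proof cases
    case 1
    then show ?thesis
      using zero[of "int k + int l - int j"]
      by (simp add: padded_expansion_def padded_digit_def flip: l_def)
  next
    case 2
    then show ?thesis
      unfolding exp
      by (simp add: padded_expansion_def padded_digit_def conc_def of_nat_diff algebra_simps del: upt_Suc flip: l_def)
  next
    case 3
    then show ?thesis
      unfolding exp by (simp add: padded_expansion_def padded_digit_def conc_def del: upt_Suc flip: l_def)
  next
    case 4
    then have "- 1 - int (j - k - Suc l - 1) = int (k + l) - int (j - 1)" "\<not> j - k < Suc l" "\<not> j < k"
        "\<not> j - k - Suc l < 1" "\<not> j \<le> k + l" "j \<noteq> Suc (k + l)"
      by linarith+
    then show ?thesis
      unfolding exp l_def[symmetric] padded_expansion_def padded_digit_def conc_def
      by (simp only: length_replicate length_map length_upt list.size if_False diff_zero One_nat_def) (simp add: algebra_simps)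
  qed
qed

text \<open>If the first digit is zero, only the tail remains, which is worth less than one unit of the first
  position.\<close>

lemma top_digit_eq_0_iff:
  assumes \<beta>: "\<beta> > 1" and x: "\<bar>x\<bar> < \<beta> ^ Suc m"
  shows "beta_digit \<beta> x (int m) = 0 \<longleftrightarrow> \<bar>x\<bar> < \<beta> ^ m"
proof
  assume "beta_digit \<beta> x (int m) = 0"
  then have zero: "abs_digit \<beta> x (int m - int 0) = 0" by (simp add: beta_digit_def split: if_splits)
  let ?c = "\<lambda>j. abs_digit \<beta> x (int m - int j)"
  have c: "nonneg_expansion \<beta> ?c" "\<beta> ^ Suc m * word_value \<beta> ?c = \<bar>x\<bar>"
    using abs_digit_expansion[OF \<beta> x] by blast+
  have "\<beta> * word_value \<beta> ?c = word_value \<beta> (suffix 1 ?c)"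
    unfolding word_value_rec_expansion(1)[OF \<beta> c(1)] zero by simp
  also have "\<dots> < 1"
    by (rule word_value_rec_expansion(3)[OF \<beta> nonneg_expansion_suffix[OF c(1)]])
  finally have "\<beta> ^ m * (\<beta> * word_value \<beta> ?c) < \<beta> ^ m * 1"
    using \<beta> by (intro mult_strict_left_mono) auto
  then show "\<bar>x\<bar> < \<beta> ^ m"
    using c(2) by (simp add: mult.left_commute mult.assoc)
next
  assume "\<bar>x\<bar> < \<beta> ^ m"
  then show "beta_digit \<beta> x (int m) = 0"
    by (intro beta_digit_eq_0[OF \<beta>]) (simp add: power_int_of_nat)
qed

text \<open>The least index, not below 0, that is large enough for all components: with it the vector
  expansion has no superfluous leading zeros.\<close>

definition leading_pos :: "real \<Rightarrow> real list \<Rightarrow> nat \<Rightarrow> bool" where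
  "leading_pos \<beta> xs m \<longleftrightarrow> (\<forall>x\<in>set xs. \<bar>x\<bar> < \<beta> ^ Suc m) \<and> (m = 0 \<or> (\<exists>x\<in>set xs. \<beta> ^ m \<le> \<bar>x\<bar>))"

lemma leading_pos_unique:
  assumes \<beta>: "\<beta> > 1" and m: "leading_pos \<beta> xs m" and n: "leading_pos \<beta> xs n"
  shows "m = n"
proof -
  have False if less: "leading_pos \<beta> xs m" "leading_pos \<beta> xs n" "m < n" for m n
  proof -
    obtain x where x: "x \<in> set xs" "\<beta> ^ n \<le> \<bar>x\<bar>" "\<bar>x\<bar> < \<beta> ^ Suc m"
      using less unfolding leading_pos_def by (metis not_less_zero)
    have "\<beta> ^ Suc m \<le> \<beta> ^ n" using \<beta> less(3) by (intro power_increasing) auto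
    with x show False by linarith
  qed
  then show ?thesis using m n by (metis linorder_neqE_nat)
qed

lemma leading_pos_exists:
  assumes \<beta>: "\<beta> > 1"
  shows "\<exists>m. leading_pos \<beta> xs m"
proof -
  let ?B = "\<lambda>m. \<forall>x\<in>set xs. \<bar>x\<bar> < \<beta> ^ Suc m"
  define m where "m = (LEAST m. ?B m)"
  have "?B (Max (insert 0 (top_index \<beta> ` set xs)))"
    using top_index_le_iff[OF \<beta>] by (metis List.finite_set Max_ge finite_imageI finite_insert image_eqI insertCI)
  then have "?B m" unfolding m_def by (rule LeastI)
  moreover have "m = 0 \<or> (\<exists>x\<in>set xs. \<beta> ^ m \<le> \<bar>x\<bar>)"
  proof (cases m)
    case (Suc k)
    then have "\<not> ?B k" using not_less_Least[of k ?B] by (simp add: m_def)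
    with Suc show ?thesis by (auto simp: not_less)
  qed simp
  ultimately show ?thesis unfolding leading_pos_def by blast
qed

lemma digit_in_signed_digits:
  assumes \<beta>: "\<beta> > 1" and x: "\<bar>x\<bar> < \<beta> ^ Suc m"
  shows "beta_digit \<beta> x (int m - int j) \<in> signed_digits \<beta>"
proof -
  have "signed_expansion \<beta> (\<lambda>j. beta_digit \<beta> x (int m - int j))"
    using signed_expansion_iff_beta_digit[OF \<beta>] x by blast
  from signed_expansion_bounded[OF this, of j] show ?thesis by (auto simp: signed_digits_def)
qed

lemma nth_padded_vec_expansion:
  "i < length xs \<Longrightarrow> padded_vec_expansion \<beta> m xs j ! i = padded_expansion \<beta> m (xs ! i) j"
  by (simp add: padded_vec_expansion_def)

lemma padded_vec_expansion_letter:
  "padded_vec_expansion \<beta> m xs j = (if j = Suc m then star_letter (length xs)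
     else map Digit (map (\<lambda>x. beta_digit \<beta> x (int m - int (if j \<le> m then j else j - 1))) xs))"
  by (auto simp: padded_vec_expansion_def padded_expansion_def padded_digit_def star_letter_def map_replicate_const)

lemma star_letter_if_star:
  assumes "a \<in> vec_alphabet \<beta> n" "i < n" "a ! i = Star"
  shows "a = star_letter n"
  using assms by (auto simp: vec_alphabet_def)

lemma first_letter_zero_iff:
  assumes \<beta>: "\<beta> > 1" and xs: "\<forall>x\<in>set xs. \<bar>x\<bar> < \<beta> ^ Suc m"
  shows "padded_vec_expansion \<beta> m xs 0 = zero_letter (length xs) \<longleftrightarrow> (\<forall>x\<in>set xs. \<bar>x\<bar> < \<beta> ^ m)"
proof -
  have "padded_vec_expansion \<beta> m xs 0 = zero_letter (length xs) \<longleftrightarrow> (\<forall>x\<in>set xs. beta_digit \<beta> x (int m) = 0)"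
    unfolding padded_vec_expansion_letter zero_letter_def all_set_conv_all_nth
    by (auto simp: list_eq_iff_nth_eq)
  then show ?thesis using top_digit_eq_0_iff[OF \<beta>] xs by blast
qed

text \<open>The letter \<open>Star\<close> occurs at the same position in all components, which determines how many leading
  zeros each component gets from the index of the first letter. The condition on the first letter then
  amounts to \<open>leading_pos\<close>.\<close>

lemma is_vec_expansion_iff:
  assumes \<beta>: "\<beta> > 1" and n: "length xs \<ge> 1"
  shows "is_vec_expansion \<beta> xs u \<longleftrightarrow> (\<exists>m. leading_pos \<beta> xs m \<and> u = padded_vec_expansion \<beta> m xs)"
proof
  assume u: "is_vec_expansion \<beta> xs u"
  let ?n = "length xs"
  have alph: "u j \<in> vec_alphabet \<beta> ?n" for j using u by (simp add: is_vec_expansion_def)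
  have len: "length (u j) = ?n" for j
    using alph[of j] unfolding vec_alphabet_def star_letter_def by auto
  have "\<forall>i<?n. \<exists>k. (\<lambda>j. u j ! i) = padded_expansion \<beta> (k + top_index \<beta> (xs ! i)) (xs ! i)"
    using u unfolding is_vec_expansion_def replicate_conc_expansion[OF \<beta>] by blast
  then obtain k where k: "\<And>i. i < ?n \<Longrightarrow> (\<lambda>j. u j ! i) = padded_expansion \<beta> (k i + top_index \<beta> (xs ! i)) (xs ! i)"
    by metis
  have pos: "0 < ?n" using n by linarith
  define m where "m = k 0 + top_index \<beta> (xs ! 0)"
  have same: "k i + top_index \<beta> (xs ! i) = m" if i: "i < ?n" for i
  proof -
    from fun_cong[OF k[OF pos], of "Suc m"] have "u (Suc m) ! 0 = Star"
      by (simp add: padded_expansion_def m_def)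
    then have "u (Suc m) = star_letter ?n"
      by (rule star_letter_if_star[OF alph pos])
    then have "u (Suc m) ! i = Star" using i by (simp add: star_letter_def)
    then have "padded_expansion \<beta> (k i + top_index \<beta> (xs ! i)) (xs ! i) (Suc m) = Star"
      using fun_cong[OF k[OF i], of "Suc m"] by simp
    then show ?thesis unfolding padded_expansion_star_iff by simp
  qed
  have eq: "u = padded_vec_expansion \<beta> m xs"
  proof
    fix j
    show "u j = padded_vec_expansion \<beta> m xs j"
    proof (rule nth_equalityI)
      fix i assume "i < length (u j)"
      then have i: "i < ?n" using len by simp
      show "u j ! i = padded_vec_expansion \<beta> m xs j ! i"
        using fun_cong[OF k[OF i], of j] unfolding same[OF i] nth_padded_vec_expansion[OF i] .
    qed (simp add: len padded_vec_expansion_def)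
  qed
  have bound: "\<forall>x\<in>set xs. \<bar>x\<bar> < \<beta> ^ Suc m"
  proof
    fix x assume "x \<in> set xs"
    then obtain i where i: "i < ?n" "x = xs ! i" by (auto simp: in_set_conv_nth)
    then have "top_index \<beta> x \<le> m" using same[OF i(1)] by simp
    then show "\<bar>x\<bar> < \<beta> ^ Suc m" using top_index_le_iff[OF \<beta>] by blast
  qed
  have "m = 0 \<or> (\<exists>x\<in>set xs. \<beta> ^ m \<le> \<bar>x\<bar>)"
  proof (cases "\<forall>i<?n. \<bar>xs ! i\<bar> < 1")
    case True
    then have "u 1 = star_letter ?n" using u by (simp add: is_vec_expansion_def)
    then have "u 1 ! 0 = Star" using pos by (simp add: star_letter_def)
    then have "padded_expansion \<beta> m (xs ! 0) 1 = Star"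
      unfolding eq nth_padded_vec_expansion[OF pos] .
    then show ?thesis unfolding padded_expansion_star_iff by simp
  next
    case False
    then have "u 0 \<noteq> zero_letter ?n" using u by (auto simp: is_vec_expansion_def)
    then show ?thesis unfolding eq first_letter_zero_iff[OF \<beta> bound] by (auto simp: not_less)
  qed
  with bound eq show "\<exists>m. leading_pos \<beta> xs m \<and> u = padded_vec_expansion \<beta> m xs"
    unfolding leading_pos_def by blast
next
  assume "\<exists>m. leading_pos \<beta> xs m \<and> u = padded_vec_expansion \<beta> m xs"
  then obtain m where bound: "\<forall>x\<in>set xs. \<bar>x\<bar> < \<beta> ^ Suc m" and lead: "m = 0 \<or> (\<exists>x\<in>set xs. \<beta> ^ m \<le> \<bar>x\<bar>)"
      and u: "u = padded_vec_expansion \<beta> m xs"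
    unfolding leading_pos_def by blast
  let ?n = "length xs"
  have "u j \<in> vec_alphabet \<beta> ?n" for j
  proof (cases "j = Suc m")
    case False
    let ?ds = "map (\<lambda>x. beta_digit \<beta> x (int m - int (if j \<le> m then j else j - 1))) xs"
    have "set ?ds \<subseteq> signed_digits \<beta>"
      unfolding set_map by (intro image_subsetI digit_in_signed_digits[OF \<beta>]) (use bound in blast)
    moreover have "u j = map Digit ?ds" using False unfolding u padded_vec_expansion_letter by simp
    moreover have "length ?ds = ?n" by simp
    ultimately show ?thesis unfolding vec_alphabet_def by blast
  qed (simp add: u padded_vec_expansion_letter vec_alphabet_def)
  moreover have "\<exists>k. (\<lambda>j. u j ! i) = replicate k (Digit 0) \<frown> expansion \<beta> (xs ! i)" if i: "i < ?n" for i
  proof -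
    have "\<bar>xs ! i\<bar> < \<beta> ^ Suc m" using bound i by simp
    then have "top_index \<beta> (xs ! i) \<le> m" using top_index_le_iff[OF \<beta>] by blast
    then have "m - top_index \<beta> (xs ! i) + top_index \<beta> (xs ! i) = m" by simp
    then have "replicate (m - top_index \<beta> (xs ! i)) (Digit 0) \<frown> expansion \<beta> (xs ! i) = padded_expansion \<beta> m (xs ! i)"
      unfolding replicate_conc_expansion[OF \<beta>] by simp
    moreover have "(\<lambda>j. u j ! i) = padded_expansion \<beta> m (xs ! i)"
      by (simp add: u nth_padded_vec_expansion[OF i])
    ultimately show ?thesis by metis
  qed
  moreover have "if \<forall>i<?n. \<bar>xs ! i\<bar> < 1 then u 0 = zero_letter ?n \<and> u 1 = star_letter ?n else u 0 \<noteq> zero_letter ?n"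
  proof (cases "\<forall>x\<in>set xs. \<bar>x\<bar> < 1")
    case True
    have "m = 0"
    proof (rule ccontr)
      assume "m \<noteq> 0"
      then obtain x where x: "x \<in> set xs" "\<beta> ^ m \<le> \<bar>x\<bar>" using lead by blast
      have "1 \<le> \<beta> ^ m" using \<beta> by (intro one_le_power) simp
      moreover have "\<bar>x\<bar> < 1" using x(1) True by blast
      ultimately show False using x(2) by linarith
    qed
    then show ?thesis
      using True first_letter_zero_iff[OF \<beta> bound] by (simp add: u padded_vec_expansion_letter[of _ _ _ "Suc 0"])
  next
    case False
    then obtain x where x: "x \<in> set xs" "\<not> \<bar>x\<bar> < 1" by blast
    then have "\<not> (\<forall>i<?n. \<bar>xs ! i\<bar> < 1)" by (metis in_set_conv_nth)
    moreover have "\<not> (\<forall>x\<in>set xs. \<bar>x\<bar> < \<beta> ^ m)" using lead x by (auto simp: not_less)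
    ultimately show ?thesis
      unfolding u first_letter_zero_iff[OF \<beta> bound] by (simp only: if_False not_False_eq_True)
  qed
  ultimately show "is_vec_expansion \<beta> xs u" unfolding is_vec_expansion_def by blast
qed

lemma vec_expansion_eq:
  assumes \<beta>: "\<beta> > 1" and n: "length xs \<ge> 1" and m: "leading_pos \<beta> xs m"
  shows "vec_expansion \<beta> xs = padded_vec_expansion \<beta> m xs"
  unfolding vec_expansion_def is_vec_expansion_iff[OF \<beta> n]
  using m leading_pos_unique[OF \<beta> m] by (intro the_equality) blast+

section \<open>From definable to recognizable\<close>

lemma omega_regular_first_letter: "omega_regular (\<lambda>w. p (w 0))"
proof (rule omega_regularI[where Q = "UNIV :: bool set" and I = "{True}" and F = "{False}" and
      \<delta> = "\<lambda>s a s'. (s \<longrightarrow> p a) \<and> \<not> s'"])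
  fix w
  show "p (w 0) \<longleftrightarrow> buchi_accepts UNIV (\<lambda>s a s'. (s \<longrightarrow> p a) \<and> \<not> s') {True} {False} w"
  proof
    assume "p (w 0)"
    moreover have "\<exists>\<^sub>\<infinity>j::nat. j \<noteq> 0" unfolding INFM_nat by auto
    ultimately show "buchi_accepts UNIV (\<lambda>s a s'. (s \<longrightarrow> p a) \<and> \<not> s') {True} {False} w"
      unfolding buchi_accepts_def by (intro exI[of _ "\<lambda>j. j = 0"]) auto
  qed (auto simp: buchi_accepts_def)
qed simp

lemma finite_vec_alphabet: "finite (vec_alphabet \<beta> n)"
proof -
  have "finite {ds. set ds \<subseteq> signed_digits \<beta> \<and> length ds = n}"
    by (rule finite_lists_length_eq) (simp add: signed_digits_def)
  then have "finite (map Digit ` {ds. set ds \<subseteq> signed_digits \<beta> \<and> length ds = n})" by simp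
  then show ?thesis
    unfolding vec_alphabet_def by (simp add: setcompr_eq_image conj_commute)
qed

lemma omega_regular_imp_buchi:
  assumes "omega_regular P" "finite A" "\<And>w j. P w \<Longrightarrow> w j \<in> A"
  shows "\<exists>M :: (nat, 'a) buchi. buchi_automaton A M \<and> language M = {w. P w}"
proof -
  obtain Q :: "nat set" and \<delta> I F where Q: "finite Q" and P: "\<And>w. P w \<longleftrightarrow> buchi_accepts Q \<delta> I F w"
    using assms(1) by (rule omega_regularE) blast
  define M :: "(nat, 'a) buchi" where
    "M = \<lparr>states = Q, transitions = {(p, a, q). p \<in> Q \<and> a \<in> A \<and> q \<in> Q \<and> \<delta> p a q},
          initial = I \<inter> Q, terminal = F \<inter> Q\<rparr>"
  have "accepts M w \<longleftrightarrow> P w" for w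
  proof
    assume "accepts M w"
    then obtain r where "r 0 \<in> I" "\<forall>j. r j \<in> Q \<and> \<delta> (r j) (w j) (r (Suc j))" "\<exists>\<^sub>\<infinity>j. r j \<in> F \<inter> Q"
      by (auto simp: accepts_def M_def)
    moreover from this(3) have "\<exists>\<^sub>\<infinity>j. r j \<in> F" by (rule INFM_mono) auto
    ultimately show "P w" unfolding P buchi_accepts_def by blast
  next
    assume w: "P w"
    then obtain r where r: "r 0 \<in> I" "\<And>j. r j \<in> Q" "\<And>j. \<delta> (r j) (w j) (r (Suc j))" "\<exists>\<^sub>\<infinity>j. r j \<in> F"
      unfolding P buchi_accepts_def by blast
    have "\<exists>\<^sub>\<infinity>j. r j \<in> F \<inter> Q" using r(4) by (rule INFM_mono) (use r(2) in auto)
    with r assms(3)[OF w] show "accepts M w" by (auto simp: accepts_def M_def intro!: exI[of _ r])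
  qed
  moreover have "buchi_automaton A M"
    using Q assms(2) by (auto simp: buchi_automaton_def M_def)
  ultimately show ?thesis unfolding language_def by blast
qed

definition digit_letter :: "nat \<Rightarrow> (nat \<Rightarrow> int) \<Rightarrow> symb list" where
  "digit_letter n ds = map (\<lambda>i. Digit (ds i)) [0..<n]"

lemma insert_star_eq_padded:
  assumes tr: "\<And>i j. i < length xs \<Longrightarrow> snd (w j) i = beta_digit \<beta> (xs ! i) (int m - int j)"
  shows "insert_star (digit_letter (length xs)) (star_letter (length xs)) m w = padded_vec_expansion \<beta> m xs"
proof
  fix j
  have "digit_letter (length xs) (snd (w k)) = map Digit (map (\<lambda>x. beta_digit \<beta> x (int m - int k)) xs)" for k
    by (rule nth_equalityI) (simp_all add: digit_letter_def tr)
  then show "insert_star (digit_letter (length xs)) (star_letter (length xs)) m w j = padded_vec_expansion \<beta> m xs j"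
    by (simp add: insert_star_def padded_vec_expansion_letter)
qed

text \<open>If the first letter holds the units digits, it may be zero: this happens exactly when all
  components have modulus less than 1. Otherwise it must not be zero.\<close>

definition leading :: "nat \<Rightarrow> letter word \<Rightarrow> bool" where
  "leading n w \<longleftrightarrow> fst (w 0) \<or> (\<exists>i<n. snd (w 0) i \<noteq> 0)"

lemma leading_pos_iff:
  assumes \<beta>: "\<beta> > 1" and m: "\<And>j. fst (w j) \<longleftrightarrow> j = m"
    and bound: "\<forall>x\<in>set xs. \<bar>x\<bar> < \<beta> ^ Suc m"
    and tr: "\<And>i j. i < length xs \<Longrightarrow> snd (w j) i = beta_digit \<beta> (xs ! i) (int m - int j)"
  shows "leading_pos \<beta> xs m \<longleftrightarrow> leading (length xs) w"
proof -
  have "snd (w 0) i \<noteq> 0 \<longleftrightarrow> \<beta> ^ m \<le> \<bar>xs ! i\<bar>" if "i < length xs" for i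
    using top_digit_eq_0_iff[OF \<beta>, of "xs ! i" m] bound that tr[OF that, of 0] by (auto simp: not_less)
  then have "(\<exists>i<length xs. snd (w 0) i \<noteq> 0) \<longleftrightarrow> (\<exists>i<length xs. \<beta> ^ m \<le> \<bar>xs ! i\<bar>)"
    by blast
  also have "\<dots> \<longleftrightarrow> (\<exists>x\<in>set xs. \<beta> ^ m \<le> \<bar>x\<bar>)"
    by (metis in_set_conv_nth)
  finally have "(\<exists>i<length xs. snd (w 0) i \<noteq> 0) \<longleftrightarrow> (\<exists>x\<in>set xs. \<beta> ^ m \<le> \<bar>x\<bar>)" .
  then show ?thesis
    unfolding leading_pos_def leading_def using bound m by auto
qed

theorem theorem22:
  fixes \<beta> :: real and n :: nat and X :: "real list set"
  assumes "pisot \<beta>"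
    and "n \<ge> 1"
    and "X \<subseteq> vectors n"
    and "beta_definable \<beta> n X"
  shows "beta_recognizable \<beta> n X"
proof -
  have \<beta>: "\<beta> > 1" using assms(1) by (simp add: pisot_def)
  obtain \<phi> where \<phi>: "free_vars \<phi> \<subseteq> {..<n}" and X: "X = {xs \<in> vectors n. sat \<beta> (\<lambda>i. xs ! i) \<phi>}"
    using assms(4) unfolding beta_definable_def by blast
  define P where "P w \<longleftrightarrow> (well_formed \<beta> {..<n} w \<and> sat \<beta> (valuation \<beta> w) \<phi>) \<and> leading n w" for w
  define L where "L u \<longleftrightarrow> (\<exists>w m. P w \<and> (\<forall>j. fst (w j) \<longleftrightarrow> j = m) \<and>
      u = insert_star (digit_letter n) (star_letter n) m w)" for u
  have "omega_regular P"
    unfolding P_def leading_def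
    by (rule omega_regular_conj[OF omega_regular_sat[OF assms(1) finite_lessThan \<phi>] omega_regular_first_letter])
  from omega_regular_insert_star[OF this] have reg: "omega_regular L"
    unfolding L_def .
  have L_iff: "L u \<longleftrightarrow> (\<exists>xs\<in>X. \<exists>m. leading_pos \<beta> xs m \<and> u = padded_vec_expansion \<beta> m xs)" for u
  proof
    assume "L u"
    then obtain w m where P: "P w" and m: "\<And>j. fst (w j) \<longleftrightarrow> j = m"
        and u: "u = insert_star (digit_letter n) (star_letter n) m w"
      unfolding L_def by blast
    define xs where "xs = map (valuation \<beta> w) [0..<n]"
    have len: "length xs = n" by (simp add: xs_def)
    have tr: "\<bar>xs ! i\<bar> < \<beta> ^ Suc m \<and> track i w = (\<lambda>j. beta_digit \<beta> (xs ! i) (int m - int j))" if "i < length xs" for i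
    proof -
      have "signed_expansion \<beta> (track i w)"
        using P that len by (simp add: P_def well_formed_def)
      moreover have "\<beta> ^ Suc m * word_value \<beta> (track i w) = xs ! i"
        using that len by (simp add: xs_def valuation_def unit_posI[of w m, OF m])
      ultimately show ?thesis
        using signed_expansion_iff_beta_digit[OF \<beta>, of "track i w" m "xs ! i"] by blast
    qed
    have digit: "snd (w j) i = beta_digit \<beta> (xs ! i) (int m - int j)" if "i < length xs" for i j
      using tr[OF that] by (simp add: track_def fun_eq_iff)
    have bound: "\<forall>x\<in>set xs. \<bar>x\<bar> < \<beta> ^ Suc m"
      using tr by (auto simp: in_set_conv_nth)
    have "sat \<beta> (\<lambda>i. xs ! i) \<phi>"
    proof -
      have "sat \<beta> (\<lambda>i. xs ! i) \<phi> \<longleftrightarrow> sat \<beta> (valuation \<beta> w) \<phi>"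
        by (rule sat_cong) (use \<phi> in \<open>auto simp: xs_def\<close>)
      then show ?thesis using P by (simp add: P_def)
    qed
    then have "xs \<in> X" by (simp add: X vectors_def len)
    moreover have "leading_pos \<beta> xs m"
      using leading_pos_iff[OF \<beta> m bound digit] P len by (simp add: P_def)
    moreover have "u = padded_vec_expansion \<beta> m xs"
      using insert_star_eq_padded[OF digit] unfolding u len .
    ultimately show "\<exists>xs\<in>X. \<exists>m. leading_pos \<beta> xs m \<and> u = padded_vec_expansion \<beta> m xs" by blast
  next
    assume "\<exists>xs\<in>X. \<exists>m. leading_pos \<beta> xs m \<and> u = padded_vec_expansion \<beta> m xs"
    then obtain xs m where xs: "xs \<in> X" and lead: "leading_pos \<beta> xs m" and u: "u = padded_vec_expansion \<beta> m xs" by blast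
    have len: "length xs = n" using xs by (simp add: X vectors_def)
    define w where "w = (\<lambda>j. (j = m, \<lambda>i. beta_digit \<beta> (xs ! i) (int m - int j)))"
    have m: "fst (w j) \<longleftrightarrow> j = m" for j by (simp add: w_def)
    have digit: "snd (w j) i = beta_digit \<beta> (xs ! i) (int m - int j)" for i j by (simp add: w_def)
    have bound: "\<forall>x\<in>set xs. \<bar>x\<bar> < \<beta> ^ Suc m" using lead by (simp add: leading_pos_def)
    have tr: "signed_expansion \<beta> (track i w) \<and> \<beta> ^ Suc m * word_value \<beta> (track i w) = xs ! i" if "i < n" for i
    proof -
      have "\<bar>xs ! i\<bar> < \<beta> ^ Suc m" using bound that len by simp
      moreover have "track i w = (\<lambda>j. beta_digit \<beta> (xs ! i) (int m - int j))" by (simp add: track_def digit)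
      ultimately show ?thesis
        using signed_expansion_iff_beta_digit[OF \<beta>, of "track i w" m "xs ! i"] by blast
    qed
    have "well_formed \<beta> {..<n} w" using tr by (simp add: well_formed_def m)
    moreover have "sat \<beta> (valuation \<beta> w) \<phi> \<longleftrightarrow> sat \<beta> (\<lambda>i. xs ! i) \<phi>"
      by (rule sat_cong) (use \<phi> tr in \<open>auto simp: valuation_def unit_posI[of w m, OF m]\<close>)
    moreover have "leading n w"
      using leading_pos_iff[OF \<beta> m bound digit] lead len by simp
    ultimately have "P w" using xs by (simp add: P_def X)
    moreover have "u = insert_star (digit_letter n) (star_letter n) m w"
      using insert_star_eq_padded[OF digit] unfolding u len by simp
    ultimately show "L u" unfolding L_def using m by blast
  qed
  have len: "length xs \<ge> 1" if "xs \<in> X" for xs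
    using that assms(2,3) by (auto simp: vectors_def)
  have L_image: "{u. L u} = vec_expansion \<beta> ` X"
  proof (intro equalityI subsetI)
    fix u assume "u \<in> {u. L u}"
    then obtain xs m where "xs \<in> X" "leading_pos \<beta> xs m" "u = padded_vec_expansion \<beta> m xs"
      using L_iff by blast
    then show "u \<in> vec_expansion \<beta> ` X"
      using vec_expansion_eq[OF \<beta> len] by (intro image_eqI[of _ _ xs]) simp_all
  next
    fix u assume "u \<in> vec_expansion \<beta> ` X"
    then obtain xs where xs: "xs \<in> X" "u = vec_expansion \<beta> xs" by blast
    obtain m where "leading_pos \<beta> xs m" using leading_pos_exists[OF \<beta>] by blast
    with xs vec_expansion_eq[OF \<beta> len[OF xs(1)]] show "u \<in> {u. L u}"
      using L_iff by auto
  qed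
  have letters: "u j \<in> vec_alphabet \<beta> n" if Lu: "L u" for u j
  proof -
    obtain xs m where xs: "xs \<in> X" "leading_pos \<beta> xs m" "u = padded_vec_expansion \<beta> m xs"
      using Lu L_iff by blast
    then have "is_vec_expansion \<beta> xs u"
      using is_vec_expansion_iff[OF \<beta> len[OF xs(1)]] by blast
    then show ?thesis
      using xs(1) assms(3) by (auto simp: is_vec_expansion_def vectors_def)
  qed
  have "\<exists>M :: (nat, symb list) buchi. buchi_automaton (vec_alphabet \<beta> n) M \<and> language M = {u. L u}"
    by (rule omega_regular_imp_buchi[OF reg finite_vec_alphabet]) (rule letters)
  then show ?thesis
    using assms(3) unfolding beta_recognizable_def L_image by simp
qed

end
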